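(* Let $X$ be an infinite-dimensional Banach space and let $p_{X^*}$ be the supremal type of $X^*$. If $p_{X^*}>1$, then, for every $k\in\mathbb N$, $$\operatorname{Helly}_X(k)\ge k^{-1+\frac1{p_{X^*}}}.$$ If $X^*$ has type $p_{X^*}$, this matches the exponent in the upper bound $\operatorname{Helly}_X(k)\le 6\,T_{p_{X^*}}(X^* )\,k^{-1+\frac1{p_{X^*}}}$ coming from the type $p_{X^*}$ inequality for $X^*$.
   Context: A Banach space $E$ has Rademacher type $p\in[1,2]$ if there is a constant $T<\infty$ such that for every finite sequence $u_1,\dots,u_m\in E$, $\left(\mathbb E\|\sum_i\epsilon_i u_i\|^p\right)^{1/p}\le T\left(\sum_i\|u_i\|^p\right)^{1/p}$, where $\epsilon_i$ are independent uniform $\pm1$ random variables; $T_p(E)$ is the least such $T$. The supremal type is $p_E=\sup\{p\in[1,2]: E\text{ has type }p\}$. $\mathbf B_X$ is the closed unit ball of $X$. $\operatorname{Helly}_X(k)$ is the infimum of all $\alpha>0$ such that: for every finite family $\mathcal F$ of convex subsets of $\mathbf B_X$, if every subfamily of $\mathcal F$ of size at most $k$ has non-empty intersection, then there is $x\in X$ with $\operatorname{dist}(x,C)\le\alpha$ for every $C\in\mathcal F$. The upper bound $\operatorname{Helly}_X(k)\le 6\,T_p(X^* )\,k^{-1+1/p}$, valid when $X^*$ has type $p>1$, is a previously known result, mentioned only for comparison of exponents. *)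

theory Defs
  imports "HOL-Probability.Probability"
begin

text \<open>The law of \<open>m\<close> independent uniform signs \<open>\<epsilon> 0, \<dots>, \<epsilon> (m - 1)\<close>.\<close>

definition rademacher_pmf :: "nat \<Rightarrow> (nat \<Rightarrow> real) pmf" where
  "rademacher_pmf m = Pi_pmf {..<m} 0 (\<lambda>_. pmf_of_set {-1, 1})"

definition has_rademacher_type :: "'e::banach itself \<Rightarrow> real \<Rightarrow> bool" where
  "has_rademacher_type _ p \<longleftrightarrow> 1 \<le> p \<and> p \<le> 2 \<and>
     (\<exists>T::real. \<forall>(m::nat) (u::nat \<Rightarrow> 'e).
        (measure_pmf.expectation (rademacher_pmf m)
            (\<lambda>\<epsilon>. norm (\<Sum>i<m. \<epsilon> i *\<^sub>R u i) powr p)) powr (1 / p)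
          \<le> T * (\<Sum>i<m. norm (u i) powr p) powr (1 / p))"

text \<open>The supremum is over a nonempty bounded set, since every Banach space has type \<open>1\<close>.\<close>

definition supremal_type :: "'e::banach itself \<Rightarrow> real" where
  "supremal_type E = Sup {p. has_rademacher_type E p}"

text \<open>
  Families are finite sets of sets.  For \<open>k \<ge> 1\<close> the intersection hypothesis forces
  every member of the family to be nonempty, so \<open>infdist x C\<close> is the genuine distance (the
  library's convention \<open>infdist x {} = 0\<close> plays no role), and \<open>\<alpha> = 1\<close> is always admissible
  (take \<open>x = 0\<close>), so the infimum is over a nonempty set.  The value at \<open>k = 0\<close> is not meaningful.
\<close>

definition helly :: "'a::banach itself \<Rightarrow> nat \<Rightarrow> real" where
  "helly _ k = Inf {\<alpha>. 0 < \<alpha> \<and>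
     (\<forall>F :: 'a set set.
        finite F \<and> (\<forall>C\<in>F. convex C \<and> C \<subseteq> cball 0 1) \<and>
        (\<forall>G. G \<subseteq> F \<and> card G \<le> k \<longrightarrow> \<Inter>G \<noteq> {}) \<longrightarrow>
        (\<exists>x. \<forall>C\<in>F. infdist x C \<le> \<alpha>))}"

end

theory Submission
  imports Defs "Jordan_Normal_Form.Determinant"
begin

text \<open>
  Let \<open>p\<close> be the supremal type of \<open>X*\<close> and suppose that for every \<open>N\<close> there are \<open>N\<close> functionals in the
  unit ball of \<open>X*\<close> such that every linear combination of at most \<open>k\<close> of them has norm at least \<open>c\<close>
  times the \<open>l\<^sup>1\<close>-norm of its coefficients.  By minimax any \<open>k\<close> of the sets \<open>{z. c' < f i z}\<close>
  (\<open>c' < c\<close>) meet in the unit ball.  As \<open>X*\<close> has some type larger than 1, the signs of the functionals can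
  be chosen so that their average is small, and then no point is much closer than \<open>c\<close> to all these sets.
  So it remains to find such systems with \<open>c\<close> arbitrarily close to \<open>k powr (-1 + 1/p)\<close>.
  Krivine's theorem is not needed for this.

  For \<open>p = 2\<close> the argument of Dvoretzky and Rogers suffices: if the contraction from euclidean \<open>n\<close>-space
  to \<open>X\<close> given by \<open>z\<close> nearly maximises a determinant, its adjoint maps some functionals of the unit ball
  almost onto the first \<open>m\<close> unit vectors.

  For \<open>p < 2\<close> let \<open>c = k powr (-1 + 1/q)\<close> with \<open>p < q < 2\<close>.  If there is no such system for some \<open>N\<close>,
  iteration gives, among any \<open>(N + 1) k^j\<close> unit vectors, an \<open>l\<^sup>1\<close>-normalised combination of norm at
  most \<open>c^j\<close>.  This bounds the fat-shattering dimension of the unit ball of \<open>X\<close>, viewed as a class of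
  functions on a finite set of functionals, hence its uniform metric entropy, and chaining gives
  \<open>E |sum of \<epsilon> i * f i|\<^sup>2 \<le> (C (J + 1)\<^sup>2 (k c)^J)\<^sup>2\<close> for \<open>k^J\<close> vectors of the unit ball.
  Decomposing a sequence by the size of its terms, \<open>X*\<close> has every type below \<open>q\<close>, contradicting \<open>p < q\<close>.
\<close>

section \<open>A finite minimax theorem\<close>

text \<open>A hyperplane separates \<open>A\<close> from the open quadrant \<open>B\<close>. Since
  \<open>B\<close> is unbounded in both coordinate directions, the normal \<open>(p, q)\<close> has
  nonnegative entries, and dividing by \<open>p + q\<close> turns them into weights.\<close>

lemma convex_separation_quadrant:
  fixes A :: "(real \<times> real) set"
  assumes A: "convex A" and dis: "\<And>u v. (u, v) \<in> A \<Longrightarrow> u \<le> c \<or> v \<le> c"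
  shows "\<exists>l::real. 0 \<le> l \<and> l \<le> 1 \<and> (\<forall>(u, v)\<in>A. (1 - l) * u + l * v \<le> c)"
proof (cases "A = {}")
  case True
  then show ?thesis by (intro exI[of _ 0]) auto
next
  case False
  define B where "B = {c<..} \<times> {c<..}"
  have "convex B" unfolding B_def by (intro convex_Times) (auto simp: convex_real_interval)
  moreover have "B \<noteq> {}" "A \<inter> B = {}"
    using dis by (force simp: B_def gt_ex)+
  ultimately obtain a b where a: "a \<noteq> 0" and aA: "\<And>x. x \<in> A \<Longrightarrow> inner a x \<le> b"
    and aB: "\<And>x. x \<in> B \<Longrightarrow> inner a x \<ge> b"
    using separating_hyperplane_sets[OF A \<open>convex B\<close> False] by blast
  obtain p q where pq: "a = (p, q)" by (cases a)
  have B: "b \<le> p * (c + s) + q * (c + t)" if "s > 0" "t > 0" for s t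
    using aB[of "(c + s, c + t)"] that by (simp add: B_def pq)
  have p: "p \<ge> 0"
  proof (rule ccontr)
    assume "\<not> p \<ge> 0"
    then have p: "p < 0" by simp
    \<comment> \<open>A point this far out in \<open>B\<close> pushes \<open>inner a\<close> below
      its lower bound \<open>b\<close>.\<close>
    define s where "s = (\<bar>p * c + q * (c + 1) - b\<bar> + 1) / (- p)"
    have "s > 0" using p by (simp add: s_def divide_pos_neg zero_less_divide_iff)
    then have "b \<le> p * (c + s) + q * (c + 1)" using B[of s 1] by simp
    moreover have "p * s = - (\<bar>p * c + q * (c + 1) - b\<bar> + 1)" using p by (simp add: s_def)
    ultimately show False by (simp add: algebra_simps)
  qed
  have q: "q \<ge> 0"
  proof (rule ccontr)
    assume "\<not> q \<ge> 0"
    then have p: "q < 0" by simp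
    define s where "s = (\<bar>p * (c + 1) + q * c - b\<bar> + 1) / (- q)"
    have "s > 0" using p by (simp add: s_def divide_pos_neg zero_less_divide_iff)
    then have "b \<le> p * (c + 1) + q * (c + s)" using B[of 1 s] by simp
    moreover have "q * s = - (\<bar>p * (c + 1) + q * c - b\<bar> + 1)" using p by (simp add: s_def)
    ultimately show False by (simp add: algebra_simps)
  qed
  have pq0: "p + q > 0" using a p q by (auto simp: pq zero_prod_def)
  have b: "b \<le> (p + q) * c"
  proof (rule field_le_epsilon)
    fix e :: real assume "e > 0"
    then show "b \<le> (p + q) * c + e"
    proof -
      define d where "d = e / (p + q)"
      have "d > 0" "(p + q) * d = e" using \<open>e > 0\<close> pq0 by (auto simp: d_def)
      then show ?thesis using B[of d d] by (simp add: algebra_simps)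
    qed
  qed
  show ?thesis
  proof (intro exI[of _ "q / (p + q)"] conjI ballI)
    show "0 \<le> q / (p + q)" "q / (p + q) \<le> 1" using p q pq0 by auto
    fix x assume "x \<in> A"
    then show "case x of (u, v) \<Rightarrow> (1 - q / (p + q)) * u + q / (p + q) * v \<le> c"
    proof (cases x)
      case (Pair u v)
      have "p * u + q * v \<le> (p + q) * c"
        using aA[OF \<open>x \<in> A\<close>] b by (simp add: pq Pair)
      moreover have "(1 - q / (p + q)) * u + q / (p + q) * v = (p * u + q * v) / (p + q)"
      proof -
        have "1 - q / (p + q) = p / (p + q)" using pq0 by (simp add: diff_divide_eq_iff)
        then show ?thesis by (simp add: add_divide_distrib)
      qed
      ultimately show ?thesis using pq0 by (simp add: Pair pos_divide_le_eq mult.commute)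
    qed
  qed
qed

text \<open>Induction on \<open>S\<close>. Where \<open>f x\<close> exceeds \<open>c\<close>, the
  induction hypothesis supplies weights \<open>w\<close> on \<open>S\<close>. The pairs formed by
  the \<open>w\<close>-average and \<open>f x\<close> then miss the open quadrant, and planar
  separation gives the mixing weight \<open>l\<close> of \<open>x\<close>.\<close>

lemma finite_minimax:
  fixes f :: "'i \<Rightarrow> 'b::real_vector \<Rightarrow> real"
  assumes "finite S" "S \<noteq> {}" "convex Z" "\<And>i. i \<in> S \<Longrightarrow> linear (f i)"
    "\<And>z. z \<in> Z \<Longrightarrow> \<exists>i\<in>S. f i z \<le> c"
  shows "\<exists>w. (\<forall>i\<in>S. (0::real) \<le> w i) \<and> sum w S = 1 \<and> (\<forall>z\<in>Z. (\<Sum>i\<in>S. w i * f i z) \<le> c)"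
  using assms
proof (induction S arbitrary: Z rule: finite_ne_induct)
  case (singleton x)
  then show ?case by (intro exI[of _ "\<lambda>_. 1"]) auto
next
  case (insert x S)
  define Z' where "Z' = Z \<inter> {z. f x z > c}"
  have lx: "linear (f x)" using insert.prems by auto
  have "convex (f x -` {c<..})"
    by (intro convex_linear_vimage[OF lx]) (auto simp: convex_real_interval)
  then have "convex Z'" unfolding Z'_def using insert.prems(1)
    by (intro convex_Int) (auto simp: vimage_def greaterThan_def)
  moreover have "\<exists>i\<in>S. f i z \<le> c" if "z \<in> Z'" for z
    using insert.prems(3)[of z] that by (auto simp: Z'_def)
  ultimately obtain w where w: "\<And>i. i \<in> S \<Longrightarrow> 0 \<le> w i" "sum w S = 1"
    and wZ: "\<And>z. z \<in> Z' \<Longrightarrow> (\<Sum>i\<in>S. w i * f i z) \<le> c"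
    using insert.IH[of Z'] insert.prems(2) by (metis insertI2)
  define g where "g z = (\<Sum>i\<in>S. w i * f i z)" for z
  have lg: "linear g"
  proof (rule linearI)
    show "g (a + b) = g a + g b" for a b
      using insert.prems(2) by (auto simp: g_def linear_add distrib_left sum.distrib intro!: sum.cong)
    show "g (r *\<^sub>R a) = r *\<^sub>R g a" for r a
      unfolding g_def sum_distrib_left scaleR_conv_of_real
      using insert.prems(2) by (auto simp: linear_scale sum_distrib_left intro!: sum.cong)
  qed
  have lin: "linear (\<lambda>z. (g z, f x z))"
    using lg lx by (auto intro!: linearI simp: linear_add linear_scale)
  have "convex ((\<lambda>z. (g z, f x z)) ` Z)"
    by (rule convex_linear_image[OF lin insert.prems(1)])
  then obtain l where l: "0 \<le> l" "l \<le> 1"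
    and lZ: "\<And>z. z \<in> Z \<Longrightarrow> (1 - l) * g z + l * f x z \<le> c"
    using convex_separation_quadrant[of "(\<lambda>z. (g z, f x z)) ` Z" c] wZ
    by (force simp: Z'_def g_def)
  define w' where "w' i = (if i = x then l else (1 - l) * w i)" for i
  have S: "(\<Sum>i\<in>insert x S. w' i * h i) = l * h x + (1 - l) * (\<Sum>i\<in>S. w i * h i)" for h
  proof -
    have "(\<Sum>i\<in>S. w' i * h i) = (\<Sum>i\<in>S. (1 - l) * w i * h i)"
      using insert.hyps by (intro sum.cong) (auto simp: w'_def)
    then show ?thesis using insert.hyps by (simp add: w'_def sum_distrib_left mult.assoc)
  qed
  show ?case
  proof (intro exI[of _ w'] conjI ballI)
    fix i assume "i \<in> insert x S" then show "0 \<le> w' i" using l w by (auto simp: w'_def)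
  next
    show "sum w' (insert x S) = 1" using S[of "\<lambda>_. 1"] w by simp
  next
    fix z assume "z \<in> Z" then show "(\<Sum>i\<in>insert x S. w' i * f i z) \<le> c"
      using lZ[of z] by (simp add: S g_def algebra_simps)
  qed
qed

section \<open>Separating functionals\<close>

text \<open>
  A minimal sublinear functional is linear: \<open>q x = (INF t\<in>{0..}. p (x + t *\<^sub>R y) - t * p y)\<close> is
  sublinear and below \<open>p\<close>, so \<open>q = p\<close>, which at \<open>t = 1\<close> says that \<open>p\<close> is superadditive.
\<close>

lemma linear_below_sublinear:
  fixes p0 :: "'a::real_vector \<Rightarrow> real"
  assumes "\<And>x y. p0 (x + y) \<le> p0 x + p0 y" "\<And>t x. t > 0 \<Longrightarrow> p0 (t *\<^sub>R x) = t * p0 x"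
  shows "\<exists>p. linear p \<and> (\<forall>x. p x \<le> p0 x)"
proof -
  define Sub where "Sub = {p::'a \<Rightarrow> real. (\<forall>x y. p (x + y) \<le> p x + p y) \<and>
     (\<forall>t x. t > 0 \<longrightarrow> p (t *\<^sub>R x) = t * p x) \<and> (\<forall>x. p x \<le> p0 x)}"
  have zero: "p 0 = 0" if "p \<in> Sub" for p
  proof -
    have "p (2 *\<^sub>R 0) = 2 * p 0" using that unfolding Sub_def by (auto simp del: scaleR_zero_right)
    then show ?thesis by simp
  qed
  have lower: "- p0 (- x) \<le> p x" if "p \<in> Sub" for p x
  proof -
    have "p (x + - x) \<le> p x + p (- x)" "p (- x) \<le> p0 (- x)" using that unfolding Sub_def by blast+
    then show ?thesis using zero[OF that] by simp
  qed
  define r where "r = {(p, q). p \<in> Sub \<and> q \<in> Sub \<and> (\<forall>x. q x \<le> (p x :: real))}"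
  have "\<exists>m\<in>Field r. \<forall>a\<in>Field r. (m, a) \<in> r \<longrightarrow> a = m"
  proof (rule Zorns_po_lemma)
    have "trans r" unfolding r_def trans_def by (auto intro: order_trans)
    moreover have "antisym r" unfolding r_def antisym_def by (auto intro!: ext order_antisym)
    moreover have "refl_on (Field r) r" by (auto simp: refl_on_def r_def Field_def)
    ultimately show "Partial_order r"
      by (auto simp: partial_order_on_def preorder_on_def Field_def)
  next
    fix C assume C: "C \<in> Chains r"
    have sub: "C \<subseteq> Sub" using C by (auto simp: Chains_def r_def)
    have p0: "p0 \<in> Sub" using assms by (auto simp: Sub_def)
    have FS: "Field r = Sub" by (auto simp: Field_def r_def)
    show "\<exists>u\<in>Field r. \<forall>a\<in>C. (a, u) \<in> r"
    proof (cases "C = {}")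
      case True then show ?thesis using p0 FS by auto
    next
      case False
      define u where "u x = (INF p\<in>C. p x)" for x
      have bdd: "bdd_below ((\<lambda>p. p x) ` C)" for x
        using lower sub by (intro bdd_belowI[of _ "- p0 (- x)"]) auto
      have le: "u x \<le> p x" if "p \<in> C" for p x
        unfolding u_def by (rule cINF_lower[OF bdd that])
      have ge: "b \<le> u x" if "\<And>p. p \<in> C \<Longrightarrow> b \<le> p x" for b x
        unfolding u_def by (rule cINF_greatest[OF False that])
      have "u (x + y) \<le> u x + u y" for x y
      proof -
        have *: "u (x + y) \<le> p x + q y" if "p \<in> C" "q \<in> C" for p q
        proof -
          have "(p, q) \<in> r \<or> (q, p) \<in> r" using C that by (auto simp: Chains_def)
          then have "(\<forall>x. q x \<le> p x) \<or> (\<forall>x. p x \<le> q x)" by (auto simp: r_def)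
          then have "\<exists>s. s \<in> C \<and> s x \<le> p x \<and> s y \<le> q y"
            using that by (metis order_refl)
          then obtain s where s: "s \<in> C" "s x \<le> p x" "s y \<le> q y" by blast
          have "u (x + y) \<le> s (x + y)" using le s by blast
          also have "\<dots> \<le> s x + s y" using s sub by (auto simp: Sub_def)
          finally show ?thesis using s by linarith
        qed
        have "u (x + y) - q y \<le> u x" if "q \<in> C" for q
          by (rule ge) (use *[OF _ that] in \<open>auto simp: algebra_simps\<close>)
        then have "u (x + y) - u x \<le> u y"
          by (intro ge) (auto simp: algebra_simps)
        then show ?thesis by simp
      qed
      moreover have "u (t *\<^sub>R x) = t * u x" if t: "t > 0" for t x
      proof -
        have h: "p (t *\<^sub>R x) = t * p x" if "p \<in> C" for p using that t sub by (auto simp: Sub_def)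
        have "t * u x \<le> u (t *\<^sub>R x)" using h le t by (intro ge) (simp add: h)
        moreover have "u (t *\<^sub>R x) / t \<le> u x"
        proof (rule ge)
          fix p assume p: "p \<in> C"
          show "u (t *\<^sub>R x) / t \<le> p x"
            using le[OF p, of "t *\<^sub>R x"] h[OF p] t by (simp add: pos_divide_le_eq mult.commute)
        qed
        ultimately show ?thesis using t by (simp add: field_simps)
      qed
      moreover have "u x \<le> p0 x" for x
      proof -
        obtain p where p: "p \<in> C" using False by blast
        then have "p x \<le> p0 x" using sub by (auto simp: Sub_def)
        then show ?thesis using le[OF p, of x] by linarith
      qed
      ultimately have "u \<in> Sub" by (auto simp: Sub_def)
      then show ?thesis using le sub FS by (intro bexI[of _ u]) (auto simp: r_def)
    qed
  qed
  then obtain p where p: "p \<in> Sub" and min: "\<And>q. (p, q) \<in> r \<Longrightarrow> q = p"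
    by (auto simp: Field_def r_def)
  have pa: "p (x + y) \<le> p x + p y" and ph: "t > 0 \<Longrightarrow> p (t *\<^sub>R x) = t * p x" 
    and pp: "p x \<le> p0 x" for x y t
    using p by (auto simp: Sub_def)
  have ph0: "p (t *\<^sub>R x) = t * p x" if "t \<ge> 0" for t x
    using that ph[of t x] zero[OF p] by (cases "t = 0") auto
  have super: "p x + p y \<le> p (x + y)" for x y
  proof -
    define q where "q x = (INF t\<in>{0..}. p (x + t *\<^sub>R y) - t * p y)" for x
    have bd: "- p (- x) \<le> p (x + t *\<^sub>R y) - t * p y" if "t \<ge> 0" for x t
      using pa[of "x + t *\<^sub>R y" "- x"] ph0[OF that, of y] by simp
    have bdd: "bdd_below ((\<lambda>t. p (x + t *\<^sub>R y) - t * p y) ` {0..})" for x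
      using bd by (intro bdd_belowI[of _ "- p (- x)"]) auto
    have le: "q x \<le> p (x + t *\<^sub>R y) - t * p y" if "t \<ge> 0" for x t
      unfolding q_def using that by (intro cINF_lower[OF bdd]) auto
    have ge: "b \<le> q x" if "\<And>t. t \<ge> 0 \<Longrightarrow> b \<le> p (x + t *\<^sub>R y) - t * p y" for b x
      unfolding q_def using that by (intro cINF_greatest) auto
    have "q (a + b) \<le> q a + q b" for a b
    proof -
      have *: "q (a + b) \<le> (p (a + s *\<^sub>R y) - s * p y) + (p (b + t *\<^sub>R y) - t * p y)"
        if "s \<ge> 0" "t \<ge> 0" for s t
        using le[of "s + t" "a + b"] pa[of "a + s *\<^sub>R y" "b + t *\<^sub>R y"] that
        by (simp add: algebra_simps)
      have "q (a + b) - (p (b + t *\<^sub>R y) - t * p y) \<le> q a" if "t \<ge> 0" for t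
        by (rule ge) (use *[OF _ that] in \<open>auto simp: algebra_simps\<close>)
      then have "q (a + b) - q a \<le> q b"
        by (intro ge) (auto simp: algebra_simps)
      then show ?thesis by simp
    qed
    moreover have "q (t *\<^sub>R x) = t * q x" if t: "t > 0" for t x
    proof -
      have h: "p (t *\<^sub>R x + (t * s) *\<^sub>R y) - (t * s) * p y = t * (p (x + s *\<^sub>R y) - s * p y)" for s
        using ph[OF t, of "x + s *\<^sub>R y"] by (simp add: algebra_simps)
      have "q (t *\<^sub>R x) / t \<le> q x"
      proof (rule ge)
        fix s :: real assume "s \<ge> 0"
        then show "q (t *\<^sub>R x) / t \<le> p (x + s *\<^sub>R y) - s * p y"
          using le[of "t * s" "t *\<^sub>R x"] t unfolding h by (simp add: pos_divide_le_eq mult.commute)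
      qed
      moreover have "t * q x \<le> q (t *\<^sub>R x)"
      proof (rule ge)
        fix s :: real assume "s \<ge> 0"
        then show "t * q x \<le> p (t *\<^sub>R x + s *\<^sub>R y) - s * p y"
          using le[of "s / t" x] t h[of "s / t"] by simp
      qed
      ultimately show ?thesis using t by (simp add: field_simps)
    qed
    moreover have qp: "q x \<le> p x" for x using le[of 0 x] by simp
    ultimately have "q \<in> Sub" using order_trans[OF qp pp] by (auto simp: Sub_def)
    then have "q = p" using p qp by (intro min) (auto simp: r_def)
    then show ?thesis using le[of 1 x] by simp
  qed
  have add: "p (x + y) = p x + p y" for x y using pa[of x y] super[of x y] by simp
  have neg: "p (- x) = - p x" for x using add[of x "- x"] zero[OF p] by simp
  have "p (t *\<^sub>R x) = t * p x" for t x
  proof (cases "t \<ge> 0")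
    case False
    then show ?thesis using ph0[of "- t" x] neg[of "t *\<^sub>R x"] by simp
  qed (use ph0 in auto)
  then have "linear p" using add by (auto intro!: linearI)
  then show ?thesis using pp by blast
qed

text \<open>\<open>linear_below_sublinear\<close> is applied to the sublinear \<open>p0\<close>,
  which lies below the norm by \<open>t = 0\<close> and satisfies
  \<open>p0 (- x0) \<le> - norm x0\<close> by \<open>t = 1\<close>. A linear functional below
  \<open>p0\<close> is thus bounded and positive at \<open>x0\<close>; rescaling gives the value
  1.\<close>

lemma separating_functional:
  fixes x0 :: "'a::real_normed_vector"
  assumes "x0 \<noteq> 0"
  shows "\<exists>f :: 'a \<Rightarrow>\<^sub>L real. blinfun_apply f x0 = 1"
proof -
  define p0 where "p0 x = (INF t\<in>{0..}. norm (x + t *\<^sub>R x0) - t * norm x0)" for x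
  have bd: "- norm x \<le> norm (x + t *\<^sub>R x0) - t * norm x0" if "t \<ge> 0" for x t
    using norm_triangle_ineq4[of "x + t *\<^sub>R x0" x] that by simp
  have bdd: "bdd_below ((\<lambda>t. norm (x + t *\<^sub>R x0) - t * norm x0) ` {0..})" for x
    using bd by (intro bdd_belowI[of _ "- norm x"]) auto
  have le: "p0 x \<le> norm (x + t *\<^sub>R x0) - t * norm x0" if "t \<ge> 0" for x t
    unfolding p0_def using that by (intro cINF_lower[OF bdd]) auto
  have ge: "b \<le> p0 x" if "\<And>t. t \<ge> 0 \<Longrightarrow> b \<le> norm (x + t *\<^sub>R x0) - t * norm x0" for b x
    unfolding p0_def using that by (intro cINF_greatest) auto
  have "p0 (a + b) \<le> p0 a + p0 b" for a b
  proof -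
    have *: "p0 (a + b) \<le> (norm (a + s *\<^sub>R x0) - s * norm x0) + (norm (b + t *\<^sub>R x0) - t * norm x0)"
      if "s \<ge> 0" "t \<ge> 0" for s t
      using le[of "s + t" "a + b"] norm_triangle_ineq[of "a + s *\<^sub>R x0" "b + t *\<^sub>R x0"] that
      by (simp add: algebra_simps)
    have "p0 (a + b) - (norm (b + t *\<^sub>R x0) - t * norm x0) \<le> p0 a" if "t \<ge> 0" for t
      by (rule ge) (use *[OF _ that] in \<open>auto simp: algebra_simps\<close>)
    then have "p0 (a + b) - p0 a \<le> p0 b"
      by (intro ge) (auto simp: algebra_simps)
    then show ?thesis by simp
  qed
  moreover have "p0 (t *\<^sub>R x) = t * p0 x" if t: "t > 0" for t x
  proof -
    have h: "norm (t *\<^sub>R x + (t * s) *\<^sub>R x0) - (t * s) * norm x0 = t * (norm (x + s *\<^sub>R x0) - s * norm x0)" for s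
    proof -
      have "norm (t *\<^sub>R (x + s *\<^sub>R x0)) = t * norm (x + s *\<^sub>R x0)" using t by simp
      then show ?thesis by (simp add: algebra_simps)
    qed
    have "p0 (t *\<^sub>R x) / t \<le> p0 x"
    proof (rule ge)
      fix s :: real assume "s \<ge> 0"
      then show "p0 (t *\<^sub>R x) / t \<le> norm (x + s *\<^sub>R x0) - s * norm x0"
        using le[of "t * s" "t *\<^sub>R x"] t unfolding h by (simp add: pos_divide_le_eq mult.commute)
    qed
    moreover have "t * p0 x \<le> p0 (t *\<^sub>R x)"
    proof (rule ge)
      fix s :: real assume "s \<ge> 0"
      then show "t * p0 x \<le> norm (t *\<^sub>R x + s *\<^sub>R x0) - s * norm x0"
        using le[of "s / t" x] t h[of "s / t"] by simp
    qed
    ultimately show ?thesis using t by (simp add: field_simps)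
  qed
  ultimately obtain p where p: "linear p" and pp: "\<And>x. p x \<le> p0 x"
    using linear_below_sublinear[of p0] by blast
  have pn: "p x \<le> norm x" for x using pp[of x] le[of 0 x] by simp
  have "\<bar>p x\<bar> \<le> norm x" for x
    using pn[of x] pn[of "- x"] linear_neg[OF p, of x] by simp
  then have bl: "bounded_linear p" using p
    by (auto intro!: bounded_linear_intro[of _ 1] simp: linear_add linear_scale)
  have "p (- x0) \<le> - norm x0" using pp[of "- x0"] le[of 1 "- x0"] by simp
  then have "p x0 > 0" using assms linear_neg[OF p, of x0] by simp (smt (verit) norm_le_zero_iff)
  then show ?thesis
    by (intro exI[of _ "(1 / p x0) *\<^sub>R Blinfun p"])
       (simp add: bounded_linear_Blinfun_apply[OF bl] blinfun.scaleR_left)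
qed

section \<open>Common kernels and triangular systems in infinite dimension\<close>

lemma span_insert_kernel:
  fixes V :: "'a::real_vector set" and g :: "'a \<Rightarrow> real"
  assumes V: "subspace V" and g: "linear g"
  shows "\<exists>v. V \<subseteq> span (insert v (V \<inter> {x. g x = 0}))"
proof (cases "\<exists>v\<in>V. g v \<noteq> 0")
  case True
  then obtain v where v: "v \<in> V" "g v \<noteq> 0" by blast
  have "x \<in> span (insert v (V \<inter> {x. g x = 0}))" if "x \<in> V" for x
  proof -
    have "x - (g x / g v) *\<^sub>R v \<in> V \<inter> {x. g x = 0}"
    proof
      show "x - (g x / g v) *\<^sub>R v \<in> V" using that v V by (intro subspace_diff subspace_scale)
      show "x - (g x / g v) *\<^sub>R v \<in> {x. g x = 0}"
        using v g by (simp add: linear_diff linear_scale)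
    qed
    from span_base[OF this] show ?thesis unfolding span_insert by (intro CollectI exI)
  qed
  then show ?thesis by (intro exI[of _ v] subsetI)
next
  case False
  then have "V \<subseteq> insert 0 (V \<inter> {x. g x = 0})" by blast
  from order_trans[OF this span_superset] show ?thesis by (rule exI)
qed

text \<open>Each functional raises the codimension by at most one, so the common kernel together
  with finitely many vectors spans the space. A zero kernel would make the space
  finite-dimensional.\<close>

lemma common_kernel_nontrivial:
  fixes g :: "nat \<Rightarrow> 'a::real_vector \<Rightarrow> real"
  assumes inf: "\<not> (\<exists>B :: 'a set. finite B \<and> span B = UNIV)" and g: "\<And>i. linear (g i)"
  shows "\<exists>z. z \<noteq> 0 \<and> (\<forall>i<d. g i z = 0)"
proof (rule ccontr)
  assume neg: "\<not> ?thesis"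
  have "\<exists>B. finite B \<and> span (B \<union> {z. \<forall>i<d. g i z = 0}) = UNIV" for d
  proof (induction d)
    case 0
    show ?case by (intro exI[of _ "{}"]) simp
  next
    case (Suc d)
    then obtain B where B: "finite B" "span (B \<union> {z. \<forall>i<d. g i z = 0}) = UNIV" by blast
    have "subspace {z. \<forall>i<d. g i z = 0}"
      using g by (auto simp: subspace_def linear_0 linear_add linear_scale)
    then obtain v where v: "{z. \<forall>i<d. g i z = 0} \<subseteq> span (insert v ({z. \<forall>i<d. g i z = 0} \<inter> {x. g d x = 0}))"
      using span_insert_kernel[of _ "g d"] g by blast
    have eq: "{z. \<forall>i<d. g i z = 0} \<inter> {x. g d x = 0} = {z. \<forall>i<Suc d. g i z = 0}"
      by (auto simp: less_Suc_eq)
    define K where "K = {z. \<forall>i<Suc d. g i z = 0}"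
    have "insert v K \<subseteq> insert v B \<union> K" by blast
    from span_mono[OF this] have 1: "{z. \<forall>i<d. g i z = 0} \<subseteq> span (insert v B \<union> K)"
      using v unfolding eq K_def by blast
    have "B \<subseteq> span (insert v B \<union> K)" using span_superset[of "insert v B \<union> K"] by blast
    then have "B \<union> {z. \<forall>i<d. g i z = 0} \<subseteq> span (insert v B \<union> K)" using 1 by blast
    from span_minimal[OF this subspace_span] have "UNIV \<subseteq> span (insert v B \<union> K)"
      unfolding B(2) .
    then have "span (insert v B \<union> K) = UNIV" by (rule top.extremum_uniqueI)
    then show ?case using B(1) unfolding K_def by (intro exI[of _ "insert v B"]) (rule conjI[OF finite.insertI])
  qed
  then obtain B where B: "finite B" "span (B \<union> {z. \<forall>i<d. g i z = 0}) = UNIV" by blast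
  have "{z. \<forall>i<d. g i z = 0} \<subseteq> {0}" using neg by blast
  then have "span (B \<union> {z. \<forall>i<d. g i z = 0}) \<subseteq> span (insert 0 B)"
    by (intro span_mono) blast
  then have "UNIV \<subseteq> span (insert 0 B)" unfolding B(2) .
  then have sp: "span (insert 0 B) = UNIV" by (rule top.extremum_uniqueI)
  show False
    by (rule notE[OF inf exI[of "\<lambda>B. finite B \<and> span B = UNIV", OF conjI[OF finite.insertI[OF B(1)] sp]]])
qed

text \<open>Recursive choice: \<open>z l\<close> is taken in the common kernel of the earlier
  functionals, and \<open>g l\<close> is then normalised at it. The matrix of values has unit
  diagonal and zeros above it, so its determinant is 1, which starts the maximisation in
  \<open>Dvoretzky_Rogers\<close>.\<close>

lemma triangular_system:
  assumes inf: "\<not> (\<exists>B :: 'a::real_normed_vector set. finite B \<and> span B = UNIV)"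
  shows "\<exists>(g :: nat \<Rightarrow> 'a \<Rightarrow>\<^sub>L real) z. \<forall>l. blinfun_apply (g l) (z l) = 1 \<and> (\<forall>i<l. blinfun_apply (g i) (z l) = 0)"
proof -
  have step: "\<exists>p :: ('a \<Rightarrow>\<^sub>L real) \<times> 'a. blinfun_apply (fst p) (snd p) = 1 \<and> (\<forall>i<l. blinfun_apply (fst (h i)) (snd p) = 0)"
    for h :: "nat \<Rightarrow> ('a \<Rightarrow>\<^sub>L real) \<times> 'a" and l
  proof -
    obtain z where z: "z \<noteq> 0" "\<forall>i<l. blinfun_apply (fst (h i)) z = 0"
      using common_kernel_nontrivial[OF inf, of "\<lambda>i. blinfun_apply (fst (h i))" l]
      by (auto simp: blinfun.bounded_linear_right bounded_linear.linear)
    obtain f :: "'a \<Rightarrow>\<^sub>L real" where "blinfun_apply f z = 1" using separating_functional[OF z(1)] by blast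
    then show ?thesis using z by (intro exI[of _ "(f, z)"]) auto
  qed
  have "\<exists>h :: nat \<Rightarrow> ('a \<Rightarrow>\<^sub>L real) \<times> 'a. \<forall>l. blinfun_apply (fst (h l)) (snd (h l)) = 1 \<and> (\<forall>i<l. blinfun_apply (fst (h i)) (snd (h l)) = 0)"
    by (rule dependent_wf_choice[of less_than "\<lambda>h l p. blinfun_apply (fst p) (snd p) = 1 \<and> (\<forall>i<l. blinfun_apply (fst (h i)) (snd p) = 0)", simplified])
       (use step in auto)
  then obtain h :: "nat \<Rightarrow> ('a \<Rightarrow>\<^sub>L real) \<times> 'a" where "\<forall>l. blinfun_apply (fst (h l)) (snd (h l)) = 1 \<and> (\<forall>i<l. blinfun_apply (fst (h i)) (snd (h l)) = 0)"
    by blast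
  then show ?thesis by (intro exI[of _ "\<lambda>l. fst (h l)"] exI[of _ "\<lambda>l. snd (h l)"]) auto
qed

section \<open>The Dvoretzky--Rogers argument\<close>

text \<open>Plays the part of a volume: with \<open>g\<close> fixed, it is an alternating
  multilinear form in the first \<open>n\<close> vectors of \<open>z\<close>.\<close>

definition eval_det :: "nat \<Rightarrow> (nat \<Rightarrow> 'a::real_normed_vector \<Rightarrow>\<^sub>L real) \<Rightarrow> (nat \<Rightarrow> 'a) \<Rightarrow> real" where
  "eval_det n g z = Determinant.det (Matrix.mat n n (\<lambda>(i, l). blinfun_apply (g i) (z l)))"

text \<open>Dual form of the statement that \<open>z\<close> defines a contraction from euclidean
  \<open>n\<close>-space: the adjoint sends \<open>f\<close> to the vector of the values
  \<open>f (z l)\<close>.\<close>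

definition weak_l2 :: "nat \<Rightarrow> (nat \<Rightarrow> 'a::real_normed_vector) \<Rightarrow> bool" where
  "weak_l2 n z \<longleftrightarrow> (\<forall>f :: 'a \<Rightarrow>\<^sub>L real. (\<Sum>l<n. (blinfun_apply f (z l))\<^sup>2) \<le> (norm f)\<^sup>2)"

text \<open>The evaluation matrix of the combinations is a matrix product. Hence an orthogonal
  \<open>h\<close> leaves the absolute value of the determinant unchanged.\<close>

lemma eval_det_linear_comb:
  "eval_det n g (\<lambda>l. \<Sum>j<n. h j l *\<^sub>R z j) =
     eval_det n g z * Determinant.det (Matrix.mat n n (\<lambda>(j, l). h j l))"
proof -
  have "Matrix.mat n n (\<lambda>(i, l). blinfun_apply (g i) (\<Sum>j<n. h j l *\<^sub>R z j)) =
    Matrix.mat n n (\<lambda>(i, l). blinfun_apply (g i) (z l)) * Matrix.mat n n (\<lambda>(j, l). h j l)"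
    by (rule eq_matI)
       (auto simp: scalar_prod_def blinfun.sum_right blinfun.scaleR_right mult.commute
          atLeast0LessThan intro!: sum.cong)
  then show ?thesis unfolding eval_det_def
    by (simp add: Determinant.det_mult[of _ n])
qed

lemma eval_det_scale: "eval_det n g (\<lambda>l. r l *\<^sub>R z l) = (\<Prod>l<n. r l) * eval_det n g z"
proof -
  define h where "h j l = (if j = l then r l else 0)" for j l :: nat
  have "Determinant.det (Matrix.mat n n (\<lambda>(j, l). h j l)) = prod_list (diag_mat (Matrix.mat n n (\<lambda>(j, l). h j l)))"
    by (rule det_upper_triangular[of _ n]) (auto simp: h_def upper_triangular_def)
  also have "\<dots> = (\<Prod>l<n. r l)"
    by (simp add: diag_mat_def h_def prod.list_conv_set_nth atLeast0LessThan)
  finally have "eval_det n g (\<lambda>l. \<Sum>j<n. h j l *\<^sub>R z j) = (\<Prod>l<n. r l) * eval_det n g z"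
    unfolding eval_det_linear_comb by simp
  moreover have "eval_det n g (\<lambda>l. \<Sum>j<n. h j l *\<^sub>R z j) = eval_det n g (\<lambda>l. r l *\<^sub>R z l)"
    unfolding eval_det_def h_def
    by (intro arg_cong[of _ _ Determinant.det] eq_matI) (auto simp: if_distrib[of "\<lambda>x. x *\<^sub>R _"] cong: if_cong)
  ultimately show ?thesis by simp
qed

lemma eval_det_triangular:
  assumes "\<And>l. blinfun_apply (g l) (z l) = 1" "\<And>i l. i < l \<Longrightarrow> blinfun_apply (g i) (z l) = 0"
  shows "eval_det n g z = 1"
proof -
  have "eval_det n g z = prod_list (diag_mat (Matrix.mat n n (\<lambda>(i, l). blinfun_apply (g i) (z l))))"
    unfolding eval_det_def by (rule det_lower_triangular[of n]) (auto simp: assms)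
  also have "\<dots> = 1" by (simp add: diag_mat_def prod.list_conv_set_nth assms)
  finally show ?thesis .
qed

lemma weak_l2_apply_le:
  assumes "weak_l2 n z" "l < n"
  shows "\<bar>blinfun_apply f (z l)\<bar> \<le> norm f"
proof -
  have "(blinfun_apply f (z l))\<^sup>2 \<le> (\<Sum>l<n. (blinfun_apply f (z l))\<^sup>2)"
    using assms by (intro member_le_sum) auto
  also have "\<dots> \<le> (norm f)\<^sup>2" using assms by (auto simp: weak_l2_def)
  finally show ?thesis using abs_le_square_iff[of "blinfun_apply f (z l)" "norm f"] by simp
qed

text \<open>In the Leibniz expansion each of the \<open>fact n\<close> terms is at most the product
  of the norms. This makes the supremum in \<open>Dvoretzky_Rogers\<close> finite.\<close>

lemma eval_det_bounded:
  assumes "weak_l2 n z"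
  shows "\<bar>eval_det n g z\<bar> \<le> fact n * (\<Prod>i<n. norm (g i))"
proof -
  have "\<bar>eval_det n g z\<bar> = \<bar>\<Sum>p | p permutes {0..<n}. signof p * (\<Prod>i = 0..<n. Matrix.mat n n (\<lambda>(i, l). blinfun_apply (g i) (z l)) $$ (i, p i))\<bar>"
    unfolding eval_det_def by (subst det_def'[of _ n]) auto
  also have "\<dots> \<le> (\<Sum>p | p permutes {0..<n}. \<bar>signof p * (\<Prod>i = 0..<n. Matrix.mat n n (\<lambda>(i, l). blinfun_apply (g i) (z l)) $$ (i, p i))\<bar>)"
    by (rule sum_abs)
  also have "\<dots> \<le> (\<Sum>p | p permutes {0..<n}. (\<Prod>i<n. norm (g i)))"
  proof (rule sum_mono)
    fix p assume "p \<in> {p. p permutes {0..<n}}"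
    then have p: "p i < n" if "i < n" for i using that permutes_in_image[of p "{0..<n}" i] by auto
    have "\<bar>signof p * (\<Prod>i = 0..<n. Matrix.mat n n (\<lambda>(i, l). blinfun_apply (g i) (z l)) $$ (i, p i))\<bar>
       = (\<Prod>i<n. \<bar>blinfun_apply (g i) (z (p i))\<bar>)"
      using p by (auto simp: abs_mult abs_prod sign_def atLeast0LessThan intro!: prod.cong)
    also have "\<dots> \<le> (\<Prod>i<n. norm (g i))"
      using p weak_l2_apply_le[OF assms] by (intro prod_mono) auto
    finally show "\<bar>signof p * (\<Prod>i = 0..<n. Matrix.mat n n (\<lambda>(i, l). blinfun_apply (g i) (z l)) $$ (i, p i))\<bar> \<le> (\<Prod>i<n. norm (g i))" .
  qed
  also have "\<dots> = fact n * (\<Prod>i<n. norm (g i))"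
    using card_permutations[of "{0..<n}" n] by simp
  finally show ?thesis .
qed

text \<open>\<open>h\<close> is the Householder reflection along \<open>w\<close> that maps
  \<open>q\<close> to a multiple of unit vector \<open>d\<close>. As \<open>q\<close> vanishes
  before \<open>d\<close>, so does \<open>w\<close>, and the earlier coordinates are fixed. It
  serves to rotate \<open>z\<close> without disturbing coordinates already adjusted.\<close>

lemma householder_reflection:
  fixes q :: "nat \<Rightarrow> real"
  assumes dn: "d < n" and q: "\<And>j. j < d \<Longrightarrow> q j = 0"
  shows "\<exists>h :: nat \<Rightarrow> nat \<Rightarrow> real.
     \<bar>Determinant.det (Matrix.mat n n (\<lambda>(j, l). h j l))\<bar> = 1 \<and>
     (\<forall>y. (\<Sum>l<n. (\<Sum>j<n. h j l * y j)\<^sup>2) = (\<Sum>l<n. (y l)\<^sup>2)) \<and>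
     (\<forall>y l. l < d \<longrightarrow> (\<Sum>j<n. h j l * y j) = y l) \<and>
     (\<forall>i l. i < d \<longrightarrow> l < n \<longrightarrow> h i l = (if i = l then 1 else 0)) \<and>
     (\<forall>l<n. (\<Sum>j<n. h j l * q j) = (if l = d then L2_set q {..<n} else 0))"
proof -
  define N where "N = L2_set q {..<n}"
  define w where "w j = q j - (if j = d then N else 0)" for j
  define W where "W = (\<Sum>j<n. (w j)\<^sup>2)"
  \<comment> \<open>If \<open>W = 0\<close> then \<open>c = 0\<close>, and the reflection degenerates to the identity as it should.\<close>
  define c where "c = 2 / W"
  define h where "h j l = (if j = l then 1 else 0) - c * w j * w l" for j l
  have cW: "c * c * W = 2 * c" by (simp add: c_def)
  have w0: "w j = 0" if "j < d" for j using q that by (simp add: w_def)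
  have hy: "(\<Sum>j<n. h j l * y j) = y l - c * (\<Sum>j<n. w j * y j) * w l" if "l < n" for y l
  proof -
    have "(\<Sum>j<n. h j l * y j) = (\<Sum>j<n. (if j = l then y j else 0) - c * w l * (w j * y j))"
      by (intro sum.cong) (auto simp: h_def algebra_simps)
    also have "\<dots> = (\<Sum>j<n. if j = l then y j else 0) - c * w l * (\<Sum>j<n. w j * y j)"
      by (simp only: sum_subtractf sum_distrib_left)
    also have "(\<Sum>j<n. if j = l then y j else 0) = y l" using that by simp
    finally show ?thesis by (simp add: mult_ac)
  qed
  have WW: "(\<Sum>j<n. w j * w j) = W" by (simp add: W_def power2_eq_square)
  have norm_eq: "(\<Sum>l<n. (\<Sum>j<n. h j l * y j)\<^sup>2) = (\<Sum>l<n. (y l)\<^sup>2)" for y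
  proof -
    define s where "s = (\<Sum>j<n. w j * y j)"
    have "(\<Sum>l<n. (\<Sum>j<n. h j l * y j)\<^sup>2) = (\<Sum>l<n. (y l - c * s * w l)\<^sup>2)"
      by (intro sum.cong) (auto simp: hy s_def)
    also have "\<dots> = (\<Sum>l<n. (y l)\<^sup>2 - 2 * c * s * (w l * y l) + c * c * s * s * (w l)\<^sup>2)"
      by (intro sum.cong) (auto simp: power2_eq_square algebra_simps)
    also have "\<dots> = (\<Sum>l<n. (y l)\<^sup>2) - 2 * c * s * (\<Sum>l<n. w l * y l) + c * c * s * s * (\<Sum>l<n. (w l)\<^sup>2)"
      by (simp only: sum.distrib sum_subtractf sum_distrib_left)
    also have "\<dots> = (\<Sum>l<n. (y l)\<^sup>2) - 2 * c * s * s + (c * c * W) * s * s"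
      unfolding s_def[symmetric] W_def[symmetric] by simp
    finally show ?thesis unfolding cW by simp
  qed
  have det1: "\<bar>Determinant.det (Matrix.mat n n (\<lambda>(j, l). h j l))\<bar> = 1"
  proof -
    let ?H = "Matrix.mat n n (\<lambda>(j, l). h j l)"
    \<comment> \<open>The reflection is a symmetric involution, so its determinant squares to
      1.\<close>
    have "?H * ?H = 1\<^sub>m n"
    proof (rule eq_matI)
      fix i l assume il: "i < dim_row (1\<^sub>m n :: real mat)" "l < dim_col (1\<^sub>m n :: real mat)"
      have sym: "h i j = h j i" for i j by (auto simp: h_def)
      have "(?H * ?H) $$ (i, l) = (\<Sum>j<n. h i j * h j l)"
        using il by (simp add: scalar_prod_def atLeast0LessThan)
      also have "\<dots> = (\<Sum>j<n. h j l * h j i)" using sym by (intro sum.cong) (auto simp: mult.commute)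
      also have "\<dots> = h l i - c * (\<Sum>j<n. w j * h j i) * w l" using il by (subst hy) auto
      also have "(\<Sum>j<n. w j * h j i) = (\<Sum>j<n. h j i * w j)" by (simp add: mult.commute)
      also have "\<dots> = w i - c * W * w i" using il by (subst hy) (auto simp: WW)
      also have "h l i - c * (w i - c * W * w i) * w l = (if l = i then 1 else 0) - 2 * c * (w i * w l) + (c * c * W) * (w i * w l)"
        by (simp add: h_def algebra_simps)
      also have "\<dots> = (1\<^sub>m n :: real mat) $$ (i, l)" unfolding cW using il by auto
      finally show "(?H * ?H) $$ (i, l) = (1\<^sub>m n :: real mat) $$ (i, l)" .
    qed auto
    from arg_cong[OF this, of Determinant.det] have "Determinant.det ?H * Determinant.det ?H = 1"
      by (simp add: Determinant.det_mult[of _ n])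
    then have "(Determinant.det ?H)\<^sup>2 = 1" by (simp add: power2_eq_square)
    then show ?thesis unfolding power2_eq_1_iff by auto
  qed
  have "(\<Sum>j<n. h j l * q j) = (if l = d then N else 0)" if l: "l < n" for l
  proof -
    have N2: "(\<Sum>j<n. (q j)\<^sup>2) = N\<^sup>2" by (simp add: N_def L2_set_def sum_nonneg)
    have "(\<Sum>j<n. w j * q j) = (\<Sum>j<n. (q j)\<^sup>2 - (if j = d then N * q j else 0))"
      by (intro sum.cong) (auto simp: w_def power2_eq_square algebra_simps)
    then have wq: "(\<Sum>j<n. w j * q j) = N\<^sup>2 - N * q d" using dn by (simp add: sum_subtractf N2)
    have "W = (\<Sum>j<n. (q j)\<^sup>2 - (if j = d then 2 * N * q j - N * N else 0))"
      unfolding W_def by (intro sum.cong) (auto simp: w_def power2_eq_square algebra_simps)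
    \<comment> \<open>\<open>W\<close> is twice the inner product of \<open>w\<close> and
      \<open>q\<close>, so for nonzero \<open>W\<close> the reflection subtracts exactly
      \<open>w\<close> from \<open>q\<close>.\<close>
    then have W: "W = 2 * (N\<^sup>2 - N * q d)" using dn by (simp add: sum_subtractf N2) (simp add: power2_eq_square)
    show ?thesis
    proof (cases "W = 0")
      case True
      then have "w l = 0" using l by (auto simp: W_def sum_nonneg_eq_0_iff)
      then show ?thesis by (auto simp: hy[OF l] w_def)
    next
      case False
      then have "c * (\<Sum>j<n. w j * q j) = 1" unfolding wq c_def W by simp
      then show ?thesis unfolding hy[OF l] by (auto simp: w_def)
    qed
  qed
  moreover have "(\<Sum>j<n. h j l * y j) = y l" if "l < d" for y l
    using that dn by (subst hy) (auto simp: w0)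
  moreover have "h i l = (if i = l then 1 else 0)" if "i < d" for i l
    using that by (simp add: h_def w0)
  ultimately show ?thesis using det1 norm_eq unfolding N_def by (intro exI[of _ h]) auto
qed

lemma weak_l2_I:
  assumes "\<And>f :: 'a::real_normed_vector \<Rightarrow>\<^sub>L real. norm f \<le> 1 \<Longrightarrow> (\<Sum>l<n. (blinfun_apply f (z l))\<^sup>2) \<le> 1"
  shows "weak_l2 n z"
  unfolding weak_l2_def
proof
  fix f :: "'a \<Rightarrow>\<^sub>L real"
  show "(\<Sum>l<n. (blinfun_apply f (z l))\<^sup>2) \<le> (norm f)\<^sup>2"
  proof (cases "f = 0")
    case False
    have "(\<Sum>l<n. (blinfun_apply (inverse (norm f) *\<^sub>R f) (z l))\<^sup>2) \<le> 1"
      by (rule assms) (use False in simp)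
    moreover have "(\<Sum>l<n. (blinfun_apply (inverse (norm f) *\<^sub>R f) (z l))\<^sup>2) =
       (inverse (norm f))\<^sup>2 * (\<Sum>l<n. (blinfun_apply f (z l))\<^sup>2)"
      by (simp add: blinfun.scaleR_left power_mult_distrib sum_distrib_left)
    ultimately have "(inverse (norm f))\<^sup>2 * (\<Sum>l<n. (blinfun_apply f (z l))\<^sup>2) \<le> 1" by simp
    then show ?thesis using False by (simp add: inverse_eq_divide power_divide pos_divide_le_eq)
  qed simp
qed

text \<open>
  Otherwise shrinking the first \<open>d\<close> coordinates of \<open>z\<close> slightly and stretching the others would
  preserve \<open>weak_l2\<close> and enlarge the determinant.
\<close>

lemma contact_functional:
  fixes z :: "nat \<Rightarrow> 'a::real_normed_vector"
  assumes z: "weak_l2 n z" and t: "0 < t" "t \<le> 1" "2 * real m * t \<le> 1" 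
    and n: "m \<le> n" "3 \<le> real (n - m) * (t * t)" and dm: "d < m"
    and max: "\<And>z'. weak_l2 n z' \<Longrightarrow> \<bar>eval_det n g z'\<bar> < sqrt 2 * \<bar>eval_det n g z\<bar>"
  shows "\<exists>f :: 'a \<Rightarrow>\<^sub>L real. norm f \<le> 1 \<and> (\<Sum>l<d. (blinfun_apply f (z l))\<^sup>2) \<le> t \<and>
    1 - t < (\<Sum>l<n. (blinfun_apply f (z l))\<^sup>2)"
proof (rule ccontr)
  assume neg: "\<not> ?thesis"
  \<comment> \<open>The squared factors are \<open>1 - t\<close> and \<open>1 + t * t\<close>: the
    loss on the first \<open>d\<close> coordinates is of first order in \<open>t\<close>, the gain
    on the others of second order, but over many coordinates.\<close>
  define r where "r l = (if l < d then sqrt (1 - t) else sqrt (1 + t * t))" for l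
  have split: "(\<Sum>l<n. s l) = (\<Sum>l<d. s l) + (\<Sum>l=d..<n. s l)" for s :: "nat \<Rightarrow> real"
    using dm n by (simp add: lessThan_atLeast0 sum.atLeastLessThan_concat)
  have "weak_l2 n (\<lambda>l. r l *\<^sub>R z l)"
  proof (rule weak_l2_I)
    fix f :: "'a \<Rightarrow>\<^sub>L real" assume f: "norm f \<le> 1"
    define p where "p = (\<Sum>l<d. (blinfun_apply f (z l))\<^sup>2)"
    define q where "q = (\<Sum>l=d..<n. (blinfun_apply f (z l))\<^sup>2)"
    have pq0: "p \<ge> 0" "q \<ge> 0" by (auto simp: p_def q_def sum_nonneg)
    have "p + q \<le> (norm f)\<^sup>2" using z unfolding p_def q_def split[symmetric] by (auto simp: weak_l2_def)
    also have "\<dots> \<le> 1" using f by (simp add: power_le_one)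
    finally have pq: "p + q \<le> 1" .
    have "(\<Sum>l<n. (blinfun_apply f (r l *\<^sub>R z l))\<^sup>2) = (1 - t) * p + (1 + t * t) * q"
      using t unfolding split by (simp add: r_def p_def q_def sum_distrib_left blinfun.scaleR_right power_mult_distrib)
    also have "\<dots> \<le> 1"
    \<comment> \<open>If \<open>p > t\<close>, the loss \<open>t * p\<close> outweighs the gain
      \<open>t * t * q\<close>. Otherwise the negated claim leaves \<open>p + q\<close> at most
      \<open>1 - t\<close>, which is room enough for the factor \<open>1 + t * t\<close>.\<close>
    proof (cases "p > t")
      case True
      have "(1 - t) * p + (1 + t * t) * q \<le> (1 - t) * p + (1 + t * t) * (1 - p)"
        using pq t by (intro add_left_mono mult_left_mono) auto
      also have "\<dots> = 1 + t * t - (t + t * t) * p" by (simp add: algebra_simps)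
      also have "\<dots> \<le> 1 + t * t - (t + t * t) * t"
        using True t by (intro diff_left_mono mult_left_mono) auto
      also have "\<dots> \<le> 1" using t by (simp add: algebra_simps)
      finally show ?thesis .
    next
      case False
      then have "p + q \<le> 1 - t" using neg f unfolding p_def q_def split by force
      then have "(1 + t * t) * (p + q) \<le> (1 + t * t) * (1 - t)" by (intro mult_left_mono) auto
      also have "\<dots> \<le> 1"
      proof -
        have "t * t \<le> t" "0 \<le> t * (t * t)" using t by (auto simp: mult_left_le)
        moreover have "(1 + t * t) * (1 - t) = 1 - t + t * t - t * (t * t)" by (simp add: algebra_simps)
        ultimately show ?thesis by linarith
      qed
      finally have "(1 + t * t) * (p + q) \<le> 1" .
      moreover have "(1 - t) * p \<le> (1 + t * t) * p" using t pq0 by (intro mult_right_mono) (auto intro: order_trans[of _ 0])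
      ultimately show ?thesis by (simp add: distrib_left)
    qed
    finally show "(\<Sum>l<n. (blinfun_apply f (r l *\<^sub>R z l))\<^sup>2) \<le> 1" .
  qed
  from max[OF this] have "\<bar>\<Prod>l<n. r l\<bar> * \<bar>eval_det n g z\<bar> < sqrt 2 * \<bar>eval_det n g z\<bar>"
    by (simp add: eval_det_scale abs_mult)
  then have small: "\<bar>\<Prod>l<n. r l\<bar> < sqrt 2" by (simp add: mult_less_cancel_right)
  have "(\<Prod>l<n. (r l)\<^sup>2) = (\<Prod>l<d. (r l)\<^sup>2) * (\<Prod>l=d..<n. (r l)\<^sup>2)"
    using dm n by (simp add: lessThan_atLeast0 prod.atLeastLessThan_concat)
  also have "(\<Prod>l<d. (r l)\<^sup>2) = (1 - t) ^ d" using t by (simp add: r_def)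
  also have "(\<Prod>l=d..<n. (r l)\<^sup>2) = (1 + t * t) ^ (n - d)" using t by (simp add: r_def)
  finally have prod: "(\<Prod>l<n. r l)\<^sup>2 = (1 - t) ^ d * (1 + t * t) ^ (n - d)"
    by (simp add: prod_power_distrib)
  have "1 / 2 \<le> 1 + real d * (- t)"
  proof -
    have "real d * t \<le> real m * t" using dm t by (intro mult_right_mono) auto
    then show ?thesis using t(3) by linarith
  qed
  also have "\<dots> \<le> (1 + (- t)) ^ d" using t by (intro Bernoulli_inequality) auto
  finally have 1: "1 / 2 \<le> (1 - t) ^ d" by simp
  have "4 \<le> 1 + real (n - m) * (t * t)" using n by simp
  also have "\<dots> \<le> 1 + real (n - d) * (t * t)" using dm by (intro add_left_mono mult_right_mono) auto
  also have "\<dots> \<le> (1 + t * t) ^ (n - d)" using t by (intro Bernoulli_inequality) (auto intro: order_trans[of _ 0])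
  finally have 2: "4 \<le> (1 + t * t) ^ (n - d)" .
  \<comment> \<open>The two Bernoulli bounds make the squared ratio of the determinants at least 2,
    against \<open>max\<close>.\<close>
  have "1 / 2 * 4 \<le> (1 - t) ^ d * (1 + t * t) ^ (n - d)"
    using 1 2 t by (intro mult_mono) auto
  then have "2 \<le> (\<Prod>l<n. r l)\<^sup>2" unfolding prod by simp
  then have "sqrt 2 \<le> \<bar>\<Prod>l<n. r l\<bar>" by (metis real_sqrt_abs real_sqrt_le_iff)
  then show False using small by simp
qed

text \<open>\<open>z\<close> nearly maximises the determinant in a dimension \<open>n\<close> much
  larger than \<open>m\<close>. Step \<open>d\<close> finds a functional of the unit ball with small
  values on the first \<open>d\<close> vectors and nearly full euclidean length, and a reflection of
  \<open>z\<close> turns its remaining part into coordinate \<open>d\<close>. The contraction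
  property then transfers the euclidean norm of \<open>a\<close> to the combination of the
  \<open>f i\<close>.\<close>

lemma Dvoretzky_Rogers:
  assumes inf: "\<not> (\<exists>B :: 'a::real_normed_vector set. finite B \<and> span B = UNIV)" and e: "e > 0"
  shows "\<exists>f :: nat \<Rightarrow> 'a \<Rightarrow>\<^sub>L real. (\<forall>i<m. norm (f i) \<le> 1) \<and>
    (\<forall>a. (1 - e) * L2_set a {..<m} \<le> norm (\<Sum>i<m. a i *\<^sub>R f i))"
proof -
  define e' where "e' = min e 1"
  \<comment> \<open>Each functional will miss its unit vector by at most \<open>3 * t\<close> in
    squared length, so the \<open>m\<close> errors add up to at most
    \<open>e'\<^sup>2\<close>.\<close>
  define t where "t = e'\<^sup>2 / (3 * (real m + 1))"
  have e': "0 < e'" "e' \<le> 1" "e' \<le> e" using e by (auto simp: e'_def)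
  have e'2: "0 < e'\<^sup>2" "e'\<^sup>2 \<le> 1" using e' by (auto simp: power_le_one)
  have tm: "3 * (real m + 1) * t = e'\<^sup>2" by (simp add: t_def field_simps)
  have t: "0 < t" using e' by (simp add: t_def)
  have mt: "3 * real m * t \<le> e'\<^sup>2" using tm t by (simp add: algebra_simps)
  have t3: "3 * t \<le> e'\<^sup>2"
  proof -
    have "0 \<le> real m * t" using t by simp
    moreover have "3 * (real m * t) + 3 * t = e'\<^sup>2" using tm by (simp add: algebra_simps)
    ultimately show ?thesis by linarith
  qed
  have t1: "2 * t \<le> 1" "2 * real m * t \<le> 1"
  proof -
    show "2 * t \<le> 1" using t3 e'2 t by linarith
    have "0 \<le> real m * t" using t by simp
    then show "2 * real m * t \<le> 1" using mt e'2 by linarith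
  qed
  \<comment> \<open>\<open>N\<close> extra coordinates, enough for a factor \<open>1 + t * t\<close>
    in each to gain 4 in total.\<close>
  obtain N where N: "3 / (t * t) \<le> real N" using real_arch_simple by blast
  define n where "n = m + N"
  have n: "m \<le> n" "3 \<le> real (n - m) * (t * t)" using N t by (auto simp: n_def field_simps)
  obtain g :: "nat \<Rightarrow> 'a \<Rightarrow>\<^sub>L real" and z0 where g: "\<And>l. blinfun_apply (g l) (z0 l) = 1"
    "\<And>i l. i < l \<Longrightarrow> blinfun_apply (g i) (z0 l) = 0"
    using triangular_system[OF inf] by blast
  define D where "D = (\<lambda>z. \<bar>eval_det n g z\<bar>) ` Collect (weak_l2 n)"
  have bdd: "bdd_above D" unfolding D_def
    using eval_det_bounded by (intro bdd_aboveI[of _ "fact n * (\<Prod>i<n. norm (g i))"]) auto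
  define M where "M = (\<Sum>l<n. (norm (z0 l))\<^sup>2) + 1"
  have M: "M > 0" unfolding M_def by (intro add_nonneg_pos sum_nonneg) auto
  have weak0: "weak_l2 n (\<lambda>l. (1 / sqrt M) *\<^sub>R z0 l)"
  proof (rule weak_l2_I)
    fix f :: "'a \<Rightarrow>\<^sub>L real" assume f: "norm f \<le> 1"
    have "(\<Sum>l<n. (blinfun_apply f ((1 / sqrt M) *\<^sub>R z0 l))\<^sup>2) = (\<Sum>l<n. (blinfun_apply f (z0 l))\<^sup>2) / M"
      using M by (simp add: blinfun.scaleR_right power_divide sum_divide_distrib)
    also have "(\<Sum>l<n. (blinfun_apply f (z0 l))\<^sup>2) \<le> (\<Sum>l<n. (norm (z0 l))\<^sup>2)"
    proof (rule sum_mono)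
      fix l
      have "norm (blinfun_apply f (z0 l)) \<le> norm f * norm (z0 l)" by (rule norm_blinfun)
      also have "\<dots> \<le> norm (z0 l)" using f by (simp add: mult_left_le_one_le)
      finally have "\<bar>blinfun_apply f (z0 l)\<bar> \<le> \<bar>norm (z0 l)\<bar>" by simp
      then show "(blinfun_apply f (z0 l))\<^sup>2 \<le> (norm (z0 l))\<^sup>2" unfolding abs_le_square_iff .
    qed
    also have "\<dots> \<le> M" by (simp add: M_def)
    finally show "(\<Sum>l<n. (blinfun_apply f ((1 / sqrt M) *\<^sub>R z0 l))\<^sup>2) \<le> 1"
      using M by (simp add: divide_right_mono)
  qed
  have pos: "0 < \<bar>eval_det n g (\<lambda>l. (1 / sqrt M) *\<^sub>R z0 l)\<bar>"
    using M g by (simp add: eval_det_scale eval_det_triangular)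
  have "0 < Sup D"
    by (rule less_le_trans[OF pos cSup_upper[OF _ bdd]]) (use weak0 in \<open>auto simp: D_def\<close>)
  \<comment> \<open>The supremum need not be attained, but a factor \<open>sqrt 2\<close> of slack
    suffices for \<open>contact_functional\<close>.\<close>
  then have "Sup D / sqrt 2 < Sup D" by (simp add: divide_less_eq)
  then obtain z where z: "weak_l2 n z" and "Sup D / sqrt 2 < \<bar>eval_det n g z\<bar>"
    using less_cSup_iff[of D] bdd weak0 unfolding D_def by auto
  then have gt: "Sup D < sqrt 2 * \<bar>eval_det n g z\<bar>" by (simp add: field_simps)
  have max: "\<bar>eval_det n g z'\<bar> < sqrt 2 * \<bar>eval_det n g z\<bar>" if "weak_l2 n z'" for z'
    by (rule le_less_trans[OF cSup_upper[OF _ bdd] gt]) (use that in \<open>auto simp: D_def\<close>)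
  have "\<exists>z' f. weak_l2 n z' \<and> \<bar>eval_det n g z'\<bar> = \<bar>eval_det n g z\<bar> \<and>
      (\<forall>i<d. norm (f i :: 'a \<Rightarrow>\<^sub>L real) \<le> 1 \<and>
        (\<Sum>l<n. (blinfun_apply (f i) (z' l) - (if i = l then 1 else 0))\<^sup>2) \<le> 3 * t)" if "d \<le> m" for d
    using that
  proof (induction d)
    case 0
    show ?case using z by auto
  next
    case (Suc d)
    then obtain z' f where z': "weak_l2 n z'" "\<bar>eval_det n g z'\<bar> = \<bar>eval_det n g z\<bar>"
      and f: "\<And>i. i < d \<Longrightarrow> norm (f i :: 'a \<Rightarrow>\<^sub>L real) \<le> 1"
        "\<And>i. i < d \<Longrightarrow> (\<Sum>l<n. (blinfun_apply (f i) (z' l) - (if i = l then 1 else 0))\<^sup>2) \<le> 3 * t"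
      by auto
    have dm: "d < m" "d < n" using Suc.prems n by auto
    have "\<exists>f :: 'a \<Rightarrow>\<^sub>L real. norm f \<le> 1 \<and> (\<Sum>l<d. (blinfun_apply f (z' l))\<^sup>2) \<le> t \<and>
      1 - t < (\<Sum>l<n. (blinfun_apply f (z' l))\<^sup>2)"
      by (rule contact_functional[OF z'(1) t _ t1(2) n dm(1), of g]) (use t1 t max z' in auto)
    then obtain u :: "'a \<Rightarrow>\<^sub>L real" where u: "norm u \<le> 1" "(\<Sum>l<d. (blinfun_apply u (z' l))\<^sup>2) \<le> t"
      "1 - t < (\<Sum>l<n. (blinfun_apply u (z' l))\<^sup>2)" by blast
    \<comment> \<open>Cutting off the first \<open>d\<close> coordinates makes the reflection fix
      the unit vectors before \<open>d\<close>, hence keeps the errors of the earlier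
      functionals.\<close>
    define q where "q l = (if l < d then 0 else blinfun_apply u (z' l))" for l
    obtain h where h: "\<bar>Determinant.det (Matrix.mat n n (\<lambda>(j, l). h j l))\<bar> = 1"
      "\<And>y. (\<Sum>l<n. (\<Sum>j<n. h j l * y j)\<^sup>2) = (\<Sum>l<n. (y l)\<^sup>2)"
      "\<And>y l. l < d \<Longrightarrow> (\<Sum>j<n. h j l * y j) = y l"
      "\<And>i l. i < d \<Longrightarrow> l < n \<Longrightarrow> h i l = (if i = l then 1 else 0)"
      "\<And>l. l < n \<Longrightarrow> (\<Sum>j<n. h j l * q j) = (if l = d then L2_set q {..<n} else 0)"
      using householder_reflection[OF dm(2), of q] unfolding q_def by auto
    define z'' where "z'' l = (\<Sum>j<n. h j l *\<^sub>R z' j)" for l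
    have ap: "blinfun_apply v (z'' l) = (\<Sum>j<n. h j l * blinfun_apply v (z' j))" for v :: "'a \<Rightarrow>\<^sub>L real" and l
      by (simp add: z''_def blinfun.sum_right blinfun.scaleR_right)
    have w'': "weak_l2 n z''" using z'(1) by (simp add: weak_l2_def ap h(2))
    have det'': "\<bar>eval_det n g z''\<bar> = \<bar>eval_det n g z\<bar>"
      unfolding z''_def eval_det_linear_comb abs_mult h(1) z'(2) by simp
    have old: "(\<Sum>l<n. (blinfun_apply (f i) (z'' l) - (if i = l then 1 else 0))\<^sup>2) \<le> 3 * t" if "i < d" for i
    proof -
      have "blinfun_apply (f i) (z'' l) - (if i = l then 1 else 0) =
        (\<Sum>j<n. h j l * (blinfun_apply (f i) (z' j) - (if i = j then 1 else 0)))" if "l < n" for l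
        using h(4)[OF \<open>i < d\<close> that] \<open>i < d\<close> dm
        by (simp add: ap right_diff_distrib sum_subtractf if_distrib[of "\<lambda>x. _ * x"] cong: if_cong)
      then have "(\<Sum>l<n. (blinfun_apply (f i) (z'' l) - (if i = l then 1 else 0))\<^sup>2) =
         (\<Sum>l<n. (\<Sum>j<n. h j l * (blinfun_apply (f i) (z' j) - (if i = j then 1 else 0)))\<^sup>2)"
        by (intro sum.cong) auto
      then show ?thesis unfolding h(2) using f(2)[OF that] by simp
    qed
    \<comment> \<open>The error splits into at most \<open>t\<close> from the first \<open>d\<close>
      coordinates and at most \<open>2 * t\<close> from \<open>sqrt Q - 1\<close>, as
      \<open>Q\<close> lies between \<open>1 - 2 * t\<close> and 1.\<close>
    have new: "(\<Sum>l<n. (blinfun_apply u (z'' l) - (if d = l then 1 else 0))\<^sup>2) \<le> 3 * t"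
    proof -
      have split: "(\<Sum>l<n. s l) = (\<Sum>l<d. s l) + (\<Sum>l=d..<n. s l)" for s :: "nat \<Rightarrow> real"
        using dm by (simp add: lessThan_atLeast0 sum.atLeastLessThan_concat)
      define Q where "Q = (\<Sum>l=d..<n. (blinfun_apply u (z' l))\<^sup>2)"
      have q2: "(\<Sum>l<n. (q l)\<^sup>2) = Q" unfolding split by (simp add: q_def Q_def)
      have Q0: "0 \<le> Q" by (simp add: Q_def sum_nonneg)
      have "(\<Sum>l<n. (blinfun_apply u (z' l))\<^sup>2) \<le> (norm u)\<^sup>2" using z'(1) by (auto simp: weak_l2_def)
      also have "\<dots> \<le> 1" using u by (simp add: power_le_one)
      finally have "(\<Sum>l<d. (blinfun_apply u (z' l))\<^sup>2) + Q \<le> 1" by (simp add: split Q_def)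
      moreover have "0 \<le> (\<Sum>l<d. (blinfun_apply u (z' l))\<^sup>2)" by (simp add: sum_nonneg)
      ultimately have Q1: "Q \<le> 1" by simp
      have Qt: "1 - 2 * t \<le> Q" using u(2,3) unfolding split Q_def by simp
      have rot: "blinfun_apply u (z'' l) = (if l = d then sqrt Q else 0)" if "d \<le> l" "l < n" for l
      proof -
        have "(\<Sum>j<n. h j l * blinfun_apply u (z' j)) = (\<Sum>j<n. h j l * q j)"
          using h(4) that by (intro sum.cong) (auto simp: q_def)
        then show ?thesis using h(5)[OF that(2)] by (simp add: ap L2_set_def q2)
      qed
      have "(\<Sum>l<n. (blinfun_apply u (z'' l) - (if d = l then 1 else 0))\<^sup>2) =
        (\<Sum>l<d. (blinfun_apply u (z' l))\<^sup>2) + (\<Sum>l=d..<n. if l = d then (sqrt Q - 1)\<^sup>2 else 0)"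
        unfolding split
      proof (intro arg_cong2[of _ _ _ _ "(+)"] sum.cong refl)
        fix l assume "l \<in> {..<d}"
        then show "(blinfun_apply u (z'' l) - (if d = l then 1 else 0))\<^sup>2 = (blinfun_apply u (z' l))\<^sup>2"
          using h(3) by (simp add: ap)
      qed (auto simp: rot)
      also have "\<dots> \<le> t + (sqrt Q - 1)\<^sup>2" using u(2) dm by simp
      also have "(sqrt Q - 1)\<^sup>2 \<le> 2 * t"
      proof -
        have s: "0 \<le> sqrt Q" "sqrt Q \<le> 1" "sqrt Q * sqrt Q = Q" using Q0 Q1 by auto
        then have "Q \<le> sqrt Q" by (metis mult_left_le)
        moreover have "(sqrt Q - 1)\<^sup>2 = 1 - 2 * sqrt Q + Q" using s by (simp add: power2_eq_square algebra_simps)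
        ultimately show ?thesis using Qt by simp
      qed
      finally show ?thesis by simp
    qed
    show ?case
      by (intro exI[of _ z''] exI[of _ "f(d := u)"])
         (use w'' det'' old new f(1) u(1) in \<open>auto simp: less_Suc_eq\<close>)
  qed
  from this[of m] obtain z' and f :: "nat \<Rightarrow> 'a \<Rightarrow>\<^sub>L real" where z': "weak_l2 n z'"
      and f: "\<And>i. i < m \<Longrightarrow> norm (f i) \<le> 1"
        "\<And>i. i < m \<Longrightarrow> (\<Sum>l<n. (blinfun_apply (f i) (z' l) - (if i = l then 1 else 0))\<^sup>2) \<le> 3 * t"
    by auto
  have "(1 - e) * L2_set a {..<m} \<le> norm (\<Sum>i<m. a i *\<^sub>R f i)" for a
  proof -
    define v where "v = (\<Sum>i<m. a i *\<^sub>R f i)"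
    define b where "b l = (if l < m then a l else 0)" for l
    define y where "y i l = blinfun_apply (f i) (z' l) - (if i = l then 1 else 0)" for i l
    \<comment> \<open>\<open>a\<close>, extended by 0, is the image of \<open>v\<close> up to the
      accumulated errors, which Cauchy-Schwarz later bounds by
      \<open>e' * L2_set a {..<m}\<close>.\<close>
    have bv: "b l = blinfun_apply v (z' l) + - (\<Sum>i<m. a i * y i l)" for l
      by (simp add: v_def b_def y_def blinfun.sum_left blinfun.scaleR_left right_diff_distrib sum_subtractf
          if_distrib[of "\<lambda>x. _ * x"] cong: if_cong)
    have La: "L2_set b {..<n} = L2_set a {..<m}"
    proof -
      have "(\<Sum>l<n. (b l)\<^sup>2) = (\<Sum>l<m. (a l)\<^sup>2)"
        using n by (intro sum.mono_neutral_cong_right) (auto simp: b_def)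
      then show ?thesis by (simp add: L2_set_def)
    qed
    have "L2_set b {..<n} \<le> L2_set (\<lambda>l. blinfun_apply v (z' l)) {..<n} + L2_set (\<lambda>l. - (\<Sum>i<m. a i * y i l)) {..<n}"
      unfolding bv by (rule L2_set_triangle_ineq)
    moreover have "L2_set (\<lambda>l. blinfun_apply v (z' l)) {..<n} \<le> norm v"
      using z' unfolding weak_l2_def L2_set_def by (metis norm_ge_zero real_le_lsqrt)
    moreover have "L2_set (\<lambda>l. - (\<Sum>i<m. a i * y i l)) {..<n} \<le> e' * L2_set a {..<m}"
    proof -
      have "(\<Sum>l<n. (- (\<Sum>i<m. a i * y i l))\<^sup>2) \<le> (\<Sum>l<n. (\<Sum>i<m. (a i)\<^sup>2) * (\<Sum>i<m. (y i l)\<^sup>2))"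
        by (intro sum_mono) (simp add: Cauchy_Schwarz_ineq_sum)
      also have "\<dots> = (\<Sum>i<m. (a i)\<^sup>2) * (\<Sum>i<m. \<Sum>l<n. (y i l)\<^sup>2)"
        unfolding sum_distrib_left[symmetric] by (subst sum.swap) simp
      also have "\<dots> \<le> (\<Sum>i<m. (a i)\<^sup>2) * (\<Sum>i<m. 3 * t)"
        using f(2) by (intro mult_left_mono sum_mono) (auto simp: y_def sum_nonneg)
      also have "\<dots> \<le> (\<Sum>i<m. (a i)\<^sup>2) * e'\<^sup>2"
        using mt by (intro mult_left_mono) (auto simp: sum_nonneg mult_ac)
      finally have "L2_set (\<lambda>l. - (\<Sum>i<m. a i * y i l)) {..<n} \<le> sqrt ((\<Sum>i<m. (a i)\<^sup>2) * e'\<^sup>2)"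
        unfolding L2_set_def by (rule real_sqrt_le_mono)
      also have "\<dots> = e' * L2_set a {..<m}" using e' by (simp add: L2_set_def real_sqrt_mult)
      finally show ?thesis .
    qed
    moreover have "e' * L2_set a {..<m} \<le> e * L2_set a {..<m}" using e' by (intro mult_right_mono) auto
    ultimately show ?thesis by (simp add: La v_def algebra_simps)
  qed
  with f(1) show ?thesis by (intro exI[of _ f] conjI allI impI) auto
qed

section \<open>Fat shattering and separated sets\<close>

text \<open>
  \<open>G\<close> lists the shattered indices together with their witness levels; the gap between the strict
  inequalities makes every shattered \<open>G\<close> the graph of a function.
\<close>

definition shatters :: "'z set \<Rightarrow> ('z \<Rightarrow> 'i \<Rightarrow> nat) \<Rightarrow> ('i \<times> nat) set \<Rightarrow> bool" where
  "shatters A F G \<longleftrightarrow> (\<forall>T\<subseteq>G. \<exists>z\<in>A. (\<forall>(i, h)\<in>T. h < F z i) \<and> (\<forall>(i, h)\<in>G - T. F z i < h))"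

lemma shatters_mono: "shatters A F G \<Longrightarrow> A \<subseteq> B \<Longrightarrow> shatters B F G"
  unfolding shatters_def by blast

lemma shatters_empty: "shatters A F {} \<longleftrightarrow> A \<noteq> {}"
  by (auto simp: shatters_def)

text \<open>\<open>A\<close> realises the subsets without \<open>(i, h)\<close>, and
  \<open>B\<close> those containing it.\<close>

lemma shatters_insert:
  assumes "shatters A F G" "shatters B F G" "\<And>z. z \<in> A \<Longrightarrow> F z i < h" "\<And>z. z \<in> B \<Longrightarrow> h < F z i"
  shows "shatters (A \<union> B) F (insert (i, h) G)"
  unfolding shatters_def
proof (intro allI impI)
  fix T assume T: "T \<subseteq> insert (i, h) G"
  show "\<exists>z\<in>A \<union> B. (\<forall>(i, h)\<in>T. h < F z i) \<and> (\<forall>(i, h)\<in>insert (i, h) G - T. F z i < h)"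
  proof (cases "(i, h) \<in> T")
    case True
    have "T \<inter> G \<subseteq> G" by blast
    then obtain z where "z \<in> B" "\<forall>(i, h)\<in>T \<inter> G. h < F z i" "\<forall>(i, h)\<in>G - T \<inter> G. F z i < h"
      using assms(2) unfolding shatters_def by blast
    then show ?thesis using True T assms(4)[of z] by (intro bexI[of _ z]) auto
  next
    case False
    have "T \<inter> G \<subseteq> G" by blast
    then obtain z where "z \<in> A" "\<forall>(i, h)\<in>T \<inter> G. h < F z i" "\<forall>(i, h)\<in>G - T \<inter> G. F z i < h"
      using assms(1) unfolding shatters_def by blast
    then show ?thesis using False T assms(3)[of z] by (intro bexI[of _ z]) auto
  qed
qed

lemma shatters_inj_on:
  assumes "shatters A F G" shows "inj_on fst G"
proof (rule inj_onI)
  have lt: False if "(i, h) \<in> G" "(i, h') \<in> G" "h < h'" for i h h'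
  proof -
    have "{(i, h')} \<subseteq> G" using that by simp
    then obtain z where "\<forall>(i, h)\<in>{(i, h')}. h < F z i" "\<forall>(i, h)\<in>G - {(i, h')}. F z i < h"
      using assms unfolding shatters_def by blast
    moreover have "(i, h) \<in> G - {(i, h')}" using that by simp
    ultimately have "h' < F z i" "F z i < h" by fastforce+
    then show False using that by simp
  qed
  fix x y assume "x \<in> G" "y \<in> G" "fst x = fst y"
  then show "x = y" using lt[of "fst x" "snd x" "snd y"] lt[of "fst x" "snd y" "snd x"]
    by (cases x; cases y) (auto intro: linorder_cases[of "snd x" "snd y"])
qed

lemma pigeonhole_fibre:
  assumes "finite S" "finite T" "f ` S \<subseteq> T" "card T * m \<le> card S" "0 < m" "S \<noteq> {}"
  shows "\<exists>y\<in>T. m \<le> card {x\<in>S. f x = y}"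
proof (rule ccontr)
  assume neg: "\<not> ?thesis"
  have "card S = (\<Sum>y\<in>T. card {x\<in>S. f x = y})"
  proof -
    have "S = (\<Union>y\<in>T. {x\<in>S. f x = y})" using assms(3) by auto
    then have "card S = card (\<Union>y\<in>T. {x\<in>S. f x = y})" by simp
    also have "\<dots> = (\<Sum>y\<in>T. card {x\<in>S. f x = y})"
      using assms by (intro card_UN_disjoint) auto
    finally show ?thesis .
  qed
  also have "\<dots> < (\<Sum>y\<in>T. m)"
    using neg assms by (intro sum_strict_mono) (auto simp: not_le)
  finally show False using assms(4) by simp
qed

text \<open>
  The argument of Alon, Ben-David, Cesa-Bianchi and Haussler: pair up the elements of \<open>A\<close>; many
  pairs are separated at the same coordinate \<open>i\<close> by the same two values.  This yields two subfamilies
  that are still separated off \<open>i\<close>, and a set shattered by both can be extended by \<open>i\<close>, so the number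
  of shattered sets doubles.
\<close>

lemma card_shattered_ge:
  fixes F :: "'z \<Rightarrow> 'i \<Rightarrow> nat"
  assumes "finite I" "card I \<le> n" "0 < n" "finite A"
    "\<And>z i. z \<in> A \<Longrightarrow> i \<in> I \<Longrightarrow> F z i \<le> b"
    "\<And>z w. z \<in> A \<Longrightarrow> w \<in> A \<Longrightarrow> z \<noteq> w \<Longrightarrow> \<exists>i\<in>I. F z i + 2 \<le> F w i \<or> F w i + 2 \<le> F z i"
    "(2 * n * (b + 1)\<^sup>2) ^ r \<le> card A"
  shows "2 ^ r \<le> card {G. G \<subseteq> I \<times> {..b} \<and> shatters A F G}"
  using assms
proof (induction r arbitrary: I A)
  case 0
  then have "A \<noteq> {}" by auto
  then have "{{}} \<subseteq> {G. G \<subseteq> I \<times> {..b} \<and> shatters A F G}" by (auto simp: shatters_empty)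
  moreover have "finite {G. G \<subseteq> I \<times> {..b} \<and> shatters A F G}" using 0 by simp
  ultimately have "card {{}::('i \<times> nat) set} \<le> card {G. G \<subseteq> I \<times> {..b} \<and> shatters A F G}"
    by (intro card_mono)
  then show ?case by simp
next
  case (Suc r)
  define m where "m = (2 * n * (b + 1)\<^sup>2) ^ r"
  \<comment> \<open>There are at most \<open>n * (b + 1)\<^sup>2\<close> colours for the
    \<open>M\<close> pairs formed below, so one colour occurs at least \<open>m\<close>
    times.\<close>
  define M where "M = n * (b + 1)\<^sup>2 * m"
  have m: "0 < m" using Suc.prems by (simp add: m_def)
  have M: "0 < M" using m Suc.prems by (simp add: M_def)
  have cA: "2 * M \<le> card A" using Suc.prems(7) by (simp add: M_def m_def mult_ac)
  have "M \<le> card A" using cA by simp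
  then obtain A1 where A1: "A1 \<subseteq> A" "card A1 = M" by (rule obtain_subset_with_card_n)
  have "finite A1" using A1(1) Suc.prems(4) by (rule finite_subset)
  have "M \<le> card (A - A1)" using A1 cA \<open>finite A1\<close> by (simp add: card_Diff_subset)
  then obtain A2 where A2: "A2 \<subseteq> A - A1" "card A2 = M"  by (rule obtain_subset_with_card_n)
  have "finite A2" using A2(1) Suc.prems(4) by (meson finite_Diff finite_subset)
  obtain \<phi> where \<phi>: "bij_betw \<phi> A1 A2"
    using finite_same_card_bij[OF \<open>finite A1\<close> \<open>finite A2\<close>] A1 A2 by auto
  have "\<exists>i\<in>I. F z i + 2 \<le> F (\<phi> z) i \<or> F (\<phi> z) i + 2 \<le> F z i" if z: "z \<in> A1" for z
  proof -
    have "\<phi> z \<in> A2" using bij_betwE[OF \<phi>] z by blast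
    then have "z \<in> A" "\<phi> z \<in> A" "z \<noteq> \<phi> z" using z A1(1) A2(1) by auto
    then show ?thesis by (rule Suc.prems(6))
  qed
  then obtain c where c: "\<And>z. z \<in> A1 \<Longrightarrow> c z \<in> I"
      "\<And>z. z \<in> A1 \<Longrightarrow> F z (c z) + 2 \<le> F (\<phi> z) (c z) \<or> F (\<phi> z) (c z) + 2 \<le> F z (c z)"
    by metis
  have \<phi>A: "\<phi> z \<in> A" if "z \<in> A1" for z using that A2(1) bij_betwE[OF \<phi>] by blast
  define col where "col z = (c z, F z (c z), F (\<phi> z) (c z))" for z
  have "\<exists>y\<in>I \<times> {..b} \<times> {..b}. m \<le> card {x\<in>A1. col x = y}"
  proof (rule pigeonhole_fibre)
    show "col ` A1 \<subseteq> I \<times> {..b} \<times> {..b}" using c \<phi>A A1 Suc.prems(5) by (auto simp: col_def)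
    show "card (I \<times> {..b} \<times> {..b}) * m \<le> card A1"
    proof -
      have "card (I \<times> {..b} \<times> {..b}) = card I * (b + 1)\<^sup>2"
        by (simp add: card_cartesian_product power2_eq_square)
      then show ?thesis unfolding A1(2) M_def using Suc.prems(2) by (simp only: mult_le_mono1)
    qed
  qed (use \<open>finite A1\<close> Suc.prems m M A1 in auto)
  then obtain i u v where iuv: "i \<in> I" "u \<le> b" "v \<le> b" "m \<le> card {x\<in>A1. col x = (i, u, v)}" by auto
  define B where "B = {x\<in>A1. col x = (i, u, v)}"
  have B: "B \<subseteq> A1" "\<And>z. z \<in> B \<Longrightarrow> F z i = u" "\<And>z. z \<in> B \<Longrightarrow> F (\<phi> z) i = v" "m \<le> card B"
    using iuv by (auto simp: B_def col_def)
  have "B \<noteq> {}" using B(4) m by auto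
  then have uv: "u + 2 \<le> v \<or> v + 2 \<le> u" using c(2) by (fastforce simp: B_def col_def)
  have inj: "inj_on \<phi> B" using \<phi> B(1) by (meson bij_betw_imp_inj_on inj_on_subset)
  have fB: "finite B" using B(1) \<open>finite A1\<close> finite_subset by blast
  have BA: "B \<subseteq> A" "\<phi> ` B \<subseteq> A" using B(1) A1 \<phi>A by auto
  \<comment> \<open>Up to exchanging the two sides of the pairs, \<open>P\<close> has the lower
    value at \<open>i\<close>.\<close>
  have "\<exists>P Q a a'. P \<subseteq> A \<and> Q \<subseteq> A \<and> finite P \<and> finite Q \<and> m \<le> card P \<and> m \<le> card Q \<and>
      (\<forall>z\<in>P. F z i = a) \<and> (\<forall>z\<in>Q. F z i = a') \<and> a + 2 \<le> a' \<and> a' \<le> b"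
    using uv
  proof
    assume "u + 2 \<le> v"
    then show ?thesis using B BA fB inj iuv
      by (intro exI[of _ B] exI[of _ "\<phi> ` B"] exI[of _ u] exI[of _ v]) (auto simp: card_image)
  next
    assume "v + 2 \<le> u"
    then show ?thesis using B BA fB inj iuv
      by (intro exI[of _ "\<phi> ` B"] exI[of _ B] exI[of _ v] exI[of _ u]) (auto simp: card_image)
  qed
  then obtain P Q a a' where PQ: "P \<subseteq> A" "Q \<subseteq> A" "finite P" "finite Q" "m \<le> card P" "m \<le> card Q"
    "\<And>z. z \<in> P \<Longrightarrow> F z i = a" "\<And>z. z \<in> Q \<Longrightarrow> F z i = a'" "a + 2 \<le> a'" "a' \<le> b" by blast
  define I' where "I' = I - {i}"
  define S where "S X = {G. G \<subseteq> I' \<times> {..b} \<and> shatters X F G}" for X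
  have I': "finite I'" "card I' \<le> n" using Suc.prems by (auto simp: I'_def intro: le_trans[OF card_mono])
  have sep': "\<exists>j\<in>I'. F z j + 2 \<le> F w j \<or> F w j + 2 \<le> F z j"
    if zw: "z \<in> A" "w \<in> A" "z \<noteq> w" "F z i = F w i" for z w
  proof -
    obtain j where "j \<in> I" "F z j + 2 \<le> F w j \<or> F w j + 2 \<le> F z j"
      using Suc.prems(6)[OF zw(1-3)] by blast
    then show ?thesis using zw(4) by (intro bexI[of _ j]) (auto simp: I'_def)
  qed
  have SX: "2 ^ r \<le> card (S X)"
    if X: "X \<subseteq> A" "finite X" "m \<le> card X" "\<And>z. z \<in> X \<Longrightarrow> F z i = e" for X e
    unfolding S_def
  proof (rule Suc.IH[OF I' Suc.prems(3) X(2)])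
    show "F z j \<le> b" if "z \<in> X" "j \<in> I'" for z j
      using Suc.prems(5) X(1) that by (auto simp: I'_def)
    show "\<exists>j\<in>I'. F z j + 2 \<le> F w j \<or> F w j + 2 \<le> F z j" if "z \<in> X" "w \<in> X" "z \<noteq> w" for z w
      using that X(1) X(4)[of z] X(4)[of w] by (intro sep') auto
    show "(2 * n * (b + 1)\<^sup>2) ^ r \<le> card X" using X(3) by (simp only: m_def)
  qed
  have S1: "2 ^ r \<le> card (S P)" by (rule SX[OF PQ(1,3,5,7)])
  have S2: "2 ^ r \<le> card (S Q)" by (rule SX[OF PQ(2,4,6,8)])
  have fS: "finite (S X)" for X using I' by (simp add: S_def)
  \<comment> \<open>The level \<open>a + 1\<close> lies strictly between \<open>a\<close> and
    \<open>a'\<close>. A set shattered by both \<open>P\<close> and \<open>Q\<close> is counted once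
    by itself and once with \<open>(i, a + 1)\<close> added, which gives the full sum
    \<open>card (S P) + card (S Q)\<close>.\<close>
  let ?R = "insert (i, a + 1) ` (S P \<inter> S Q)"
  let ?all = "{G. G \<subseteq> I \<times> {..b} \<and> shatters A F G}"
  have notin: "(i, h) \<notin> G" if "G \<in> S X" for G X h using that by (auto simp: S_def I'_def)
  have "card ?R = card (S P \<inter> S Q)"
  proof (rule card_image, rule inj_onI)
    fix x y assume "x \<in> S P \<inter> S Q" "y \<in> S P \<inter> S Q" "insert (i, a + 1) x = insert (i, a + 1) y"
    then show "x = y" using insert_ident[OF notin notin] by blast
  qed
  moreover have "card ((S P \<union> S Q) \<union> ?R) = card (S P \<union> S Q) + card ?R"
    using fS notin by (intro card_Un_disjoint) auto
  ultimately have "card ((S P \<union> S Q) \<union> ?R) = card (S P) + card (S Q)"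
    using card_Un_Int[OF fS fS, of P Q] by simp
  moreover have "card ((S P \<union> S Q) \<union> ?R) \<le> card ?all"
  proof (rule card_mono)
    show "finite ?all" using Suc.prems by simp
    have "insert (i, a + 1) G \<in> ?all" if "G \<in> S P" "G \<in> S Q" for G
    proof -
      have "shatters (P \<union> Q) F (insert (i, a + 1) G)"
        using that PQ by (intro shatters_insert) (auto simp: S_def)
      then have "shatters A F (insert (i, a + 1) G)" using PQ by (auto intro: shatters_mono)
      then show ?thesis using that iuv PQ by (auto simp: S_def I'_def)
    qed
    then show "(S P \<union> S Q) \<union> ?R \<subseteq> ?all"
      using PQ by (auto simp: S_def I'_def intro: shatters_mono)
  qed
  ultimately show ?case using S1 S2 by simp
qed

text \<open>A set of at most \<open>d + 1\<close> elements is one of at most \<open>d\<close>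
  elements to which nothing or one point is added.\<close>

lemma card_subsets_le:
  assumes "finite W"
  shows "card {G. G \<subseteq> W \<and> card G \<le> d} \<le> (card W + 1) ^ d"
proof (induction d)
  case 0
  have "{G. G \<subseteq> W \<and> card G \<le> 0} \<subseteq> {{}}" using assms by (auto dest: finite_subset[OF _ assms])
  then show ?case using card_mono[of "{{}}" "{G. G \<subseteq> W \<and> card G \<le> 0}"] by simp
next
  case (Suc d)
  let ?S = "{G. G \<subseteq> W \<and> card G \<le> d}"
  let ?f = "\<lambda>(x, G). case x of None \<Rightarrow> G | Some y \<Rightarrow> insert y G"
  let ?D = "(insert None (Some ` W)) \<times> ?S"
  have fD: "finite ?D" using assms by simp
  have "{G. G \<subseteq> W \<and> card G \<le> Suc d} \<subseteq> ?f ` ?D"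
  proof
    fix G assume G: "G \<in> {G. G \<subseteq> W \<and> card G \<le> Suc d}"
    show "G \<in> ?f ` ?D"
    proof (cases "card G \<le> d")
      case True
      then show ?thesis using G by (intro image_eqI[of _ _ "(None, G)"]) auto
    next
      case False
      then have "G \<noteq> {}" by auto
      then obtain y where y: "y \<in> G" by blast
      have "finite G" using G assms finite_subset by blast
      then have "card (G - {y}) \<le> d" using G y by (auto simp: card_Diff_singleton)
      then show ?thesis using G y by (intro image_eqI[of _ _ "(Some y, G - {y})"]) auto
    qed
  qed
  then have "card {G. G \<subseteq> W \<and> card G \<le> Suc d} \<le> card (?f ` ?D)" using fD by (intro card_mono) auto
  also have "\<dots> \<le> card ?D" using fD by (rule card_image_le)
  also have "\<dots> = (card W + 1) * card ?S" using assms
    by (simp add: card_cartesian_product card_image card_insert_if image_iff)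
  also have "\<dots> \<le> (card W + 1) * (card W + 1) ^ d" by (rule mult_le_mono2[OF Suc])
  finally show ?case by simp
qed

text \<open>Too many separated elements would shatter at least \<open>2 ^ r\<close> sets by
  \<open>card_shattered_ge\<close>, while the sets of at most \<open>d\<close> grid points number at
  most \<open>(n * (b + 1) + 1) ^ d\<close>.\<close>

lemma separated_card_less:
  fixes F :: "'z \<Rightarrow> 'i \<Rightarrow> nat"
  assumes "finite I" "card I \<le> n" "0 < n" "finite A"
    "\<And>z i. z \<in> A \<Longrightarrow> i \<in> I \<Longrightarrow> F z i \<le> b"
    "\<And>z w. z \<in> A \<Longrightarrow> w \<in> A \<Longrightarrow> z \<noteq> w \<Longrightarrow> \<exists>i\<in>I. F z i + 2 \<le> F w i \<or> F w i + 2 \<le> F z i"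
    and d: "\<And>G. G \<subseteq> I \<times> {..b} \<Longrightarrow> shatters A F G \<Longrightarrow> card (fst ` G) \<le> d"
    and r: "(n * (b + 1) + 1) ^ d < 2 ^ r"
  shows "card A < (2 * n * (b + 1)\<^sup>2) ^ r"
proof (rule ccontr)
  assume "\<not> ?thesis"
  then have "2 ^ r \<le> card {G. G \<subseteq> I \<times> {..b} \<and> shatters A F G}"
    using assms(1-6) by (intro card_shattered_ge) auto
  also have "\<dots> \<le> card {G. G \<subseteq> I \<times> {..b} \<and> card G \<le> d}"
  proof (rule card_mono)
    show "finite {G. G \<subseteq> I \<times> {..b} \<and> card G \<le> d}" using assms(1) by simp
    have "card G \<le> d" if "G \<subseteq> I \<times> {..b}" "shatters A F G" for G
      using d[OF that] card_image[OF shatters_inj_on[OF that(2)]] by simp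
    then show "{G. G \<subseteq> I \<times> {..b} \<and> shatters A F G} \<subseteq> {G. G \<subseteq> I \<times> {..b} \<and> card G \<le> d}"
      by blast
  qed
  also have "\<dots> \<le> (card (I \<times> {..b}) + 1) ^ d" using assms(1) by (intro card_subsets_le) auto
  also have "card (I \<times> {..b}) = card I * (b + 1)" by (simp add: card_cartesian_product)
  also have "(card I * (b + 1) + 1) ^ d \<le> (n * (b + 1) + 1) ^ d"
    by (intro power_mono add_mono mult_le_mono1 assms(2)) auto
  finally show False using r by simp
qed

section \<open>Spread systems and metric entropy\<close>

text \<open>Up to the constant \<open>c\<close>, any \<open>k\<close> of the vectors behave like the
  unit vectors of l1. Arbitrary finite index sets allow passing to subfamilies without
  renumbering.\<close>

definition spread_system :: "'e::real_normed_vector itself \<Rightarrow> nat \<Rightarrow> nat \<Rightarrow> real \<Rightarrow> bool" where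
  "spread_system _ N k c \<longleftrightarrow> (\<exists>(I :: nat set) (f :: nat \<Rightarrow> 'e). finite I \<and> card I = N \<and>
     (\<forall>i\<in>I. norm (f i) \<le> 1) \<and>
     (\<forall>S\<subseteq>I. card S \<le> k \<longrightarrow> (\<forall>a. c * (\<Sum>i\<in>S. \<bar>a i\<bar>) \<le> norm (\<Sum>i\<in>S. a i *\<^sub>R f i))))"

text \<open>The failing inequality for some \<open>N\<close> of the vectors, divided by the l1-norm
  of its coefficients.\<close>

lemma small_l1_combination:
  fixes f :: "nat \<Rightarrow> 'e::real_normed_vector"
  assumes nP: "\<not> spread_system TYPE('e) N k c" and c: "0 < c"
    and I: "finite I" "N \<le> card I" "\<forall>i\<in>I. norm (f i) \<le> 1"
  shows "\<exists>S\<subseteq>I. card S \<le> k \<and> (\<exists>a. (\<Sum>i\<in>S. \<bar>a i\<bar>) = 1 \<and> norm (\<Sum>i\<in>S. a i *\<^sub>R f i) \<le> c)"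
proof -
  obtain I' where I': "I' \<subseteq> I" "card I' = N" using I(2) by (rule obtain_subset_with_card_n)
  have "finite I'" using I'(1) I(1) by (rule finite_subset)
  have "\<exists>S a. S \<subseteq> I' \<and> card S \<le> k \<and> norm (\<Sum>i\<in>S. a i *\<^sub>R f i) < c * (\<Sum>i\<in>S. \<bar>a i\<bar>)"
  proof (rule ccontr)
    assume "\<not> ?thesis"
    then have "\<forall>S\<subseteq>I'. card S \<le> k \<longrightarrow> (\<forall>a. c * (\<Sum>i\<in>S. \<bar>a i\<bar>) \<le> norm (\<Sum>i\<in>S. a i *\<^sub>R f i))"
      by (meson not_le)
    then have "spread_system TYPE('e) N k c"
      unfolding spread_system_def using \<open>finite I'\<close> I' I(3)
      by (intro exI[of _ I'] exI[of _ f]) auto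
    then show False using nP by simp
  qed
  then obtain S a where S: "S \<subseteq> I'" "card S \<le> k"
    and a: "norm (\<Sum>i\<in>S. a i *\<^sub>R f i) < c * (\<Sum>i\<in>S. \<bar>a i\<bar>)" by blast
  define A where "A = (\<Sum>i\<in>S. \<bar>a i\<bar>)"
  have A: "0 < A" using le_less_trans[OF norm_ge_zero a] c unfolding A_def by (simp add: zero_less_mult_iff)
  have "(\<Sum>i\<in>S. \<bar>a i / A\<bar>) = 1" using A by (simp add: abs_divide sum_divide_distrib[symmetric] A_def[symmetric])
  moreover have "norm (\<Sum>i\<in>S. (a i / A) *\<^sub>R f i) \<le> c"
  proof -
    have "(\<Sum>i\<in>S. (a i / A) *\<^sub>R f i) = (1 / A) *\<^sub>R (\<Sum>i\<in>S. a i *\<^sub>R f i)"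
      by (simp add: scaleR_sum_right)
    then have "norm (\<Sum>i\<in>S. (a i / A) *\<^sub>R f i) = norm (\<Sum>i\<in>S. a i *\<^sub>R f i) / A" using A by simp
    also have "\<dots> \<le> c" using a A by (simp add: A_def divide_le_eq)
    finally show ?thesis .
  qed
  ultimately show ?thesis using S I'(1) by (intro exI[of _ S] conjI exI[of _ "\<lambda>i. a i / A"]) auto
qed

text \<open>Greedy extraction: each combination uses up at most \<open>k\<close> indices, so at
  least \<open>N\<close> indices remain before each step.\<close>

lemma disjoint_l1_combinations:
  fixes f :: "nat \<Rightarrow> 'e::real_normed_vector"
  assumes nP: "\<not> spread_system TYPE('e) N k c" and c: "0 < c"
    and I: "finite I" "k * M + N \<le> card I" "\<forall>i\<in>I. norm (f i) \<le> 1"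
  shows "\<exists>(S :: nat \<Rightarrow> nat set) A. (\<forall>l<M. S l \<subseteq> I \<and> (\<Sum>i\<in>S l. \<bar>A l i\<bar>) = 1 \<and>
     norm (\<Sum>i\<in>S l. A l i *\<^sub>R f i) \<le> c) \<and> (\<forall>l<M. \<forall>l'<M. l \<noteq> l' \<longrightarrow> S l \<inter> S l' = {})"
  using I
proof (induction M arbitrary: I)
  case 0
  then show ?case by auto
next
  case (Suc M)
  have "N \<le> card I" using Suc.prems(2) by simp
  from small_l1_combination[where f = f, OF nP c Suc.prems(1) this Suc.prems(3)] obtain S0 a where
    S0: "S0 \<subseteq> I" "card S0 \<le> k" "(\<Sum>i\<in>S0. \<bar>a i\<bar>) = 1" "norm (\<Sum>i\<in>S0. a i *\<^sub>R f i) \<le> c"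
    by auto
  have fS: "finite S0" using S0(1) Suc.prems(1) by (rule finite_subset)
  have "k * M + N \<le> card (I - S0)" using Suc.prems(2) S0(2) by (simp add: card_Diff_subset[OF fS S0(1)])
  then have "\<exists>S A. (\<forall>l<M. S l \<subseteq> I - S0 \<and> (\<Sum>i\<in>S l. \<bar>A l i\<bar>) = 1 \<and>
     norm (\<Sum>i\<in>S l. A l i *\<^sub>R f i) \<le> c) \<and> (\<forall>l<M. \<forall>l'<M. l \<noteq> l' \<longrightarrow> S l \<inter> S l' = {})"
    using Suc.prems(1,3) by (intro Suc.IH) auto
  then obtain S A where SA':
    "(\<forall>l<M. S l \<subseteq> I - S0 \<and> (\<Sum>i\<in>S l. \<bar>A l i\<bar>) = 1 \<and>
     norm (\<Sum>i\<in>S l. A l i *\<^sub>R f i) \<le> c) \<and> (\<forall>l<M. \<forall>l'<M. l \<noteq> l' \<longrightarrow> S l \<inter> S l' = {})"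
    by (elim exE)
  then have SA: "\<And>l. l < M \<Longrightarrow> S l \<subseteq> I - S0 \<and> (\<Sum>i\<in>S l. \<bar>A l i\<bar>) = 1 \<and>
     norm (\<Sum>i\<in>S l. A l i *\<^sub>R f i) \<le> c" "\<And>l l'. l < M \<Longrightarrow> l' < M \<Longrightarrow> l \<noteq> l' \<Longrightarrow> S l \<inter> S l' = {}"
    by auto
  have disj: "S l \<inter> S0 = {}" if "l < M" for l using SA(1)[OF that] by blast
  show ?case
  proof (intro exI[of _ "S(M := S0)"] exI[of _ "A(M := a)"] conjI allI impI)
    fix l assume "l < Suc M"
    then show "(S(M := S0)) l \<subseteq> I" "(\<Sum>i\<in>(S(M := S0)) l. \<bar>(A(M := a)) l i\<bar>) = 1"
      "norm (\<Sum>i\<in>(S(M := S0)) l. (A(M := a)) l i *\<^sub>R f i) \<le> c"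
      using SA(1)[of l] S0 by (auto simp: less_Suc_eq)
  next
    fix l l' assume "l < Suc M" "l' < Suc M" "l \<noteq> l'"
    then show "(S(M := S0)) l \<inter> (S(M := S0)) l' = {}"
      using SA(2)[of l l'] disj[of l] disj[of l'] by (auto simp: less_Suc_eq Int_commute)
  qed
qed

text \<open>Induction on \<open>j\<close>: disjoint combinations of norm at most \<open>c\<close>
  are rescaled into the unit ball, and the induction hypothesis is applied to them. Disjoint
  supports make the l1-norms multiply.\<close>

lemma small_l1_combination_iterated:
  fixes f :: "nat \<Rightarrow> 'e::real_normed_vector"
  assumes nP: "\<not> spread_system TYPE('e) N k c" and c: "0 < c" and k: "2 \<le> k"
    and I: "finite I" "(N + 1) * k ^ j \<le> card I + N" "\<forall>i\<in>I. norm (f i) \<le> 1"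
  shows "\<exists>a. (\<Sum>i\<in>I. \<bar>a i\<bar>) = 1 \<and> norm (\<Sum>i\<in>I. a i *\<^sub>R f i) \<le> c ^ j"
  using I
proof (induction j arbitrary: I f)
  case 0
  then have "I \<noteq> {}" by auto
  then obtain i where i: "i \<in> I" by blast
  then show ?case using 0
    by (intro exI[of _ "\<lambda>j. if j = i then 1 else 0"])
       (simp add: if_distrib[of abs] if_distrib[of "\<lambda>x. x *\<^sub>R _"] cong: if_cong)
next
  case (Suc j)
  \<comment> \<open>The fewest blocks the induction hypothesis accepts. Stating the size condition
    with \<open>card I + N\<close> makes it recur: \<open>k * N \<ge> 2 * N\<close> leaves the
    \<open>N\<close> spare indices that the extraction needs.\<close>
  define M where "M = (N + 1) * k ^ j - N"
  have "1 \<le> k ^ j" using k by simp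
  from mult_le_mono2[OF this, of "N + 1"] have "N + 1 \<le> (N + 1) * k ^ j" by (simp only: mult_1_right)
  then have M: "M + N = (N + 1) * k ^ j" unfolding M_def by linarith
  have "k * (M + N) \<le> card I + N" using Suc.prems(2) by (simp add: M mult_ac)
  moreover have "2 * N \<le> k * N" using k by simp
  ultimately have kM: "k * M + N \<le> card I" unfolding distrib_left by linarith
  obtain S A where SA':
    "(\<forall>l<M. S l \<subseteq> I \<and> (\<Sum>i\<in>S l. \<bar>A l i\<bar>) = 1 \<and>
     norm (\<Sum>i\<in>S l. A l i *\<^sub>R f i) \<le> c) \<and> (\<forall>l<M. \<forall>l'<M. l \<noteq> l' \<longrightarrow> S l \<inter> S l' = {})"
    using disjoint_l1_combinations[where f = f, OF nP c Suc.prems(1) kM Suc.prems(3)] by (elim exE)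
  then have SA: "\<And>l. l < M \<Longrightarrow> S l \<subseteq> I \<and> (\<Sum>i\<in>S l. \<bar>A l i\<bar>) = 1 \<and>
     norm (\<Sum>i\<in>S l. A l i *\<^sub>R f i) \<le> c" "\<And>l l'. l < M \<Longrightarrow> l' < M \<Longrightarrow> l \<noteq> l' \<Longrightarrow> S l \<inter> S l' = {}"
    by auto
  define g where "g l = (1 / c) *\<^sub>R (\<Sum>i\<in>S l. A l i *\<^sub>R f i)" for l
  have "\<exists>b. (\<Sum>l<M. \<bar>b l\<bar>) = 1 \<and> norm (\<Sum>l<M. b l *\<^sub>R g l) \<le> c ^ j"
    using M SA(1) c by (intro Suc.IH) (auto simp: g_def)
  then obtain b where b: "(\<Sum>l<M. \<bar>b l\<bar>) = 1" "norm (\<Sum>l<M. b l *\<^sub>R g l) \<le> c ^ j" by auto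
  have fS: "finite (S l)" if "l < M" for l using SA(1)[OF that] Suc.prems(1) finite_subset by blast
  \<comment> \<open>Disjointness leaves at most one summand that is not 0.\<close>
  define a where "a i = (\<Sum>l<M. if i \<in> S l then b l * A l i else 0)" for i
  have a: "a i = b l * A l i" if "l < M" "i \<in> S l" for i l
  proof -
    have "a i = (\<Sum>l'<M. if l' = l then b l * A l i else 0)"
      unfolding a_def using SA(2) that by (intro sum.cong) (auto split: if_splits)
    then show ?thesis using that by simp
  qed
  have a0: "a i = 0" if "i \<notin> (\<Union>l<M. S l)" for i using that by (auto simp: a_def)
  have US: "(\<Union>l<M. S l) \<subseteq> I" using SA(1) by auto
  have "(\<Sum>i\<in>I. \<bar>a i\<bar>) = (\<Sum>i\<in>(\<Union>l<M. S l). \<bar>a i\<bar>)"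
    using US a0 Suc.prems(1) by (intro sum.mono_neutral_right) auto
  also have "\<dots> = (\<Sum>l<M. \<Sum>i\<in>S l. \<bar>a i\<bar>)" using fS SA(2) by (intro sum.UNION_disjoint) auto
  also have "\<dots> = (\<Sum>l<M. \<bar>b l\<bar> * (\<Sum>i\<in>S l. \<bar>A l i\<bar>))"
    by (simp add: a abs_mult sum_distrib_left)
  also have "\<dots> = 1" using SA(1) b(1) by simp
  finally have 1: "(\<Sum>i\<in>I. \<bar>a i\<bar>) = 1" .
  have "(\<Sum>i\<in>I. a i *\<^sub>R f i) = (\<Sum>i\<in>(\<Union>l<M. S l). a i *\<^sub>R f i)"
    using US a0 Suc.prems(1) by (intro sum.mono_neutral_right) auto
  also have "\<dots> = (\<Sum>l<M. \<Sum>i\<in>S l. a i *\<^sub>R f i)" using fS SA(2) by (intro sum.UNION_disjoint) auto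
  also have "\<dots> = c *\<^sub>R (\<Sum>l<M. b l *\<^sub>R g l)"
    using c by (simp add: a g_def scaleR_sum_right mult_ac)
  finally have "norm (\<Sum>i\<in>I. a i *\<^sub>R f i) \<le> c ^ Suc j" using b(2) c by simp
  then show ?case using 1 by blast
qed

text \<open>The witnesses \<open>z\<close> and \<open>w\<close> for the sign pattern of
  \<open>a\<close> and for its complement differ by at least \<open>s\<close> in the right direction
  at every index, while \<open>norm (z - w) \<le> 2\<close>. This links fat shattering to l1 lower
  bounds.\<close>

lemma shattered_l1_lower:
  fixes f :: "'i \<Rightarrow> 'a::real_normed_vector \<Rightarrow>\<^sub>L real"
  assumes "\<And>T. T \<subseteq> \<sigma> \<Longrightarrow> \<exists>z. norm z \<le> 1 \<and> (\<forall>i\<in>T. h i + s \<le> blinfun_apply (f i) z) \<and>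
      (\<forall>i\<in>\<sigma> - T. blinfun_apply (f i) z \<le> h i)"
  shows "s / 2 * (\<Sum>i\<in>\<sigma>. \<bar>a i\<bar>) \<le> norm (\<Sum>i\<in>\<sigma>. a i *\<^sub>R f i)"
proof -
  define T where "T = {i\<in>\<sigma>. 0 \<le> a i}"
  have T: "T \<subseteq> \<sigma>" "\<sigma> - T \<subseteq> \<sigma>" "\<sigma> - (\<sigma> - T) = T" by (auto simp: T_def)
  obtain z where z: "norm z \<le> 1" "\<And>i. i \<in> T \<Longrightarrow> h i + s \<le> blinfun_apply (f i) z"
      "\<And>i. i \<in> \<sigma> - T \<Longrightarrow> blinfun_apply (f i) z \<le> h i" using assms[OF T(1)] by blast
  obtain w where w: "norm w \<le> 1" "\<And>i. i \<in> \<sigma> - T \<Longrightarrow> h i + s \<le> blinfun_apply (f i) w"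
      "\<And>i. i \<in> T \<Longrightarrow> blinfun_apply (f i) w \<le> h i" using assms[OF T(2)] unfolding T(3) by blast
  have "s * (\<Sum>i\<in>\<sigma>. \<bar>a i\<bar>) = (\<Sum>i\<in>\<sigma>. \<bar>a i\<bar> * s)" by (simp add: sum_distrib_left mult.commute)
  also have "\<dots> \<le> (\<Sum>i\<in>\<sigma>. a i * (blinfun_apply (f i) z - blinfun_apply (f i) w))"
  proof (rule sum_mono)
    fix i assume i: "i \<in> \<sigma>"
    show "\<bar>a i\<bar> * s \<le> a i * (blinfun_apply (f i) z - blinfun_apply (f i) w)"
    proof (cases "i \<in> T")
      case True
      then have "0 \<le> a i" "s \<le> blinfun_apply (f i) z - blinfun_apply (f i) w"
        using z(2)[OF True] w(3)[OF True] by (auto simp: T_def)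
      then show ?thesis by (simp add: mult_left_mono)
    next
      case False
      then have iT: "i \<in> \<sigma> - T" using i by blast
      then have "a i \<le> 0" "s \<le> - (blinfun_apply (f i) z - blinfun_apply (f i) w)"
        using z(3)[OF iT] w(2)[OF iT] by (auto simp: T_def)
      then have "- a i * s \<le> - a i * - (blinfun_apply (f i) z - blinfun_apply (f i) w)"
        by (intro mult_left_mono) auto
      then show ?thesis using \<open>a i \<le> 0\<close> by (simp add: algebra_simps)
    qed
  qed
  also have "\<dots> = blinfun_apply (\<Sum>i\<in>\<sigma>. a i *\<^sub>R f i) (z - w)"
    by (simp add: blinfun.sum_left blinfun.scaleR_left blinfun.diff_right right_diff_distrib sum_subtractf)
  also have "\<dots> \<le> norm (\<Sum>i\<in>\<sigma>. a i *\<^sub>R f i) * norm (z - w)"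
    using norm_blinfun[of "\<Sum>i\<in>\<sigma>. a i *\<^sub>R f i" "z - w"] by simp
  also have "\<dots> \<le> norm (\<Sum>i\<in>\<sigma>. a i *\<^sub>R f i) * 2"
    using norm_triangle_ineq4[of z w] z(1) w(1) by (intro mult_left_mono) auto
  finally show ?thesis by simp
qed

text \<open>\<open>F\<close> rounds values at scale \<open>s\<close>. A shattered set of more than
  \<open>d\<close> indices would give an l1 lower bound with constant
  \<open>s / 2 = 2 * c ^ j\<close>, against \<open>small_l1_combination_iterated\<close>. So
  \<open>separated_card_less\<close> bounds the separated sets, and a largest one is the
  net.\<close>

lemma entropy_net:
  fixes f :: "nat \<Rightarrow> 'a::real_normed_vector \<Rightarrow>\<^sub>L real"
  assumes nP: "\<not> spread_system TYPE('a \<Rightarrow>\<^sub>L real) N k c" and c: "1 / real k \<le> c" "c \<le> 1" and k: "2 \<le> k"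
    and I: "finite I" "card I \<le> k ^ J" "\<And>i. i \<in> I \<Longrightarrow> norm (f i) \<le> 1" and j: "j \<le> J"
  shows "\<exists>A\<subseteq>cball 0 1. finite A \<and> A \<noteq> {} \<and> card A \<le> 2 ^ (6 * k\<^sup>2 * (N + 1) * (J + 1)\<^sup>2 * k ^ j) \<and>
    (\<forall>z\<in>cball 0 1. \<exists>w\<in>A. \<forall>i\<in>I. \<bar>blinfun_apply (f i) z - blinfun_apply (f i) w\<bar> < 8 * c ^ j)"
proof -
  have c0: "0 < c" using c k by (intro less_le_trans[OF _ c(1)]) auto
  define s where "s = 4 * c ^ j"
  have s: "0 < s" using c0 by (simp add: s_def)
  define F where "F z i = nat \<lfloor>(blinfun_apply (f i) z + 1) / s\<rfloor>" for z i
  \<comment> \<open>Rounded values are at most \<open>2 / s\<close>, hence at most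
    \<open>k ^ j\<close> because \<open>c \<ge> 1 / k\<close>.\<close>
  define b where "b = k ^ j"
  define d where "d = (N + 1) * k ^ j"
  \<comment> \<open>\<open>k ^ J * (b + 1) + 1\<close> is at most \<open>k ^ (2 * J + 2)\<close>,
    and \<open>k < 2 ^ k\<close>, so this exponent meets the counting hypothesis of
    \<open>separated_card_less\<close>.\<close>
  define r where "r = k * (2 * J + 2) * d"
  define sep where "sep A \<longleftrightarrow> finite A \<and> A \<subseteq> cball 0 1 \<and> (\<forall>z\<in>A. \<forall>w\<in>A. z \<noteq> w \<longrightarrow>
     (\<exists>i\<in>I. 8 * c ^ j \<le> \<bar>blinfun_apply (f i) z - blinfun_apply (f i) w\<bar>))" for A
  have f1: "\<bar>blinfun_apply (f i) z\<bar> \<le> 1" if "i \<in> I" "norm z \<le> 1" for i z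
  proof -
    have "norm (blinfun_apply (f i) z) \<le> norm (f i) * norm z" by (rule norm_blinfun)
    also have "\<dots> \<le> 1 * 1" using that I(3) by (intro mult_mono) auto
    finally show ?thesis by simp
  qed
  have Fr: "real (F z i) \<le> (blinfun_apply (f i) z + 1) / s" "(blinfun_apply (f i) z + 1) / s < real (F z i) + 1"
    if "i \<in> I" "norm z \<le> 1" for i z
  proof -
    have "0 \<le> (blinfun_apply (f i) z + 1) / s" using f1[OF that] s by simp
    then have "real (F z i) = of_int \<lfloor>(blinfun_apply (f i) z + 1) / s\<rfloor>" by (simp add: F_def)
    then show "real (F z i) \<le> (blinfun_apply (f i) z + 1) / s" "(blinfun_apply (f i) z + 1) / s < real (F z i) + 1"
      by linarith+
  qed
  have ck: "1 / c ^ j \<le> real k ^ j"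
  proof -
    have "1 / c \<le> real k" using c c0 k by (simp add: field_simps)
    then have "(1 / c) ^ j \<le> real k ^ j" using c0 by (intro power_mono) auto
    then show ?thesis by (simp add: power_divide)
  qed
  have kpos: "1 \<le> k ^ x" for x using k by simp
  have dbl: "2 * k ^ x \<le> k ^ (x + 1)" for x using mult_le_mono1[OF k, of "k ^ x"] by simp
  have kJ: "k ^ j \<le> k ^ J" using j k by (intro power_increasing) auto
  have bound: "card A \<le> 2 ^ (6 * k\<^sup>2 * (N + 1) * (J + 1)\<^sup>2 * k ^ j)" if A: "sep A" for A
  proof -
    have A1: "norm z \<le> 1" if "z \<in> A" for z using A that by (auto simp: sep_def)
    have "card A < (2 * k ^ J * (b + 1)\<^sup>2) ^ r"
    proof (rule separated_card_less[OF I(1,2)])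
      show "0 < k ^ J" using k by simp
      show "finite A" using A by (simp add: sep_def)
      show "F z i \<le> b" if "z \<in> A" "i \<in> I" for z i
      proof -
        have "real (F z i) \<le> (1 + 1) / s"
          by (rule order_trans[OF Fr(1)[OF that(2) A1[OF that(1)]]])
             (use f1[OF that(2) A1[OF that(1)]] s in \<open>auto intro!: divide_right_mono\<close>)
        also have "\<dots> = (1 / c ^ j) / 2" by (simp add: s_def)
        also have "\<dots> \<le> 1 / c ^ j" 
        proof -
          have half: "x / 2 \<le> x" if "0 \<le> x" for x :: real using that by linarith
          show ?thesis by (rule half) (use c0 in simp)
        qed
        also have "\<dots> \<le> real b" using ck by (simp add: b_def)
        finally show ?thesis by simp
      qed
      show "\<exists>i\<in>I. F z i + 2 \<le> F w i \<or> F w i + 2 \<le> F z i" if zw: "z \<in> A" "w \<in> A" "z \<noteq> w" for z w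
      proof -
        obtain i where i: "i \<in> I" "8 * c ^ j \<le> \<bar>blinfun_apply (f i) z - blinfun_apply (f i) w\<bar>"
          using A zw unfolding sep_def by blast
        define x where "x = (blinfun_apply (f i) z + 1) / s"
        define y where "y = (blinfun_apply (f i) w + 1) / s"
        have "\<bar>x - y\<bar> = \<bar>blinfun_apply (f i) z - blinfun_apply (f i) w\<bar> / s"
          using s by (simp add: x_def y_def diff_divide_distrib[symmetric] abs_divide)
        then have "2 \<le> \<bar>x - y\<bar>" using i(2) s by (simp add: le_divide_eq s_def)
        moreover note Fr[OF i(1) A1[OF zw(1)]] Fr[OF i(1) A1[OF zw(2)]]
        ultimately have "real (F z i) + 2 < real (F w i) + 1 \<or> real (F w i) + 2 < real (F z i) + 1"
          unfolding x_def[symmetric] y_def[symmetric] by linarith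
        then have "F z i + 2 \<le> F w i \<or> F w i + 2 \<le> F z i" using \<open>2 \<le> \<bar>x - y\<bar>\<close> by linarith
        then show ?thesis using i(1) by blast
      qed
      show "card (fst ` G) \<le> d" if G: "G \<subseteq> I \<times> {..b}" "shatters A F G" for G
      proof (rule ccontr)
        assume neg: "\<not> ?thesis"
        have sub: "fst ` G \<subseteq> I" using G(1) by auto
        have fin: "finite (fst ` G)" using sub I(1) by (rule finite_subset)
        have "\<forall>i\<in>fst ` G. \<exists>h. (i, h) \<in> G" by auto
        from bchoice[OF this] obtain lev where lev: "\<And>i. i \<in> fst ` G \<Longrightarrow> (i, lev i) \<in> G" by blast
        \<comment> \<open>In the original scale the level \<open>lev i\<close> becomes
          \<open>lev i * s - 1\<close>; the strict integer inequalities on both sides leave a gap of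
          one step \<open>s\<close>.\<close>
        have "\<exists>z. norm z \<le> 1 \<and> (\<forall>i\<in>T. (real (lev i) * s - 1) + s \<le> blinfun_apply (f i) z) \<and>
            (\<forall>i\<in>fst ` G - T. blinfun_apply (f i) z \<le> real (lev i) * s - 1)" if T: "T \<subseteq> fst ` G" for T
        proof -
          have "{(i, h) \<in> G. i \<in> T} \<subseteq> G" by blast
          then obtain z where z: "z \<in> A" "\<forall>(i, h)\<in>{(i, h) \<in> G. i \<in> T}. h < F z i"
            "\<forall>(i, h)\<in>G - {(i, h) \<in> G. i \<in> T}. F z i < h"
            using G(2) unfolding shatters_def by blast
          show ?thesis
          proof (intro exI[of _ z] conjI ballI)
            show "norm z \<le> 1" using A1 z(1) by blast
            fix i assume i: "i \<in> T"
            then have iI: "i \<in> I" and iG: "(i, lev i) \<in> G" using T sub lev by auto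
            then have "lev i < F z i" using z(2) i by auto
            then have "real (lev i) + 1 \<le> real (F z i)" by linarith
            also have "\<dots> \<le> (blinfun_apply (f i) z + 1) / s" by (rule Fr(1)[OF iI A1[OF z(1)]])
            finally show "(real (lev i) * s - 1) + s \<le> blinfun_apply (f i) z"
              using s by (simp add: le_divide_eq algebra_simps)
          next
            fix i assume i: "i \<in> fst ` G - T"
            then have iI: "i \<in> I" and iG: "(i, lev i) \<in> G" using sub lev by auto
            then have "F z i < lev i" using z(3) i by auto
            then have "real (F z i) + 1 \<le> real (lev i)" by linarith
            with Fr(2)[OF iI A1[OF z(1)]] have "(blinfun_apply (f i) z + 1) / s \<le> real (lev i)" by linarith
            then show "blinfun_apply (f i) z \<le> real (lev i) * s - 1"
              using s by (simp add: divide_le_eq)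
          qed
        qed
        from shattered_l1_lower[OF this]
        have low: "s / 2 * (\<Sum>i\<in>fst ` G. \<bar>a i\<bar>) \<le> norm (\<Sum>i\<in>fst ` G. a i *\<^sub>R f i)" for a by blast
        have "(N + 1) * k ^ j \<le> card (fst ` G) + N" using neg by (simp add: d_def)
        with I(3) sub obtain a where a: "(\<Sum>i\<in>fst ` G. \<bar>a i\<bar>) = 1" "norm (\<Sum>i\<in>fst ` G. a i *\<^sub>R f i) \<le> c ^ j"
          using small_l1_combination_iterated[where f = f, OF nP c0 k fin] by blast
        then have "s / 2 \<le> c ^ j" using low[of a] by simp
        then show False using c0 by (simp add: s_def)
      qed
      have "b + 1 \<le> 2 * k ^ J" using kJ kpos[of J] by (simp add: b_def)
      also have "\<dots> \<le> k ^ (J + 1)" by (rule dbl)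
      finally have b1: "b + 1 \<le> k ^ (J + 1)" .
      have "k ^ J * (b + 1) + 1 \<le> k ^ J * k ^ (J + 1) + k ^ (2 * J + 1)"
        using b1 kpos[of "2 * J + 1"] by (intro add_mono mult_le_mono) auto
      also have "\<dots> = 2 * k ^ (2 * J + 1)" by (simp add: power_add mult_2)
      also have "\<dots> \<le> k ^ (2 * J + 2)" using dbl[of "2 * J + 1"] by simp
      finally have "(k ^ J * (b + 1) + 1) ^ d \<le> (k ^ (2 * J + 2)) ^ d" by (intro power_mono) auto
      also have "\<dots> = k ^ ((2 * J + 2) * d)" by (simp only: power_mult)
      also have "\<dots> < (2 ^ k) ^ ((2 * J + 2) * d)"
        using k by (intro power_strict_mono) (auto simp: d_def)
      also have "\<dots> = 2 ^ r" by (simp only: r_def power_mult mult.assoc)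
      finally show "(k ^ J * (b + 1) + 1) ^ d < 2 ^ r" .
    qed
    also have "\<dots> \<le> (k ^ (3 * J + 3)) ^ r"
    proof (intro power_mono)
      have "b + 1 \<le> 2 * k ^ J" using kJ kpos[of J] by (simp add: b_def)
      also have "\<dots> \<le> k ^ (J + 1)" by (rule dbl)
      finally have "2 * k ^ J * (b + 1)\<^sup>2 \<le> k * k ^ J * (k ^ (J + 1))\<^sup>2"
        using k by (intro mult_le_mono power_mono) auto
      also have "\<dots> = k ^ (3 * J + 3)" by (simp add: power2_eq_square power_add eval_nat_numeral)
      finally show "2 * k ^ J * (b + 1)\<^sup>2 \<le> k ^ (3 * J + 3)" .
    qed auto
    also have "\<dots> \<le> ((2 ^ k) ^ (3 * J + 3)) ^ r"
      using k by (intro power_mono less_imp_le[OF less_exp]) auto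
    also have "\<dots> = 2 ^ (k * (3 * J + 3) * r)" by (simp only: power_mult)
    also have "k * (3 * J + 3) * r = 6 * k\<^sup>2 * (N + 1) * (J + 1)\<^sup>2 * k ^ j"
      by (simp add: r_def d_def power2_eq_square algebra_simps)
    finally show ?thesis by simp
  qed
  define P where "P m \<longleftrightarrow> (\<exists>A. sep A \<and> card A = m)" for m
  have "sep {0}" by (simp add: sep_def)
  then have P1: "P 1" unfolding P_def by (intro exI[of _ "{0}"]) simp
  have PB: "\<And>m. P m \<Longrightarrow> m \<le> 2 ^ (6 * k\<^sup>2 * (N + 1) * (J + 1)\<^sup>2 * k ^ j)" using bound by (auto simp: P_def)
  \<comment> \<open>\<open>bound\<close> caps the sizes, so a separated set of greatest size exists.
    A point that it fails to approximate could be added to it.\<close>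
  have "P (Greatest P)" by (rule GreatestI_nat[of P 1, OF P1 PB])
  then obtain A where A: "sep A" "card A = Greatest P" by (auto simp: P_def)
  have max: "card B \<le> card A" if "sep B" for B
    unfolding A(2) by (rule Greatest_le_nat[of P, OF _ PB]) (use that in \<open>auto simp: P_def\<close>)
  have "1 \<le> card A" using max[OF \<open>sep {0}\<close>] by simp
  then have "A \<noteq> {}" by auto
  moreover have "\<exists>w\<in>A. \<forall>i\<in>I. \<bar>blinfun_apply (f i) z - blinfun_apply (f i) w\<bar> < 8 * c ^ j"
    if z: "z \<in> cball 0 1" for z
  proof (rule ccontr)
    assume neg: "\<not> ?thesis"
    then have zA: "z \<notin> A" using c0 by force
    have "sep (insert z A)" unfolding sep_def
    proof (intro conjI ballI impI)
      show "finite (insert z A)" "insert z A \<subseteq> cball 0 1" using A(1) z by (auto simp: sep_def)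
      fix x y assume xy: "x \<in> insert z A" "y \<in> insert z A" "x \<noteq> y"
      consider "x = z" "y \<in> A" | "y = z" "x \<in> A" | "x \<in> A" "y \<in> A" using xy by blast
      then show "\<exists>i\<in>I. 8 * c ^ j \<le> \<bar>blinfun_apply (f i) x - blinfun_apply (f i) y\<bar>"
      proof cases
        case 1 then show ?thesis using neg by (auto simp: not_less)
      next
        case 2 then show ?thesis using neg by (auto simp: not_less abs_minus_commute)
      next
        case 3 then show ?thesis using A(1) xy(3) unfolding sep_def by blast
      qed
    qed
    then show False using max[of "insert z A"] zA A(1) by (simp add: sep_def)
  qed
  moreover have "finite A" "A \<subseteq> cball 0 1" using A(1) by (auto simp: sep_def)
  ultimately show ?thesis using bound[OF A(1)] by blast
qed

section \<open>Rademacher averages\<close>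

abbreviation rad_exp :: "nat \<Rightarrow> ((nat \<Rightarrow> real) \<Rightarrow> real) \<Rightarrow> real" where
  "rad_exp m g \<equiv> measure_pmf.expectation (rademacher_pmf m) g"

lemma set_pmf_rademacher:
  "set_pmf (rademacher_pmf m) = PiE_dflt {..<m} 0 (\<lambda>_. {-1, 1})"
  unfolding rademacher_pmf_def by (subst set_Pi_pmf) (auto simp: o_def)

lemma rademacher_pmf_sign: "\<epsilon> \<in> set_pmf (rademacher_pmf m) \<Longrightarrow> i < m \<Longrightarrow> \<epsilon> i \<in> {-1, 1}"
  by (auto simp: set_pmf_rademacher PiE_dflt_def)

lemma integrable_rademacher [simp]:
  fixes g :: "_ \<Rightarrow> real"
  shows "integrable (measure_pmf (rademacher_pmf m)) g"
  by (rule integrable_measure_pmf_finite) (auto simp: set_pmf_rademacher intro!: finite_PiE_dflt)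

lemma rad_exp_mono:
  assumes "\<And>\<epsilon>. (\<And>i. i < m \<Longrightarrow> \<epsilon> i \<in> {-1, 1}) \<Longrightarrow> g \<epsilon> \<le> h \<epsilon>"
  shows "rad_exp m g \<le> rad_exp m h"
  by (rule integral_mono_AE) (auto simp: AE_measure_pmf_iff dest: rademacher_pmf_sign intro!: assms)

lemma rad_exp_nonneg:
  assumes "\<And>\<epsilon>. 0 \<le> g \<epsilon>" shows "0 \<le> rad_exp m g"
  using assms by simp

lemma rad_exp_exists_le:
  assumes "rad_exp m g \<le> c"
  shows "\<exists>\<epsilon>. (\<forall>i<m. \<epsilon> i \<in> {-1, 1}) \<and> g \<epsilon> \<le> c"
proof (rule ccontr)
  assume "\<not> ?thesis"
  then have "c < g \<epsilon>" if "\<forall>i<m. \<epsilon> i \<in> {-1, 1}" for \<epsilon>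
    using that by (meson not_le)
  then have gt: "c < g \<epsilon>" if "\<epsilon> \<in> set_pmf (rademacher_pmf m)" for \<epsilon>
    using rademacher_pmf_sign[OF that] by meson
  have "c < rad_exp m g"
    by (rule measure_pmf.expectation_greater) (auto simp: AE_measure_pmf_iff gt)
  then show False using assms by simp
qed

text \<open>The auxiliary estimate of Hoeffding's lemma at probability 1/2 and length
  \<open>2 * x\<close>, after factoring \<open>exp (- x)\<close> out of
  \<open>cosh x\<close>.\<close>

lemma cosh_le_exp_half_square: "cosh (x::real) \<le> exp (x\<^sup>2 / 2)"
proof -
  have nn: "cosh x \<le> exp (x\<^sup>2 / 2)" if x: "0 \<le> x" for x :: real
  proof -
    have c: "cosh x = exp (- x) * (1 + 1 / 2 * (exp (2 * x) - 1))"
    proof -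
      have "exp (2 * x) = exp x * exp x" unfolding mult_2 by (rule exp_add)
      then show ?thesis by (simp add: cosh_def exp_minus field_simps)
    qed
    have p: "0 < 1 + 1 / 2 * (exp (2 * x) - 1)" using x by (intro add_pos_nonneg) auto
    have "ln (cosh x) = - (2 * x) * (1 / 2) + ln (1 + 1 / 2 * (exp (2 * x) - 1))"
      unfolding c using p by (subst ln_mult_pos) auto
    also have "\<dots> \<le> (2 * x)\<^sup>2 / 8" by (rule Hoeffdings_lemma_aux) (use x in auto)
    also have "\<dots> = x\<^sup>2 / 2" by (simp add: power_mult_distrib)
    finally show ?thesis using cosh_real_pos[of x] by (metis exp_le_cancel_iff exp_ln)
  qed
  show ?thesis using nn[of "\<bar>x\<bar>"] by (cases "0 \<le> x") auto
qed

text \<open>Independence factors the expectation into values of \<open>cosh\<close>;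
  \<open>a\<close> is extended by 0 because the signs run over all of \<open>{..<m}\<close>.\<close>

lemma rad_exp_exp_sum:
  assumes "I \<subseteq> {..<m}"
  shows "rad_exp m (\<lambda>\<epsilon>. exp (\<Sum>i\<in>I. \<epsilon> i * a i)) \<le> exp ((\<Sum>i\<in>I. (a i)\<^sup>2) / 2)"
proof -
  define b where "b i = (if i \<in> I then a i else 0)" for i
  have eq: "(\<Sum>i\<in>I. \<epsilon> i * a i) = (\<Sum>i<m. \<epsilon> i * b i)" for \<epsilon> :: "nat \<Rightarrow> real"
    using assms by (intro sum.mono_neutral_cong_left) (auto simp: b_def)
  have "rad_exp m (\<lambda>\<epsilon>. exp (\<Sum>i\<in>I. \<epsilon> i * a i)) = rad_exp m (\<lambda>\<epsilon>. \<Prod>i<m. exp (\<epsilon> i * b i))"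
    by (simp add: eq exp_sum)
  also have "\<dots> = (\<Prod>i<m. measure_pmf.expectation (pmf_of_set {-1, 1}) (\<lambda>v. exp (v * b i)))"
    unfolding rademacher_pmf_def
    by (intro expectation_prod_Pi_pmf integrable_measure_pmf_finite) auto
  also have "\<dots> = (\<Prod>i<m. cosh (b i))"
    by (intro prod.cong refl) (simp add: integral_pmf_of_set cosh_def field_simps)
  also have "\<dots> \<le> (\<Prod>i<m. exp ((b i)\<^sup>2 / 2))"
    by (intro prod_mono) (auto simp: cosh_le_exp_half_square)
  also have "\<dots> = exp ((\<Sum>i<m. (b i)\<^sup>2) / 2)" by (simp add: exp_sum sum_divide_distrib)
  also have "(\<Sum>i<m. (b i)\<^sup>2) = (\<Sum>i\<in>I. (a i)\<^sup>2)"
    using assms by (intro sum.mono_neutral_cong_right) (auto simp: b_def)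
  finally show ?thesis .
qed

text \<open>For \<open>y > 2 * L\<close> one has \<open>y / 2 < y - L\<close>, and the quadratic
  Taylor term of the exponential suffices. This trades exponential moments for second
  moments.\<close>

lemma square_le_exp:
  fixes y L :: real
  assumes "0 \<le> y" "0 \<le> L"
  shows "y\<^sup>2 \<le> 4 * L\<^sup>2 + 8 * exp (y - L)"
proof (cases "y \<le> 2 * L")
  case True
  then have "y\<^sup>2 \<le> (2 * L)\<^sup>2" using assms by (intro power_mono)
  then show ?thesis by (simp add: power_mult_distrib add_increasing2)
next
  case False
  have "(y / 2)\<^sup>2 / 2 \<le> exp (y / 2)" using exp_lower_Taylor_quadratic[of "y / 2"] assms by simp
  also have "\<dots> \<le> exp (y - L)" using False by simp
  finally have "y\<^sup>2 \<le> 8 * exp (y - L)" by (simp add: power_divide)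
  then show ?thesis by (simp add: add_increasing)
qed

text \<open>Massart's maximal inequality in second-moment form: the exponential of the maximum is
  bounded by a sum over \<open>P\<close> and both signs, then \<open>square_le_exp\<close> is
  applied with \<open>L = 3 * M\<close>.\<close>

lemma massart_square:
  fixes a :: "'p \<Rightarrow> nat \<Rightarrow> real"
  assumes I: "I \<subseteq> {..<m}" "card I \<le> n" "0 < n" and P: "finite P" "P \<noteq> {}" "card P \<le> 2 ^ M" "0 < M"
    and \<tau>: "0 < \<tau>" "\<And>p i. p \<in> P \<Longrightarrow> i \<in> I \<Longrightarrow> \<bar>a p i\<bar> \<le> \<tau>"
  shows "rad_exp m (\<lambda>\<epsilon>. (Max ((\<lambda>p. \<bar>\<Sum>i\<in>I. \<epsilon> i * a p i\<bar>) ` P))\<^sup>2) \<le> 44 * real M * real n * \<tau>\<^sup>2"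
proof -
  define X where "X p \<epsilon> = (\<Sum>i\<in>I. \<epsilon> i * a p i)" for p and \<epsilon> :: "nat \<Rightarrow> real"
  define Y where "Y \<epsilon> = Max ((\<lambda>p. \<bar>X p \<epsilon>\<bar>) ` P)" for \<epsilon>
  \<comment> \<open>Tuned so that \<open>s\<^sup>2 * n * \<tau>\<^sup>2 = M\<close>: the exponent in
    each summand is then comparable with the logarithm of their number.\<close>
  define s where "s = sqrt (real M / real n) / \<tau>"
  have s: "0 < s" using P I \<tau> by (simp add: s_def)
  have s2: "s\<^sup>2 * (real n * \<tau>\<^sup>2) = real M" using I \<tau> by (simp add: s_def power_divide)
  have Y0: "0 \<le> Y \<epsilon>" for \<epsilon>
  proof -
    obtain p where "p \<in> P" using P by blast
    then have "\<bar>X p \<epsilon>\<bar> \<le> Y \<epsilon>" unfolding Y_def using P by (intro Max_ge) auto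
    then show ?thesis by (rule order_trans[rotated]) simp
  qed
  have expY: "exp (s * Y \<epsilon>) \<le> (\<Sum>p\<in>P. exp (\<Sum>i\<in>I. \<epsilon> i * (s * a p i)) + exp (\<Sum>i\<in>I. \<epsilon> i * (- s * a p i)))" for \<epsilon>
  proof -
    have "Y \<epsilon> \<in> (\<lambda>p. \<bar>X p \<epsilon>\<bar>) ` P" unfolding Y_def using P by (intro Max_in) auto
    then obtain p where p: "p \<in> P" "Y \<epsilon> = \<bar>X p \<epsilon>\<bar>" by blast
    have e: "(\<Sum>i\<in>I. \<epsilon> i * (t * a q i)) = t * X q \<epsilon>" for t q
      by (simp add: X_def sum_distrib_left mult_ac)
    have "exp (s * Y \<epsilon>) \<le> exp (s * X p \<epsilon>) + exp (- s * X p \<epsilon>)"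
      using p(2) by (cases "0 \<le> X p \<epsilon>") (auto simp: add_increasing2 add_increasing)
    also have "\<dots> \<le> (\<Sum>q\<in>P. exp (s * X q \<epsilon>) + exp (- s * X q \<epsilon>))"
      using P p(1) by (intro member_le_sum) (auto simp: add_nonneg_nonneg)
    finally show ?thesis unfolding e .
  qed
  have sub: "rad_exp m (\<lambda>\<epsilon>. exp (\<Sum>i\<in>I. \<epsilon> i * (t * a p i))) \<le> exp (real M)" if "p \<in> P" "t\<^sup>2 = s\<^sup>2" for p t
  proof -
    have "(\<Sum>i\<in>I. (t * a p i)\<^sup>2) \<le> (\<Sum>i\<in>I. s\<^sup>2 * \<tau>\<^sup>2)"
      unfolding power_mult_distrib that(2)
      using \<tau> that by (intro sum_mono mult_left_mono) (auto simp: abs_le_square_iff[symmetric])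
    also have "\<dots> \<le> real n * (s\<^sup>2 * \<tau>\<^sup>2)" using I by (simp add: mult_right_mono)
    also have "\<dots> = real M" using s2 by (simp add: mult_ac)
    finally have "(\<Sum>i\<in>I. (t * a p i)\<^sup>2) / 2 \<le> real M" by simp
    then show ?thesis using rad_exp_exp_sum[OF I(1), of "\<lambda>i. t * a p i"] by (meson exp_le_cancel_iff order_trans)
  qed
  have "rad_exp m (\<lambda>\<epsilon>. exp (s * Y \<epsilon>)) \<le>
      rad_exp m (\<lambda>\<epsilon>. \<Sum>p\<in>P. exp (\<Sum>i\<in>I. \<epsilon> i * (s * a p i)) + exp (\<Sum>i\<in>I. \<epsilon> i * (- s * a p i)))"
    by (rule rad_exp_mono) (rule expY)
  also have "\<dots> = (\<Sum>p\<in>P. rad_exp m (\<lambda>\<epsilon>. exp (\<Sum>i\<in>I. \<epsilon> i * (s * a p i))) + rad_exp m (\<lambda>\<epsilon>. exp (\<Sum>i\<in>I. \<epsilon> i * (- s * a p i))))"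
    by (simp add: Bochner_Integration.integral_sum Bochner_Integration.integral_add)
  also have "\<dots> \<le> (\<Sum>p\<in>P. exp (real M) + exp (real M))"
    by (intro sum_mono add_mono sub) auto
  also have "\<dots> = real (2 * card P) * exp (real M)" by simp
  also have "\<dots> \<le> exp (2 * real M) * exp (real M)"
  proof (intro mult_right_mono)
    have "2 * card P \<le> 2 ^ (M + M)"
    proof -
      have "2 \<le> (2::nat) ^ M" using P(4) self_le_power[of "2::nat" M] by simp
      then have "2 * card P \<le> 2 ^ M * 2 ^ M" using P(3) by (rule mult_le_mono)
      then show ?thesis by (simp add: power_add)
    qed
    then have "real (2 * card P) \<le> real (2 ^ (M + M))" by (rule of_nat_mono)
    also have "\<dots> = 2 ^ (M + M)" by simp
    also have "\<dots> \<le> exp 1 ^ (M + M)" using exp_ge_add_one_self[of 1] by (intro power_mono) auto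
    also have "\<dots> = exp (2 * real M)" by (simp flip: exp_of_nat_mult)
    finally show "real (2 * card P) \<le> exp (2 * real M)" .
  qed simp
  also have "\<dots> = exp (3 * real M)" by (simp flip: exp_add)
  finally have EE: "rad_exp m (\<lambda>\<epsilon>. exp (s * Y \<epsilon>)) \<le> exp (3 * real M)" .
  have "s\<^sup>2 * rad_exp m (\<lambda>\<epsilon>. (Y \<epsilon>)\<^sup>2) = rad_exp m (\<lambda>\<epsilon>. (s * Y \<epsilon>)\<^sup>2)"
    by (simp add: power_mult_distrib)
  also have "\<dots> \<le> rad_exp m (\<lambda>\<epsilon>. 4 * (3 * real M)\<^sup>2 + 8 * exp (- (3 * real M)) * exp (s * Y \<epsilon>))"
  proof (rule rad_exp_mono)
    fix \<epsilon>
    show "(s * Y \<epsilon>)\<^sup>2 \<le> 4 * (3 * real M)\<^sup>2 + 8 * exp (- (3 * real M)) * exp (s * Y \<epsilon>)"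
      using square_le_exp[of "s * Y \<epsilon>" "3 * real M"] s Y0[of \<epsilon>] by (simp add: exp_diff exp_minus field_simps)
  qed
  also have "\<dots> = 4 * (3 * real M)\<^sup>2 + 8 * exp (- (3 * real M)) * rad_exp m (\<lambda>\<epsilon>. exp (s * Y \<epsilon>))"
    by simp
  also have "\<dots> \<le> 4 * (3 * real M)\<^sup>2 + 8 * exp (- (3 * real M)) * exp (3 * real M)"
    using EE by (intro add_left_mono mult_left_mono) auto
  also have "\<dots> = 36 * (real M)\<^sup>2 + 8" by (simp add: power_mult_distrib flip: exp_add)
  also have "\<dots> \<le> 44 * (real M)\<^sup>2" using P(4) by simp
  also have "\<dots> = s\<^sup>2 * (44 * real M * real n * \<tau>\<^sup>2)"
    using s2 by (simp add: power2_eq_square mult_ac)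
  finally have "rad_exp m (\<lambda>\<epsilon>. (Y \<epsilon>)\<^sup>2) \<le> 44 * real M * real n * \<tau>\<^sup>2"
    using s by (simp add: mult_le_cancel_left)
  then show ?thesis by (simp add: Y_def X_def)
qed

text \<open>The triangle inequality in L2, obtained from Cauchy-Schwarz with the weights
  \<open>b j\<close>.\<close>

lemma rad_exp_minkowski_square:
  assumes "\<And>j. j \<in> L \<Longrightarrow> 0 < b j" "\<And>j. j \<in> L \<Longrightarrow> rad_exp m (\<lambda>\<epsilon>. (Y j \<epsilon>)\<^sup>2) \<le> (b j)\<^sup>2"
  shows "rad_exp m (\<lambda>\<epsilon>. (\<Sum>j\<in>L. Y j \<epsilon>)\<^sup>2) \<le> (\<Sum>j\<in>L. b j)\<^sup>2"
proof -
  have "rad_exp m (\<lambda>\<epsilon>. (\<Sum>j\<in>L. Y j \<epsilon>)\<^sup>2) \<le> rad_exp m (\<lambda>\<epsilon>. (\<Sum>j\<in>L. b j) * (\<Sum>j\<in>L. (Y j \<epsilon>)\<^sup>2 / b j))"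
  proof (rule rad_exp_mono)
    fix \<epsilon>
    have "(\<Sum>j\<in>L. Y j \<epsilon>) = (\<Sum>j\<in>L. sqrt (b j) * (Y j \<epsilon> / sqrt (b j)))"
      using assms(1) by (intro sum.cong) (fastforce simp: less_le)+
    also have "(\<dots>)\<^sup>2 \<le> (\<Sum>j\<in>L. (sqrt (b j))\<^sup>2) * (\<Sum>j\<in>L. (Y j \<epsilon> / sqrt (b j))\<^sup>2)"
      by (rule Cauchy_Schwarz_ineq_sum)
    also have "\<dots> = (\<Sum>j\<in>L. b j) * (\<Sum>j\<in>L. (Y j \<epsilon>)\<^sup>2 / b j)"
      using assms(1) by (intro arg_cong2[of _ _ _ _ "(*)"] sum.cong) (auto simp: power_divide less_imp_le)
    finally show "(\<Sum>j\<in>L. Y j \<epsilon>)\<^sup>2 \<le> (\<Sum>j\<in>L. b j) * (\<Sum>j\<in>L. (Y j \<epsilon>)\<^sup>2 / b j)" .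
  qed
  also have "\<dots> = (\<Sum>j\<in>L. b j) * (\<Sum>j\<in>L. rad_exp m (\<lambda>\<epsilon>. (Y j \<epsilon>)\<^sup>2) / b j)"
    by (simp add: Bochner_Integration.integral_sum)
  also have "\<dots> \<le> (\<Sum>j\<in>L. b j) * (\<Sum>j\<in>L. (b j)\<^sup>2 / b j)"
    using assms by (intro mult_left_mono sum_mono divide_right_mono sum_nonneg) (auto simp: less_imp_le)
  also have "\<dots> = (\<Sum>j\<in>L. b j)\<^sup>2"
    using assms(1) by (simp add: power2_eq_square)
  finally show ?thesis .
qed

section \<open>Chaining\<close>

lemma norm_blinfun_le_unit_ball:
  fixes f :: "'a::real_normed_vector \<Rightarrow>\<^sub>L real"
  assumes "\<And>z. norm z \<le> 1 \<Longrightarrow> \<bar>blinfun_apply f z\<bar> \<le> B"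
  shows "norm f \<le> B"
proof (rule norm_blinfun_bound)
  show "0 \<le> B" using assms[of 0] by simp
  fix x :: 'a
  show "norm (blinfun_apply f x) \<le> B * norm x"
  proof (cases "x = 0")
    case False
    then have "\<bar>blinfun_apply f ((1 / norm x) *\<^sub>R x)\<bar> \<le> B" by (intro assms) simp
    then show ?thesis using False by (simp add: blinfun.scaleR_right abs_mult field_simps)
  qed simp
qed

text \<open>Each point of the ball is reached through nets of scale \<open>8 * c ^ j\<close>,
  starting from 0. By \<open>massart_square\<close>, link \<open>j\<close> contributes in mean
  square a multiple of \<open>(k * c\<^sup>2) ^ (j + 1) * k ^ J\<close>. As
  \<open>k * c\<^sup>2 \<ge> 1\<close>, this is largest at the last link, where it is
  \<open>(k * c) ^ (2 * J)\<close>. The final approximation error is bounded trivially by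
  \<open>R\<close>.\<close>

lemma chaining_bound:
  fixes f :: "nat \<Rightarrow> 'a::real_normed_vector \<Rightarrow>\<^sub>L real"
  assumes nP: "\<not> spread_system TYPE('a \<Rightarrow>\<^sub>L real) N k c"
    and c: "1 / real k \<le> c" "c \<le> 1" "1 \<le> c * sqrt (real k)" and k: "2 \<le> k"
    and I: "I \<subseteq> {..<m}" "card I \<le> k ^ J" "\<And>i. i \<in> I \<Longrightarrow> norm (f i) \<le> 1"
  shows "rad_exp m (\<lambda>\<epsilon>. (norm (\<Sum>i\<in>I. \<epsilon> i *\<^sub>R f i))\<^sup>2) \<le>
    ((8 + 400 * (real k)\<^sup>2 * (real N + 1)) * (real J + 1)\<^sup>2 * (real k * c) ^ J)\<^sup>2"
proof -
  define Q where "Q = 6 * k\<^sup>2 * (N + 1) * (J + 1)\<^sup>2"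
  have c0: "0 < c" using c(1) k by (intro less_le_trans[OF _ c(1)]) auto
  have fI: "finite I" using I(1) finite_subset by blast
  have f1: "\<bar>blinfun_apply (f i) z\<bar> \<le> 1" if "i \<in> I" "norm z \<le> 1" for i z
  proof -
    have "norm (blinfun_apply (f i) z) \<le> norm (f i) * norm z" by (rule norm_blinfun)
    also have "\<dots> \<le> 1 * 1" using that I(3) by (intro mult_mono) auto
    finally show ?thesis by simp
  qed
  \<comment> \<open>At \<open>j = 0\<close> all values on the ball are within 8 of those at the
    origin, so the chain can start exactly at 0.\<close>
  define net where "net j A \<longleftrightarrow> A \<subseteq> cball 0 1 \<and> finite A \<and> A \<noteq> {} \<and> card A \<le> 2 ^ (Q * k ^ j) \<and>
    (\<forall>z\<in>cball 0 1. \<exists>w\<in>A. \<forall>i\<in>I. \<bar>blinfun_apply (f i) z - blinfun_apply (f i) w\<bar> < 8 * c ^ j) \<and> (j = 0 \<longrightarrow> A = {0})"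
    for j A
  have "\<exists>A. net j A" if j: "j \<le> J" for j
  proof (cases "j = 0")
    case True
    have "\<bar>blinfun_apply (f i) z\<bar> < 8" if "i \<in> I" "norm z \<le> 1" for i z using f1[OF that] by simp
    then show ?thesis using True by (intro exI[of _ "{0}"]) (auto simp: net_def)
  next
    case False
    then show ?thesis using entropy_net[where f = f, OF nP c(1,2) k fI I(2,3) j] unfolding net_def Q_def by auto
  qed
  then have "\<forall>j. \<exists>A. j \<le> J \<longrightarrow> net j A" by blast
  from choice[OF this] obtain A where net: "\<And>j. j \<le> J \<Longrightarrow> net j (A j)" by blast
  have A: "A j \<subseteq> cball 0 1" "finite (A j)" "A j \<noteq> {}" "card (A j) \<le> 2 ^ (Q * k ^ j)" if "j \<le> J" for j
    using net[OF that] by (simp_all add: net_def)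
  have A5: "\<exists>w\<in>A j. \<forall>i\<in>I. \<bar>blinfun_apply (f i) z - blinfun_apply (f i) w\<bar> < 8 * c ^ j"
    if "j \<le> J" "z \<in> cball 0 1" for j z
    using net[OF that(1)] that(2) unfolding net_def by (elim conjE) (rule bspec)
  have A6: "A 0 = {0}" using net[of 0] by (simp add: net_def)
  \<comment> \<open>Since \<open>k * c \<ge> 1\<close>, this dominates the sum of the approximation
    errors of two consecutive nets.\<close>
  define \<tau> where "\<tau> j = 16 * real k * c ^ Suc j" for j
  define P where "P j = {(u, v) \<in> A (Suc j) \<times> A j. \<forall>i\<in>I. \<bar>blinfun_apply (f i) u - blinfun_apply (f i) v\<bar> \<le> \<tau> j}" for j
  define Y where "Y j \<epsilon> = Max ((\<lambda>p. \<bar>\<Sum>i\<in>I. \<epsilon> i * (blinfun_apply (f i) (fst p) - blinfun_apply (f i) (snd p))\<bar>) ` P j)"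
    for j and \<epsilon> :: "nat \<Rightarrow> real"
  have \<tau>: "8 * c ^ Suc j + 8 * c ^ j \<le> \<tau> j" for j
  proof -
    have "1 \<le> real k * c" using c(1) k by (simp add: field_simps)
    then have "c ^ j * 1 \<le> c ^ j * (real k * c)" using c0 by (intro mult_left_mono) auto
    moreover have "c ^ Suc j \<le> c ^ j" using c0 c(2) by (intro power_decreasing) auto
    ultimately show ?thesis by (simp add: \<tau>_def algebra_simps)
  qed
  have near: "(u, v) \<in> P j" if "u \<in> A (Suc j)" "v \<in> A j"
    "\<forall>i\<in>I. \<bar>blinfun_apply (f i) z - blinfun_apply (f i) u\<bar> < 8 * c ^ Suc j"
    "\<forall>i\<in>I. \<bar>blinfun_apply (f i) z - blinfun_apply (f i) v\<bar> < 8 * c ^ j" for u v z j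
  proof -
    have "\<bar>blinfun_apply (f i) u - blinfun_apply (f i) v\<bar> \<le> \<tau> j" if "i \<in> I" for i
      using bspec[OF \<open>\<forall>i\<in>I. \<bar>blinfun_apply (f i) z - blinfun_apply (f i) u\<bar> < 8 * c ^ Suc j\<close> that]
        bspec[OF \<open>\<forall>i\<in>I. \<bar>blinfun_apply (f i) z - blinfun_apply (f i) v\<bar> < 8 * c ^ j\<close> that] \<tau>[of j]
      by linarith
    then show ?thesis using that by (auto simp: P_def)
  qed
  have fP: "finite (P j)" if "j < J" for j
    by (rule finite_subset[of _ "A (Suc j) \<times> A j"]) (use A(2) that in \<open>auto simp: P_def\<close>)
  define B where "B = 400 * (real k)\<^sup>2 * (real N + 1) * (real J + 1) * (real k * c) ^ J"
  have B: "0 < B" using k c0 by (auto simp: B_def intro!: mult_pos_pos add_nonneg_pos)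
  have EY: "rad_exp m (\<lambda>\<epsilon>. (Y j \<epsilon>)\<^sup>2) \<le> B\<^sup>2" if j: "j < J" for j
  proof -
    have neP: "P j \<noteq> {}"
    proof -
      obtain u where "u \<in> A (Suc j)" "\<forall>i\<in>I. \<bar>blinfun_apply (f i) 0 - blinfun_apply (f i) u\<bar> < 8 * c ^ Suc j"
        using A5[of "Suc j" 0] j by auto
      moreover obtain v where "v \<in> A j" "\<forall>i\<in>I. \<bar>blinfun_apply (f i) 0 - blinfun_apply (f i) v\<bar> < 8 * c ^ j"
        using A5[of j 0] j by auto
      ultimately show ?thesis using near[of u j v 0] by blast
    qed
    have "card (P j) \<le> card (A (Suc j) \<times> A j)" using A(2) j by (intro card_mono) (auto simp: P_def)
    also have "\<dots> \<le> 2 ^ (Q * k ^ Suc j) * 2 ^ (Q * k ^ j)"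
      unfolding card_cartesian_product using A(4)[of "Suc j"] A(4)[of j] j by (intro mult_le_mono) auto
    also have "\<dots> \<le> 2 ^ (2 * Q * k ^ Suc j)"
    proof -
      have "k ^ j \<le> k ^ Suc j" using k by (intro power_increasing) auto
      then have "Q * k ^ j \<le> Q * k ^ Suc j" by simp
      then have "Q * k ^ Suc j + Q * k ^ j \<le> 2 * Q * k ^ Suc j" by (simp only: mult_2 distrib_right add_left_mono)
      then show ?thesis unfolding power_add[symmetric] by (intro power_increasing) auto
    qed
    finally have cP: "card (P j) \<le> 2 ^ (2 * Q * k ^ Suc j)" .
    have "rad_exp m (\<lambda>\<epsilon>. (Y j \<epsilon>)\<^sup>2) \<le> 44 * real (2 * Q * k ^ Suc j) * real (k ^ J) * (\<tau> j)\<^sup>2"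
      unfolding Y_def
    proof (rule massart_square[OF I(1,2) _ fP[OF j] neP cP])
      show "0 < k ^ J" "0 < 2 * Q * k ^ Suc j" using k by (auto simp: Q_def)
      show "0 < \<tau> j" using k c0 by (simp add: \<tau>_def)
      show "\<bar>blinfun_apply (f i) (fst p) - blinfun_apply (f i) (snd p)\<bar> \<le> \<tau> j" if "p \<in> P j" "i \<in> I" for p i
        using that by (auto simp: P_def)
    qed
    \<comment> \<open>The constant is \<open>44 * 2 * 6 * 16\<^sup>2\<close>, rounded up next to
      \<open>400\<^sup>2\<close>.\<close>
    also have "\<dots> = 135168 * (real k)^4 * (real N + 1) * (real J + 1)\<^sup>2 * (real k * c\<^sup>2) ^ Suc j * real k ^ J"
      by (simp add: Q_def \<tau>_def power_mult_distrib power_mult[symmetric] mult.commute[of 2] algebra_simps power2_eq_square power4_eq_xxxx)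
    also have "\<dots> \<le> 160000 * (real k)^4 * (real N + 1)\<^sup>2 * (real J + 1)\<^sup>2 * (real k * c\<^sup>2) ^ J * real k ^ J"
    proof (intro mult_mono)
      have "1 \<le> (c * sqrt (real k))\<^sup>2" using c(3) by (simp add: one_le_power)
      then have "1 \<le> real k * c\<^sup>2" by (simp add: power_mult_distrib mult.commute)
      then show "(real k * c\<^sup>2) ^ Suc j \<le> (real k * c\<^sup>2) ^ J" using j by (intro power_increasing) auto
      show "real N + 1 \<le> (real N + 1)\<^sup>2" by (simp add: power2_eq_square)
    qed (use c0 in auto)
    also have "\<dots> = B\<^sup>2"
    proof -
      have "(real k * c\<^sup>2) ^ J * real k ^ J = ((real k * c) ^ J)\<^sup>2"
        by (simp add: power_mult_distrib power_mult[symmetric] power2_eq_square power_add[symmetric] mult_2_right mult_ac flip: power_mult)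
      moreover have "(real k)^4 = ((real k)\<^sup>2)\<^sup>2" by (simp flip: power_mult)
      ultimately show ?thesis unfolding B_def power_mult_distrib by (simp add: mult_ac)
    qed
    finally show ?thesis .
  qed
  define R where "R = 8 * (real k * c) ^ J"
  have R: "0 < R" using k c0 by (simp add: R_def)
  have pointwise: "norm (\<Sum>i\<in>I. \<epsilon> i *\<^sub>R f i) \<le> (\<Sum>j<J. Y j \<epsilon>) + R" if \<epsilon>: "\<And>i. i < m \<Longrightarrow> \<epsilon> i \<in> {-1, 1}" for \<epsilon>
  proof (rule norm_blinfun_le_unit_ball)
    fix z :: 'a assume z: "norm z \<le> 1"
    have "\<forall>j. \<exists>w. j \<le> J \<longrightarrow> w \<in> A j \<and> (\<forall>i\<in>I. \<bar>blinfun_apply (f i) z - blinfun_apply (f i) w\<bar> < 8 * c ^ j)"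
      using A5[of _ z] z unfolding mem_cball_0 by blast
    from choice[OF this] obtain w where w: "\<And>j. j \<le> J \<Longrightarrow> w j \<in> A j"
      "\<And>j. j \<le> J \<Longrightarrow> \<forall>i\<in>I. \<bar>blinfun_apply (f i) z - blinfun_apply (f i) (w j)\<bar> < 8 * c ^ j" by blast
    define x where "x j = (\<Sum>i\<in>I. \<epsilon> i * blinfun_apply (f i) (w j))" for j
    have "w 0 = 0" using w(1)[of 0] A6 by simp
    then have x0: "x 0 = 0" by (simp add: x_def)
    have "\<bar>x J\<bar> = \<bar>\<Sum>j<J. x (Suc j) - x j\<bar>" by (simp add: sum_lessThan_telescope x0)
    also have "\<dots> \<le> (\<Sum>j<J. \<bar>x (Suc j) - x j\<bar>)" by (rule sum_abs)
    also have "\<dots> \<le> (\<Sum>j<J. Y j \<epsilon>)"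
    proof (rule sum_mono)
      fix j assume "j \<in> {..<J}"
      then have j: "j < J" by simp
      have "(w (Suc j), w j) \<in> P j" 
        by (rule near[OF w(1) w(1) w(2) w(2)]) (use j in auto)
      moreover have "\<bar>x (Suc j) - x j\<bar> = \<bar>\<Sum>i\<in>I. \<epsilon> i * (blinfun_apply (f i) (fst (w (Suc j), w j)) - blinfun_apply (f i) (snd (w (Suc j), w j)))\<bar>"
        by (simp add: x_def right_diff_distrib sum_subtractf)
      ultimately show "\<bar>x (Suc j) - x j\<bar> \<le> Y j \<epsilon>" unfolding Y_def using fP[OF j]
        by (intro Max_ge finite_imageI) (auto intro!: rev_image_eqI)
    qed
    finally have xJ: "\<bar>x J\<bar> \<le> (\<Sum>j<J. Y j \<epsilon>)" .
    have "\<bar>(\<Sum>i\<in>I. \<epsilon> i * blinfun_apply (f i) z) - x J\<bar> = \<bar>\<Sum>i\<in>I. \<epsilon> i * (blinfun_apply (f i) z - blinfun_apply (f i) (w J))\<bar>"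
      by (simp add: x_def right_diff_distrib sum_subtractf)
    also have "\<dots> \<le> (\<Sum>i\<in>I. \<bar>\<epsilon> i * (blinfun_apply (f i) z - blinfun_apply (f i) (w J))\<bar>)" by (rule sum_abs)
    also have "\<dots> \<le> (\<Sum>i\<in>I. 8 * c ^ J)"
    proof (rule sum_mono)
      fix i assume i: "i \<in> I"
      have "\<bar>\<epsilon> i\<bar> = 1" using \<epsilon>[of i] subsetD[OF I(1) i] by auto
      then show "\<bar>\<epsilon> i * (blinfun_apply (f i) z - blinfun_apply (f i) (w J))\<bar> \<le> 8 * c ^ J"
        using bspec[OF w(2)[of J] i] by (simp add: abs_mult)
    qed
    also have "\<dots> = real (card I) * (8 * c ^ J)" by simp
    also have "\<dots> \<le> real (k ^ J) * (8 * c ^ J)" using I(2) c0 by (intro mult_right_mono) (auto simp: of_nat_mono simp del: of_nat_power)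
    also have "\<dots> = R" by (simp add: R_def power_mult_distrib)
    finally have "\<bar>(\<Sum>i\<in>I. \<epsilon> i * blinfun_apply (f i) z) - x J\<bar> \<le> R" .
    with xJ have "\<bar>\<Sum>i\<in>I. \<epsilon> i * blinfun_apply (f i) z\<bar> \<le> (\<Sum>j<J. Y j \<epsilon>) + R" by linarith
    then show "\<bar>blinfun_apply (\<Sum>i\<in>I. \<epsilon> i *\<^sub>R f i) z\<bar> \<le> (\<Sum>j<J. Y j \<epsilon>) + R"
      by (simp add: blinfun.sum_left blinfun.scaleR_left)
  qed
  \<comment> \<open>Treating the remainder as summand \<open>J\<close> lets the L2 triangle
    inequality handle it together with the links.\<close>
  define Y' where "Y' j \<epsilon> = (if j < J then Y j \<epsilon> else R)" for j \<epsilon>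
  have sumY': "(\<Sum>j<Suc J. Y' j \<epsilon>) = (\<Sum>j<J. Y j \<epsilon>) + R" for \<epsilon> by (simp add: Y'_def)
  have "rad_exp m (\<lambda>\<epsilon>. (norm (\<Sum>i\<in>I. \<epsilon> i *\<^sub>R f i))\<^sup>2) \<le> rad_exp m (\<lambda>\<epsilon>. (\<Sum>j<Suc J. Y' j \<epsilon>)\<^sup>2)"
    unfolding sumY' by (intro rad_exp_mono power_mono pointwise) auto
  also have "\<dots> \<le> (\<Sum>j<Suc J. if j < J then B else R)\<^sup>2"
    by (rule rad_exp_minkowski_square) (use B R EY in \<open>auto simp: Y'_def\<close>)
  also have "\<dots> = (real J * B + R)\<^sup>2" by simp
  also have "\<dots> \<le> ((8 + 400 * (real k)\<^sup>2 * (real N + 1)) * (real J + 1)\<^sup>2 * (real k * c) ^ J)\<^sup>2"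
  proof (rule power_mono)
    define D where "D = 400 * (real k)\<^sup>2 * (real N + 1)"
    define W where "W = (real k * c) ^ J"
    have D: "0 \<le> D" "0 \<le> W" using c0 by (auto simp: D_def W_def)
    have "real J * B \<le> (real J + 1) * B" using B by (intro mult_right_mono) auto
    also have "\<dots> = D * (real J + 1)\<^sup>2 * W" by (simp add: B_def D_def W_def power2_eq_square)
    finally have 1: "real J * B \<le> D * (real J + 1)\<^sup>2 * W" .
    have "1 \<le> (real J + 1)\<^sup>2" by (simp add: one_le_power)
    then have "8 * 1 * W \<le> 8 * (real J + 1)\<^sup>2 * W" using D by (intro mult_right_mono mult_left_mono) auto
    then have "R \<le> 8 * (real J + 1)\<^sup>2 * W" by (simp add: R_def W_def)
    with 1 have "real J * B + R \<le> (8 + D) * (real J + 1)\<^sup>2 * W" by (simp add: distrib_right)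
    then show "real J * B + R \<le> (8 + 400 * (real k)\<^sup>2 * (real N + 1)) * (real J + 1)\<^sup>2 * (real k * c) ^ J"
      by (simp add: D_def W_def)
  qed (use B R in auto)
  finally show ?thesis .
qed

section \<open>Type from the absence of spread systems\<close>

text \<open>With \<open>y\<close> the fourth root of \<open>x\<close> and
  \<open>1 / y = 1 + d\<close>, Bernoulli's inequality bounds \<open>(l + 2) * y ^ l\<close>. Its
  square times \<open>(y\<^sup>2) ^ l\<close> is therefore dominated by a geometric series.\<close>

lemma summable_quadratic_geometric:
  fixes x :: real
  assumes x: "0 < x" "x < 1"
  shows "summable (\<lambda>l. (real l + 2)\<^sup>2 * x ^ l)"
proof -
  define y where "y = sqrt (sqrt x)"
  have "y ^ 4 = (y\<^sup>2)\<^sup>2" by (simp flip: power_mult)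
  then have y: "0 < y" "y < 1" "y ^ 4 = x" using x by (auto simp: y_def)
  define d where "d = 1 / y - 1"
  have d: "0 < d" using y by (simp add: d_def field_simps)
  have yd: "y * (1 + d) = 1" using y by (simp add: d_def field_simps)
  have bound: "norm ((real l + 2)\<^sup>2 * x ^ l) \<le> (2 + 1 / d)\<^sup>2 * (y ^ 2) ^ l" for l
  proof -
    have "real l + 2 \<le> (2 + 1 / d) * (1 + real l * d)"
      using d by (simp add: field_simps)
    also have "\<dots> \<le> (2 + 1 / d) * (1 + d) ^ l"
      using d by (intro mult_left_mono Bernoulli_inequality) auto
    finally have "(real l + 2) * y ^ l \<le> (2 + 1 / d) * (1 + d) ^ l * y ^ l"
      using y by (intro mult_right_mono) auto
    also have "\<dots> = (2 + 1 / d) * (y * (1 + d)) ^ l" by (simp add: power_mult_distrib)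
    finally have "(real l + 2) * y ^ l \<le> 2 + 1 / d" by (simp add: yd)
    then have "((real l + 2) * y ^ l)\<^sup>2 * (y ^ 2) ^ l \<le> (2 + 1 / d)\<^sup>2 * (y ^ 2) ^ l"
      using y by (intro mult_right_mono power_mono) auto
    also have "((real l + 2) * y ^ l)\<^sup>2 * (y ^ 2) ^ l = (real l + 2)\<^sup>2 * x ^ l"
      by (simp add: y(3)[symmetric] power_mult_distrib flip: power_mult power_add) 
    finally show ?thesis using x by simp
  qed
  have "summable (\<lambda>l. (2 + 1 / d)\<^sup>2 * (y ^ 2) ^ l)"
    using y by (intro summable_mult summable_geometric) (simp add: power_less_one_iff)
  then show ?thesis by (rule summable_comparison_test'[of _ 0]) (rule bound)
qed

text \<open>Pointwise \<open>s powr p \<le> 1 + s\<^sup>2\<close> for \<open>s = Y / B\<close>. This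
  passes from second moments to the moments in the definition of type.\<close>

lemma rad_exp_powr_le:
  assumes B: "0 < B" and p: "1 \<le> p" "p \<le> 2" and Y: "\<And>\<epsilon>. 0 \<le> Y \<epsilon>" and E: "rad_exp m (\<lambda>\<epsilon>. (Y \<epsilon>)\<^sup>2) \<le> B\<^sup>2"
  shows "(rad_exp m (\<lambda>\<epsilon>. Y \<epsilon> powr p)) powr (1 / p) \<le> 2 * B"
proof -
  have "rad_exp m (\<lambda>\<epsilon>. Y \<epsilon> powr p) \<le> rad_exp m (\<lambda>\<epsilon>. B powr p * (1 + (Y \<epsilon>)\<^sup>2 / B\<^sup>2))"
  proof (rule rad_exp_mono)
    fix \<epsilon>
    have "(Y \<epsilon> / B) powr p \<le> 1 + (Y \<epsilon> / B)\<^sup>2"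
    proof (cases "Y \<epsilon> / B \<le> 1")
      case True
      then have "(Y \<epsilon> / B) powr p \<le> 1 powr p" using Y[of \<epsilon>] B p by (intro powr_mono2) auto
      then show ?thesis by (simp add: add_increasing2)
    next
      case False
      then have "(Y \<epsilon> / B) powr p \<le> (Y \<epsilon> / B) powr 2" using p by (intro powr_mono) auto
      also have "\<dots> = (Y \<epsilon> / B)\<^sup>2" using Y[of \<epsilon>] B False by (simp add: powr_numeral)
      finally show ?thesis by simp
    qed
    then have "B powr p * (Y \<epsilon> / B) powr p \<le> B powr p * (1 + (Y \<epsilon> / B)\<^sup>2)" by (intro mult_left_mono) auto
    moreover have "B powr p * (Y \<epsilon> / B) powr p = Y \<epsilon> powr p"
      using B Y[of \<epsilon>] by (simp flip: powr_mult)
    ultimately show "Y \<epsilon> powr p \<le> B powr p * (1 + (Y \<epsilon>)\<^sup>2 / B\<^sup>2)" by (simp add: power_divide)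
  qed
  also have "\<dots> = B powr p * (1 + rad_exp m (\<lambda>\<epsilon>. (Y \<epsilon>)\<^sup>2) / B\<^sup>2)"
    by (simp add: measure_pmf.prob_space)
  also have "\<dots> \<le> B powr p * (1 + 1)"
    using E B by (intro mult_left_mono add_left_mono) (auto simp: divide_le_eq)
  finally have le: "rad_exp m (\<lambda>\<epsilon>. Y \<epsilon> powr p) \<le> 2 * B powr p" by simp
  have "(rad_exp m (\<lambda>\<epsilon>. Y \<epsilon> powr p)) powr (1 / p) \<le> (2 * B powr p) powr (1 / p)"
    using le p by (intro powr_mono2 rad_exp_nonneg) auto
  also have "\<dots> = 2 powr (1 / p) * B" using B p by (simp add: powr_mult powr_powr)
  also have "\<dots> \<le> 2 powr 1 * B" using B p by (intro mult_right_mono powr_mono) auto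
  finally show ?thesis by simp
qed

text \<open>The vectors are grouped by size into levels \<open>I l\<close>, of norm at most
  \<open>\<rho> l\<close> and at most \<open>k ^ (l + 1)\<close> in number.
  \<open>chaining_bound\<close> with \<open>J = l + 1\<close> bounds level \<open>l\<close> by
  \<open>R * t l\<close>, and \<open>p < q\<close> makes \<open>t\<close> summable.\<close>

lemma type_of_not_spread_system:
  assumes nP: "\<not> spread_system TYPE('a::real_normed_vector \<Rightarrow>\<^sub>L real) N k (real k powr (- 1 + 1 / q))"
    and k: "2 \<le> k" and p: "1 \<le> p" "p < q" "q \<le> 2"
  shows "has_rademacher_type TYPE('a \<Rightarrow>\<^sub>L real) p"
proof -
  define \<kappa> where "\<kappa> = real k"
  have \<kappa>: "2 \<le> \<kappa>" "0 < \<kappa>" "1 < \<kappa>" using k by (auto simp: \<kappa>_def)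
  have q: "1 < q" "1 / q < 1 / p" "1 / 2 \<le> 1 / q" "1 / q \<le> 1" using p by (auto simp: field_simps)
  define c where "c = \<kappa> powr (- 1 + 1 / q)"
  \<comment> \<open>The third bound is where \<open>q \<le> 2\<close> enters.\<close>
  have c: "1 / real k \<le> c" "c \<le> 1" "1 \<le> c * sqrt (real k)"
  proof -
    have "\<kappa> powr (- 1) \<le> c" unfolding c_def using \<kappa> q by (intro powr_mono) auto
    then show "1 / real k \<le> c" using \<kappa> by (simp add: powr_minus_divide \<kappa>_def)
    have "c \<le> \<kappa> powr 0" unfolding c_def using \<kappa> q by (intro powr_mono) auto
    then show "c \<le> 1" using \<kappa> by simp
    have "c * sqrt (real k) = \<kappa> powr (- 1 + 1 / q + 1 / 2)"
      unfolding powr_add[of _ _ "1 / 2"] using \<kappa> by (simp add: c_def powr_half_sqrt \<kappa>_def)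
    also have "\<dots> \<ge> \<kappa> powr 0" using \<kappa> q by (intro powr_mono) auto
    finally show "1 \<le> c * sqrt (real k)" using \<kappa> by simp
  qed
  have kc: "(real k * c) ^ j = \<kappa> powr (real j / q)" for j
  proof -
    have "real k * c = \<kappa> powr 1 * \<kappa> powr (- 1 + 1 / q)" using \<kappa> by (simp add: c_def \<kappa>_def)
    also have "\<dots> = \<kappa> powr (1 / q)" unfolding powr_add[symmetric] by simp
    finally show ?thesis using \<kappa> by (simp add: powr_realpow[symmetric] powr_powr)
  qed
  define K where "K = 8 + 400 * (real k)\<^sup>2 * (real N + 1)"
  have K: "0 < K" unfolding K_def by (intro add_pos_nonneg) auto
  define x where "x = \<kappa> powr (1 / q - 1 / p)"
  have x: "0 < x" "x < 1" using \<kappa> q by (auto simp: x_def powr_less_one)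
  define t where "t l = K * \<kappa> powr (1 / q) * ((real l + 2)\<^sup>2 * x ^ l)" for l
  have t0: "0 < t l" for l using K \<kappa> x by (auto simp: t_def intro!: mult_pos_pos add_nonneg_pos)
  have st: "summable t" unfolding t_def by (intro summable_mult summable_quadratic_geometric x)
  define W where "W = suminf t"
  have W: "0 < W" unfolding W_def using st t0 by (intro suminf_pos)
  have main: "(rad_exp m (\<lambda>\<epsilon>. norm (\<Sum>i<m. \<epsilon> i *\<^sub>R u i) powr p)) powr (1 / p)
      \<le> 2 * W * (\<Sum>i<m. norm (u i) powr p) powr (1 / p)" for m and u :: "nat \<Rightarrow> 'a \<Rightarrow>\<^sub>L real"
  proof (cases "\<forall>i<m. u i = 0")
    case True
    then show ?thesis by simp
  next
    case False
    define S where "S = (\<Sum>i<m. norm (u i) powr p)"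
    define Pos where "Pos = {i. i < m \<and> u i \<noteq> 0}"
    have Pos: "finite Pos" "Pos \<subseteq> {..<m}" "Pos \<noteq> {}" using False by (auto simp: Pos_def)
    have SPos: "S = (\<Sum>i\<in>Pos. norm (u i) powr p)"
      unfolding S_def by (intro sum.mono_neutral_right) (auto simp: Pos_def)
    have S: "0 < S" unfolding SPos using Pos by (intro sum_pos) (auto simp: Pos_def)
    define R where "R = S powr (1 / p)"
    have R: "0 < R" "R powr p = S" using S p by (auto simp: R_def powr_powr)
    \<comment> \<open>For nonzero \<open>u i\<close>, \<open>norm (u i) powr p\<close> is
      \<open>S * \<kappa> powr (- tt i)\<close>, so the integer part of \<open>tt i\<close> sorts by
      size; \<open>tt i \<ge> 0\<close> because no term exceeds \<open>S\<close>.\<close>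
    define tt where "tt i = log \<kappa> (S / norm (u i) powr p)" for i
    define lev where "lev i = nat \<lfloor>tt i\<rfloor>" for i
    have lev: "real (lev i) \<le> tt i" "tt i < real (lev i) + 1" if i: "i \<in> Pos" for i
    proof -
      have "norm (u i) powr p \<le> S" unfolding SPos using Pos i by (intro member_le_sum) auto
      then have "1 \<le> S / norm (u i) powr p" using i by (simp add: Pos_def)
      then have "0 \<le> tt i" unfolding tt_def using \<kappa> by simp
      then have "real (lev i) = of_int \<lfloor>tt i\<rfloor>" by (simp add: lev_def)
      then show "real (lev i) \<le> tt i" "tt i < real (lev i) + 1" by linarith+
    qed
    have ktt: "\<kappa> powr tt i = S / norm (u i) powr p" if i: "i \<in> Pos" for i
      unfolding tt_def using i \<kappa> S by (intro powr_log_cancel) (auto simp: Pos_def)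
    define I where "I l = {i \<in> Pos. lev i = l}" for l
    have I: "I l \<subseteq> {..<m}" "finite (I l)" for l using Pos by (auto simp: I_def)
    define \<rho> where "\<rho> l = R * \<kappa> powr (- (real l / p))" for l
    have \<rho>: "0 < \<rho> l" for l using R \<kappa> by (simp add: \<rho>_def)
    have norm_le: "norm (u i) \<le> \<rho> l" if i: "i \<in> I l" for i l
    proof -
      have iP: "i \<in> Pos" "lev i = l" using i by (auto simp: I_def)
      have "\<kappa> powr real l \<le> \<kappa> powr tt i" using lev(1)[OF iP(1)] iP(2) \<kappa> by (intro powr_mono) auto
      then have "norm (u i) powr p \<le> S * \<kappa> powr (- real l)"
        unfolding ktt[OF iP(1)] using iP(1) \<kappa> by (simp add: Pos_def powr_minus field_simps)
      then have "(norm (u i) powr p) powr (1 / p) \<le> (S * \<kappa> powr (- real l)) powr (1 / p)"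
        using p by (intro powr_mono2) auto
      then show ?thesis using p S \<kappa> by (simp add: powr_powr powr_mult \<rho>_def R_def)
    qed
    \<comment> \<open>Each member of level \<open>l\<close> takes at least the fraction
      \<open>\<kappa> powr (- (l + 1))\<close> of \<open>S\<close>.\<close>
    have card_le: "card (I l) \<le> k ^ (l + 1)" for l
    proof -
      define s where "s = \<kappa> powr (real l + 1)"
      have s: "0 < s" "\<kappa> powr (- (real l + 1)) = 1 / s"
        using \<kappa> by (simp_all only: s_def powr_minus_divide powr_gt_zero)
      have "S * \<kappa> powr (- (real l + 1)) \<le> norm (u i) powr p" if i: "i \<in> I l" for i
      proof -
        have iP: "i \<in> Pos" "lev i = l" using i by (auto simp: I_def)
        have "\<kappa> powr tt i \<le> s" unfolding s_def using lev(2)[OF iP(1)] iP(2) \<kappa> by (intro powr_mono) auto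
        then show ?thesis unfolding ktt[OF iP(1)] s(2) using iP(1) s(1) by (simp add: Pos_def field_simps)
      qed
      then have "(\<Sum>i\<in>I l. S * \<kappa> powr (- (real l + 1))) \<le> (\<Sum>i\<in>I l. norm (u i) powr p)" by (rule sum_mono)
      also have "\<dots> \<le> S" unfolding SPos using Pos by (intro sum_mono2) (auto simp: I_def)
      finally have "real (card (I l)) * \<kappa> powr (- (real l + 1)) * S \<le> 1 * S" by (simp add: mult_ac)
      then have "real (card (I l)) * \<kappa> powr (- (real l + 1)) \<le> 1" using S by (simp only: mult_le_cancel_right_pos)
      then have "real (card (I l)) \<le> \<kappa> powr (real (l + 1))"
        unfolding s(2) using s(1) by (simp add: field_simps s_def)
      also have "\<dots> = real (k ^ (l + 1))" using \<kappa> by (subst powr_realpow) (auto simp: \<kappa>_def)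
      finally show ?thesis by (simp only: of_nat_le_iff)
    qed
    have EI: "rad_exp m (\<lambda>\<epsilon>. (norm (\<Sum>i\<in>I l. \<epsilon> i *\<^sub>R u i))\<^sup>2) \<le> (R * t l)\<^sup>2" for l
    proof -
      define f where "f i = (1 / \<rho> l) *\<^sub>R u i" for i
      have f: "norm (f i) \<le> 1" if "i \<in> I l" for i
        using norm_le[OF that] \<rho>[of l] by (simp add: f_def divide_le_eq)
      have "(norm (\<Sum>i\<in>I l. \<epsilon> i *\<^sub>R u i))\<^sup>2 = (\<rho> l)\<^sup>2 * (norm (\<Sum>i\<in>I l. \<epsilon> i *\<^sub>R f i))\<^sup>2" for \<epsilon> :: "nat \<Rightarrow> real"
      proof -
        have "(\<Sum>i\<in>I l. \<epsilon> i *\<^sub>R u i) = \<rho> l *\<^sub>R (\<Sum>i\<in>I l. \<epsilon> i *\<^sub>R f i)"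
          using \<rho>[of l] by (simp add: f_def scaleR_sum_right)
        then show ?thesis by (simp add: power_mult_distrib)
      qed
      then have "rad_exp m (\<lambda>\<epsilon>. (norm (\<Sum>i\<in>I l. \<epsilon> i *\<^sub>R u i))\<^sup>2) =
         (\<rho> l)\<^sup>2 * rad_exp m (\<lambda>\<epsilon>. (norm (\<Sum>i\<in>I l. \<epsilon> i *\<^sub>R f i))\<^sup>2)" by simp
      also have "\<dots> \<le> (\<rho> l)\<^sup>2 * (K * (real (l + 1) + 1)\<^sup>2 * (real k * c) ^ (l + 1))\<^sup>2"
        unfolding K_def using c k
        by (intro mult_left_mono chaining_bound[OF nP[folded \<kappa>_def, folded c_def]] I card_le f) auto
      also have "\<dots> = (\<rho> l * (K * (real l + 2)\<^sup>2 * \<kappa> powr ((real l + 1) / q)))\<^sup>2"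
        unfolding kc by (simp add: power_mult_distrib add_ac)
      also have "\<rho> l * (K * (real l + 2)\<^sup>2 * \<kappa> powr ((real l + 1) / q)) = R * t l"
      proof -
        have "x ^ l = \<kappa> powr ((1 / q - 1 / p) * real l)" using \<kappa> by (simp add: x_def powr_realpow[symmetric] powr_powr)
        moreover have "\<kappa> powr (- (real l / p)) * \<kappa> powr ((real l + 1) / q) = \<kappa> powr (1 / q) * \<kappa> powr ((1 / q - 1 / p) * real l)"
          unfolding powr_add[symmetric] by (rule arg_cong[of _ _ "\<lambda>s. \<kappa> powr s"]) (simp add: field_simps add_divide_distrib)
        ultimately show ?thesis by (simp add: \<rho>_def t_def mult_ac)
      qed
      finally show ?thesis .
    qed
    define L where "L = lev ` Pos"
    have L: "finite L" using Pos by (simp add: L_def)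
    have "norm (\<Sum>i<m. \<epsilon> i *\<^sub>R u i) \<le> (\<Sum>l\<in>L. norm (\<Sum>i\<in>I l. \<epsilon> i *\<^sub>R u i))" for \<epsilon> :: "nat \<Rightarrow> real"
    proof -
      have "(\<Sum>i<m. \<epsilon> i *\<^sub>R u i) = (\<Sum>i\<in>Pos. \<epsilon> i *\<^sub>R u i)"
        by (intro sum.mono_neutral_right) (auto simp: Pos_def)
      also have "\<dots> = (\<Sum>l\<in>L. \<Sum>i\<in>I l. \<epsilon> i *\<^sub>R u i)"
        unfolding L_def I_def by (rule sum.image_gen[OF Pos(1)])
      finally show ?thesis by (simp add: norm_sum)
    qed
    then have "rad_exp m (\<lambda>\<epsilon>. (norm (\<Sum>i<m. \<epsilon> i *\<^sub>R u i))\<^sup>2) \<le> rad_exp m (\<lambda>\<epsilon>. (\<Sum>l\<in>L. norm (\<Sum>i\<in>I l. \<epsilon> i *\<^sub>R u i))\<^sup>2)"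
      by (intro rad_exp_mono power_mono) auto
    also have "\<dots> \<le> (\<Sum>l\<in>L. R * t l)\<^sup>2"
      using R t0 EI by (intro rad_exp_minkowski_square) auto
    also have "\<dots> \<le> (R * W)\<^sup>2"
    proof (rule power_mono)
      have "(\<Sum>l\<in>L. t l) \<le> W" unfolding W_def using st L t0 by (intro sum_le_suminf) (auto simp: less_imp_le)
      then show "(\<Sum>l\<in>L. R * t l) \<le> R * W" using R by (simp flip: sum_distrib_left)
      show "0 \<le> (\<Sum>l\<in>L. R * t l)" using R t0 by (intro sum_nonneg) (auto simp: less_imp_le)
    qed
    finally have "(rad_exp m (\<lambda>\<epsilon>. norm (\<Sum>i<m. \<epsilon> i *\<^sub>R u i) powr p)) powr (1 / p) \<le> 2 * (R * W)"
      using R W p by (intro rad_exp_powr_le) auto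
    then show ?thesis by (simp add: R_def S_def mult_ac)
  qed
  show ?thesis unfolding has_rademacher_type_def using main p by (intro conjI exI[of _ "2 * W"] allI) auto
qed

section \<open>The Helly constant\<close>

text \<open>If there is no such point, \<open>finite_minimax\<close> gives a convex combination
  \<open>g\<close> with values at most \<open>c'\<close> on the ball. By symmetry of the ball
  \<open>norm g \<le> c' < c\<close>, against \<open>low\<close> for weights of sum 1.\<close>

lemma halfspaces_intersect:
  fixes f :: "'i \<Rightarrow> 'a::real_normed_vector \<Rightarrow>\<^sub>L real"
  assumes S: "finite S" and c: "c' < c"
    and low: "\<And>a. c * (\<Sum>i\<in>S. \<bar>a i\<bar>) \<le> norm (\<Sum>i\<in>S. a i *\<^sub>R f i)"
  shows "\<exists>z\<in>cball 0 1. \<forall>i\<in>S. c' < blinfun_apply (f i) z"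
proof (cases "S = {}")
  case True
  then show ?thesis by (intro bexI[of _ 0]) auto
next
  case False
  show ?thesis
  proof (rule ccontr)
    assume "\<not> ?thesis"
    then have neg: "\<exists>i\<in>S. blinfun_apply (f i) z \<le> c'" if "z \<in> cball 0 1" for z
      using that by (meson not_less)
    have "\<exists>w. (\<forall>i\<in>S. (0::real) \<le> w i) \<and> sum w S = 1 \<and>
        (\<forall>z\<in>cball 0 1. (\<Sum>i\<in>S. w i * blinfun_apply (f i) z) \<le> c')"
      by (rule finite_minimax[OF S False convex_cball])
         (auto intro: neg bounded_linear.linear blinfun.bounded_linear_right)
    then obtain w where w: "\<And>i. i \<in> S \<Longrightarrow> 0 \<le> w i" "sum w S = 1"
      "\<And>z. z \<in> cball 0 1 \<Longrightarrow> (\<Sum>i\<in>S. w i * blinfun_apply (f i) z) \<le> c'" by blast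
    define g where "g = (\<Sum>i\<in>S. w i *\<^sub>R f i)"
    have g: "blinfun_apply g z = (\<Sum>i\<in>S. w i * blinfun_apply (f i) z)" for z
      by (simp add: g_def blinfun.sum_left blinfun.scaleR_left)
    have "norm g \<le> c'"
    proof (rule norm_blinfun_le_unit_ball)
      fix z :: 'a assume "norm z \<le> 1"
      then have "blinfun_apply g z \<le> c'" "blinfun_apply g (- z) \<le> c'"
        using w(3)[of z] w(3)[of "- z"] by (auto simp: g)
      then show "\<bar>blinfun_apply g z\<bar> \<le> c'" by (simp add: blinfun.minus_right)
    qed
    moreover have "(\<Sum>i\<in>S. \<bar>w i\<bar>) = 1" using w(1,2) by simp
    ultimately show False using low[of w] c by (simp add: g_def)
  qed
qed

definition helly_admissible :: "'a::real_normed_vector itself \<Rightarrow> nat \<Rightarrow> real \<Rightarrow> bool" where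
  "helly_admissible _ k \<alpha> \<longleftrightarrow>
     (\<forall>F :: 'a set set.
        finite F \<and> (\<forall>C\<in>F. convex C \<and> C \<subseteq> cball 0 1) \<and>
        (\<forall>G. G \<subseteq> F \<and> card G \<le> k \<longrightarrow> \<Inter>G \<noteq> {}) \<longrightarrow>
        (\<exists>x. \<forall>C\<in>F. infdist x C \<le> \<alpha>))"

lemma helly_eq: "helly TYPE('a::banach) k = Inf {\<alpha>. 0 < \<alpha> \<and> helly_admissible TYPE('a) k \<alpha>}"
  by (simp add: helly_def helly_admissible_def)

text \<open>The origin works. This keeps the set under the infimum in \<open>helly_eq\<close>
  nonempty.\<close>

lemma helly_admissible_one:
  assumes "1 \<le> k" shows "helly_admissible TYPE('a::real_normed_vector) k 1"
  unfolding helly_admissible_def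
proof (intro allI impI exI[of _ 0] ballI)
  fix F and C :: "'a set"
  assume F: "finite F \<and> (\<forall>C\<in>F. convex C \<and> C \<subseteq> cball 0 1) \<and> (\<forall>G. G \<subseteq> F \<and> card G \<le> k \<longrightarrow> \<Inter>G \<noteq> {})"
    and C: "C \<in> F"
  have "\<forall>G. G \<subseteq> F \<and> card G \<le> k \<longrightarrow> \<Inter>G \<noteq> {}" using F by (elim conjE)
  from spec[OF this, of "{C}"] have "C \<noteq> {}" using C assms by simp
  then obtain y where "y \<in> C" by auto
  then have "infdist 0 C \<le> dist 0 y" by (rule infdist_le)
  moreover have "C \<subseteq> cball 0 1" using F C by blast
  then have "dist 0 y \<le> 1" using \<open>y \<in> C\<close> by auto
  ultimately show "infdist 0 C \<le> 1" by simp
qed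

text \<open>Some choice of signs does no worse than the mean, and type \<open>q\<close> bounds the
  mean.\<close>

lemma exists_signs_small_sum:
  assumes "has_rademacher_type TYPE('e::banach) q"
  shows "\<exists>T\<ge>0. \<forall>m (u :: nat \<Rightarrow> 'e). (\<forall>i<m. norm (u i) \<le> 1) \<longrightarrow>
    (\<exists>\<epsilon>. (\<forall>i<m. \<epsilon> i \<in> {-1, 1}) \<and> norm (\<Sum>i<m. \<epsilon> i *\<^sub>R u i) \<le> T * real m powr (1 / q))"
proof -
  obtain T where q: "1 \<le> q" and T: "\<And>m (u :: nat \<Rightarrow> 'e). (rad_exp m (\<lambda>\<epsilon>. norm (\<Sum>i<m. \<epsilon> i *\<^sub>R u i) powr q)) powr (1 / q)
          \<le> T * (\<Sum>i<m. norm (u i) powr q) powr (1 / q)"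
    using assms unfolding has_rademacher_type_def by blast
  show ?thesis
  proof (intro exI[of _ "\<bar>T\<bar>"] conjI allI impI)
    fix m and u :: "nat \<Rightarrow> 'e" assume u: "\<forall>i<m. norm (u i) \<le> 1"
    define E where "E = rad_exp m (\<lambda>\<epsilon>. norm (\<Sum>i<m. \<epsilon> i *\<^sub>R u i) powr q)"
    have E: "0 \<le> E" unfolding E_def by (rule rad_exp_nonneg) simp
    obtain \<epsilon> where \<epsilon>: "\<forall>i<m. \<epsilon> i \<in> {-1, 1}" "norm (\<Sum>i<m. \<epsilon> i *\<^sub>R u i) powr q \<le> E"
      using rad_exp_exists_le[of m "\<lambda>\<epsilon>. norm (\<Sum>i<m. \<epsilon> i *\<^sub>R u i) powr q" E] by (auto simp: E_def)
    have "norm (\<Sum>i<m. \<epsilon> i *\<^sub>R u i) = (norm (\<Sum>i<m. \<epsilon> i *\<^sub>R u i) powr q) powr (1 / q)"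
      using q by (simp add: powr_powr)
    also have "\<dots> \<le> E powr (1 / q)" using \<epsilon>(2) q by (intro powr_mono2) auto
    also have "\<dots> \<le> T * (\<Sum>i<m. norm (u i) powr q) powr (1 / q)" unfolding E_def by (rule T)
    also have "\<dots> \<le> \<bar>T\<bar> * (\<Sum>i<m. norm (u i) powr q) powr (1 / q)" by (intro mult_right_mono) auto
    also have "\<dots> \<le> \<bar>T\<bar> * real m powr (1 / q)"
    proof (intro mult_left_mono powr_mono2)
      have "norm (u i) powr q \<le> 1" if "i < m" for i
        using powr_mono2[of q "norm (u i)" 1] u that q by simp
      then have "(\<Sum>i<m. norm (u i) powr q) \<le> (\<Sum>i<m. 1)" by (intro sum_mono) auto
      then show "(\<Sum>i<m. norm (u i) powr q) \<le> real m" by simp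
    qed (use q in \<open>auto intro: sum_nonneg\<close>)
    finally show "\<exists>\<epsilon>. (\<forall>i<m. \<epsilon> i \<in> {-1, 1}) \<and> norm (\<Sum>i<m. \<epsilon> i *\<^sub>R u i) \<le> \<bar>T\<bar> * real m powr (1 / q)"
      using \<epsilon>(1) by blast
  qed simp
qed

text \<open>Any \<open>k\<close> of the sets \<open>C i\<close> meet by
  \<open>halfspaces_intersect\<close>, so some \<open>x\<close> is near all of them, and every
  \<open>g i x\<close> is almost at least \<open>c - \<alpha>\<close>. The signs make the average of
  the \<open>g i\<close> of order \<open>N powr (1 / q - 1)\<close>, which tends to 0 as
  \<open>q > 1\<close>.\<close>

lemma helly_admissible_ge:
  assumes type: "has_rademacher_type TYPE('a::real_normed_vector \<Rightarrow>\<^sub>L real) q" "1 < q"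
    and spread: "\<And>N. spread_system TYPE('a \<Rightarrow>\<^sub>L real) N k c"
    and k: "1 \<le> k" and \<alpha>: "0 < \<alpha>" "helly_admissible TYPE('a) k \<alpha>"
  shows "c \<le> \<alpha>"
proof (rule field_le_epsilon)
  fix \<eta> :: real assume \<eta>: "0 < \<eta>"
  obtain T where T: "0 \<le> T" and T2: "\<forall>m (u :: nat \<Rightarrow> 'a \<Rightarrow>\<^sub>L real). (\<forall>i<m. norm (u i) \<le> 1) \<longrightarrow>
    (\<exists>\<epsilon>. (\<forall>i<m. \<epsilon> i \<in> {-1, 1}) \<and> norm (\<Sum>i<m. \<epsilon> i *\<^sub>R u i) \<le> T * real m powr (1 / q))"
    using exists_signs_small_sum[OF type(1)] by (elim exE conjE)
  \<comment> \<open>One third of \<open>\<eta>\<close> pays for the strict half-spaces, another for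
    points that only almost realise the distance.\<close>
  define c' where "c' = c - \<eta> / 3"
  have main: "c' - \<alpha> - \<eta> / 3 \<le> (1 + \<alpha> + \<eta> / 3) * T * real N powr (1 / q - 1)" if N: "0 < N" for N
  proof -
    obtain I :: "nat set" and f0 :: "nat \<Rightarrow> 'a \<Rightarrow>\<^sub>L real" where I: "finite I" "card I = N"
      and f1: "\<forall>i\<in>I. norm (f0 i) \<le> 1"
      and f2: "\<forall>S\<subseteq>I. card S \<le> k \<longrightarrow> (\<forall>a. c * (\<Sum>i\<in>S. \<bar>a i\<bar>) \<le> norm (\<Sum>i\<in>S. a i *\<^sub>R f0 i))"
      using spread[of N, unfolded spread_system_def] by (elim exE conjE)
    have f0: "norm (f0 i) \<le> 1" if "i \<in> I" for i using f1 that by (rule bspec)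
    have f0': "c * (\<Sum>i\<in>S. \<bar>a i\<bar>) \<le> norm (\<Sum>i\<in>S. a i *\<^sub>R f0 i)" if "S \<subseteq> I" "card S \<le> k" for S a
      using f2 that by simp
    obtain h where h: "bij_betw h {..<N} I"
      using ex_bij_betw_nat_finite[OF I(1)] I(2) by (auto simp: atLeast0LessThan)
    have hI: "h i \<in> I" if "i < N" for i using bij_betwE[OF h] that by auto
    have "\<exists>\<epsilon>. (\<forall>i<N. \<epsilon> i \<in> {-1, 1}) \<and> norm (\<Sum>i<N. \<epsilon> i *\<^sub>R f0 (h i)) \<le> T * real N powr (1 / q)"
      by (rule T2[THEN spec, THEN spec, THEN mp]) (use f0 hI in auto)
    then obtain \<epsilon> where \<epsilon>': "\<forall>i<N. \<epsilon> i \<in> {-1, 1}"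
      "norm (\<Sum>i<N. \<epsilon> i *\<^sub>R f0 (h i)) \<le> T * real N powr (1 / q)"
      by (elim exE conjE)
    then have \<epsilon>: "\<And>i. i < N \<Longrightarrow> \<epsilon> i \<in> {-1, 1}"
      "norm (\<Sum>i<N. \<epsilon> i *\<^sub>R f0 (h i)) \<le> T * real N powr (1 / q)" by simp_all
    \<comment> \<open>Sign changes preserve the l1 lower bounds of the spread system, so the
      balancing signs can be absorbed.\<close>
    define g where "g i = \<epsilon> i *\<^sub>R f0 (h i)" for i
    have g1: "norm (g i) \<le> 1" if "i < N" for i using f0[OF hI[OF that]] \<epsilon>(1)[OF that] by (auto simp: g_def)
    have glow: "c * (\<Sum>i\<in>S. \<bar>a i\<bar>) \<le> norm (\<Sum>i\<in>S. a i *\<^sub>R g i)" if S: "S \<subseteq> {..<N}" "card S \<le> k" for S a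
    proof -
      define b where "b j = a (inv_into {..<N} h j) * \<epsilon> (inv_into {..<N} h j)" for j
      have inj: "inj_on h S" using h S(1) by (meson bij_betw_imp_inj_on inj_on_subset)
      have b: "b (h i) = a i * \<epsilon> i" if "i \<in> S" for i
        using h S(1) that by (simp add: b_def bij_betw_inv_into_left[OF h] subset_iff)
      have "h ` S \<subseteq> I" using hI S(1) by auto
      moreover have "card (h ` S) \<le> k" using card_image[OF inj] S(2) by simp
      ultimately have "c * (\<Sum>j\<in>h ` S. \<bar>b j\<bar>) \<le> norm (\<Sum>j\<in>h ` S. b j *\<^sub>R f0 j)" by (rule f0')
      moreover have "(\<Sum>j\<in>h ` S. \<bar>b j\<bar>) = (\<Sum>i\<in>S. \<bar>a i\<bar>)"
        unfolding sum.reindex[OF inj] o_def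
      proof (rule sum.cong)
        fix i assume i: "i \<in> S"
        have "\<epsilon> i \<in> {-1, 1}" using \<epsilon>(1) i S(1) by auto
        then show "\<bar>b (h i)\<bar> = \<bar>a i\<bar>" using b[OF i] by auto
      qed simp
      moreover have "(\<Sum>j\<in>h ` S. b j *\<^sub>R f0 j) = (\<Sum>i\<in>S. a i *\<^sub>R g i)"
        unfolding sum.reindex[OF inj] o_def by (intro sum.cong) (auto simp: b g_def)
      ultimately show ?thesis by simp
    qed
    define C where "C i = {z \<in> cball 0 1. c' < blinfun_apply (g i) z}" for i
    define F where "F = C ` {..<N}"
    have conv: "convex (C i)" for i
    proof -
      have lg: "linear (blinfun_apply (g i))" by (simp add: blinfun.bounded_linear_right bounded_linear.linear)
      have "convex (blinfun_apply (g i) -` {c'<..})"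
        by (rule convex_linear_vimage[OF lg]) (rule convex_real_interval)
      moreover have "C i = cball 0 1 \<inter> blinfun_apply (g i) -` {c'<..}" by (auto simp: C_def)
      ultimately show ?thesis by (simp add: convex_Int)
    qed
    have int: "\<Inter>G \<noteq> {}" if G: "G \<subseteq> F" "card G \<le> k" for G
    proof -
      \<comment> \<open>\<open>F\<close> is a set and the \<open>C i\<close> may coincide; an
        injective choice of indices keeps their number at most \<open>k\<close>.\<close>
      obtain S where S: "S \<subseteq> {..<N}" "inj_on C S" "G = C ` S"
        using G(1) unfolding F_def by (auto simp: subset_image_inj)
      have cS: "card S \<le> k" using G(2) card_image[OF S(2)] S(3) by simp
      have "\<exists>z\<in>cball 0 1. \<forall>i\<in>S. c' < blinfun_apply (g i) z"
        using S(1) \<eta> glow[OF S(1) cS]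
        by (intro halfspaces_intersect[of S c' c]) (auto simp: c'_def intro: finite_subset)
      then obtain z where "z \<in> cball 0 1" "\<forall>i\<in>S. c' < blinfun_apply (g i) z" by blast
      then have "z \<in> \<Inter>G" by (auto simp: S(3) C_def)
      then show ?thesis by blast
    qed
    have "finite F \<and> (\<forall>C\<in>F. convex C \<and> C \<subseteq> cball 0 1) \<and> (\<forall>G. G \<subseteq> F \<and> card G \<le> k \<longrightarrow> \<Inter>G \<noteq> {})"
      using conv int by (auto simp: F_def C_def)
    from mp[OF spec[OF \<alpha>(2)[unfolded helly_admissible_def]] this]
    obtain x where "\<forall>C\<in>F. infdist x C \<le> \<alpha>" by (elim exE)
    then have x: "infdist x (C i) \<le> \<alpha>" if "i < N" for i using that by (simp add: F_def)
    have near: "\<exists>y\<in>C i. dist x y < \<alpha> + \<eta> / 3" if i: "i < N" for i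
    proof -
      have "{C i} \<subseteq> F" "card {C i} \<le> k" using i k by (auto simp: F_def)
      then have "\<Inter>{C i} \<noteq> {}" by (rule int)
      then have ne: "C i \<noteq> {}" by simp
      have "infdist x (C i) < \<alpha> + \<eta> / 3" using x[OF i] \<eta> by simp
      then show ?thesis using ne cInf_lessD[of "(\<lambda>y. dist x y) ` C i"] by (auto simp: infdist_notempty)
    qed
    \<comment> \<open>\<open>x\<close> itself may lie outside the ball, but a nearby point of
      \<open>C 0\<close> does not.\<close>
    have xn: "norm x \<le> 1 + \<alpha> + \<eta> / 3"
    proof -
      obtain y where y: "y \<in> C 0" "dist x y < \<alpha> + \<eta> / 3" using near[OF N] by blast
      have "norm x \<le> norm y + norm (x - y)" by (metis add.commute diff_add_cancel norm_triangle_ineq)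
      then show ?thesis using y by (auto simp: C_def dist_norm)
    qed
    have gx: "c' - \<alpha> - \<eta> / 3 \<le> blinfun_apply (g i) x" if i: "i < N" for i
    proof -
      obtain y where y: "y \<in> C i" "dist x y < \<alpha> + \<eta> / 3" using near[OF i] by blast
      have "\<bar>blinfun_apply (g i) (x - y)\<bar> \<le> norm (g i) * norm (x - y)" using norm_blinfun[of "g i" "x - y"] by simp
      also have "\<dots> \<le> 1 * norm (x - y)" using g1[OF i] by (intro mult_right_mono) auto
      finally have "\<bar>blinfun_apply (g i) x - blinfun_apply (g i) y\<bar> \<le> dist x y"
        by (simp add: blinfun.diff_right dist_norm)
      then show ?thesis using y by (auto simp: C_def)
    qed
    have "real N * (c' - \<alpha> - \<eta> / 3) = (\<Sum>i<N. c' - \<alpha> - \<eta> / 3)" by simp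
    also have "\<dots> \<le> (\<Sum>i<N. blinfun_apply (g i) x)" using gx by (intro sum_mono) auto
    also have "\<dots> = blinfun_apply (\<Sum>i<N. g i) x" by (simp add: blinfun.sum_left)
    also have "\<dots> \<le> norm (\<Sum>i<N. g i) * norm x" using norm_blinfun[of "\<Sum>i<N. g i" x] by simp
    also have "\<dots> \<le> (T * real N powr (1 / q)) * (1 + \<alpha> + \<eta> / 3)"
      using \<epsilon>(2) xn T by (intro mult_mono) (auto simp: g_def)
    also have "real N powr (1 / q) = real N * real N powr (1 / q - 1)"
      using N by (simp add: powr_diff)
    finally have "real N * (c' - \<alpha> - \<eta> / 3) \<le> real N * ((1 + \<alpha> + \<eta> / 3) * T * real N powr (1 / q - 1))"
      by (simp add: mult_ac)
    then show ?thesis using N by (simp only: mult_le_cancel_left_pos of_nat_0_less_iff)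
  qed
  have "1 / q - 1 < 0" using type(2) by simp
  then have "((\<lambda>x::real. x powr (1 / q - 1)) \<longlongrightarrow> 0) at_top"
    using tendsto_neg_powr[OF _ filterlim_ident] by blast
  then have "(\<lambda>N. real N powr (1 / q - 1)) \<longlonglongrightarrow> 0"
    by (rule filterlim_compose[OF _ filterlim_real_sequentially])
  then have "(\<lambda>N. (1 + \<alpha> + \<eta> / 3) * T * real N powr (1 / q - 1)) \<longlonglongrightarrow> (1 + \<alpha> + \<eta> / 3) * T * 0"
    by (intro tendsto_intros)
  then have "c' - \<alpha> - \<eta> / 3 \<le> (1 + \<alpha> + \<eta> / 3) * T * 0"
    by (rule tendsto_lowerbound) (auto intro!: eventually_sequentiallyI[of 1] main)
  then show "c \<le> \<alpha> + \<eta>" using \<eta> by (simp add: c'_def)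
qed

text \<open>On at most \<open>k\<close> coordinates the l1-norm is at most \<open>sqrt k\<close>
  times the euclidean norm, to which \<open>Dvoretzky_Rogers\<close> applies.\<close>

lemma spread_system_inverse_sqrt:
  assumes inf: "\<not> (\<exists>B :: 'a::real_normed_vector set. finite B \<and> span B = UNIV)"
    and k: "1 \<le> k" and e: "0 < e" "e < 1"
  shows "spread_system TYPE('a \<Rightarrow>\<^sub>L real) N k ((1 - e) / sqrt (real k))"
proof -
  obtain f :: "nat \<Rightarrow> 'a \<Rightarrow>\<^sub>L real" where f: "\<And>i. i < N \<Longrightarrow> norm (f i) \<le> 1"
    "\<And>a. (1 - e) * L2_set a {..<N} \<le> norm (\<Sum>i<N. a i *\<^sub>R f i)"
    using Dvoretzky_Rogers[OF inf e(1), of N] by blast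
  have "(1 - e) / sqrt (real k) * (\<Sum>i\<in>S. \<bar>a i\<bar>) \<le> norm (\<Sum>i\<in>S. a i *\<^sub>R f i)"
    if S: "S \<subseteq> {..<N}" "card S \<le> k" for S a
  proof -
    have fS: "finite S" using S(1) finite_subset by blast
    define b where "b i = (if i \<in> S then a i else 0)" for i
    have "(\<Sum>i\<in>S. \<bar>a i\<bar> * 1) \<le> L2_set a S * L2_set (\<lambda>_. 1) S"
      using L2_set_mult_ineq[of a "\<lambda>_. 1" S] by simp
    also have "L2_set (\<lambda>_. 1) S = sqrt (real (card S))" by (simp add: L2_set_def)
    also have "L2_set a S * sqrt (real (card S)) \<le> L2_set a S * sqrt (real k)"
      using S(2) by (intro mult_left_mono) auto
    finally have "(\<Sum>i\<in>S. \<bar>a i\<bar>) / sqrt (real k) \<le> L2_set a S" using k by (simp add: divide_le_eq)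
    then have "(1 - e) * ((\<Sum>i\<in>S. \<bar>a i\<bar>) / sqrt (real k)) \<le> (1 - e) * L2_set a S"
      using e by (intro mult_left_mono) auto
    also have "L2_set a S = L2_set b {..<N}"
    proof -
      have "(\<Sum>i\<in>S. (a i)\<^sup>2) = (\<Sum>i<N. (b i)\<^sup>2)"
        using S(1) by (intro sum.mono_neutral_cong_left) (auto simp: b_def)
      then show ?thesis by (simp add: L2_set_def)
    qed
    also have "(1 - e) * L2_set b {..<N} \<le> norm (\<Sum>i<N. b i *\<^sub>R f i)" by (rule f(2))
    also have "(\<Sum>i<N. b i *\<^sub>R f i) = (\<Sum>i\<in>S. a i *\<^sub>R f i)"
      using S(1) by (intro sum.mono_neutral_cong_right) (auto simp: b_def)
    finally show ?thesis by simp
  qed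
  then show ?thesis unfolding spread_system_def using f(1)
    by (intro exI[of _ "{..<N}"] exI[of _ f]) auto
qed

text \<open>The triangle inequality. It makes the set of types nonempty, as reasoning about its
  supremum requires.\<close>

lemma has_rademacher_type_one: "has_rademacher_type TYPE('e::banach) 1"
  unfolding has_rademacher_type_def
proof (intro conjI exI[of _ 1] allI)
  fix m and u :: "nat \<Rightarrow> 'e"
  have "rad_exp m (\<lambda>\<epsilon>. norm (\<Sum>i<m. \<epsilon> i *\<^sub>R u i)) \<le> rad_exp m (\<lambda>\<epsilon>. \<Sum>i<m. norm (u i))"
  proof (rule rad_exp_mono)
    fix \<epsilon> :: "nat \<Rightarrow> real" assume \<epsilon>: "\<And>i. i < m \<Longrightarrow> \<epsilon> i \<in> {-1, 1}"
    show "norm (\<Sum>i<m. \<epsilon> i *\<^sub>R u i) \<le> (\<Sum>i<m. norm (u i))"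
      by (rule sum_norm_le) (use \<epsilon> in fastforce)
  qed
  also have "\<dots> = (\<Sum>i<m. norm (u i))" by (simp add: measure_pmf.prob_space)
  finally show "(rad_exp m (\<lambda>\<epsilon>. norm (\<Sum>i<m. \<epsilon> i *\<^sub>R u i) powr 1)) powr (1 / 1)
      \<le> 1 * (\<Sum>i<m. norm (u i) powr 1) powr (1 / 1)"
    by (simp add: sum_nonneg)
qed auto

lemma one_div_sqrt_le_helly_admissible:
  assumes inf: "\<not> (\<exists>B :: 'a::real_normed_vector set. finite B \<and> span B = UNIV)"
    and type: "has_rademacher_type TYPE('a \<Rightarrow>\<^sub>L real) q" "1 < q"
    and k: "1 \<le> k" and \<alpha>: "0 < \<alpha>" "helly_admissible TYPE('a) k \<alpha>"
  shows "1 / sqrt (real k) \<le> \<alpha>"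
proof (rule field_le_epsilon)
  fix \<eta> :: real assume \<eta>: "0 < \<eta>"
  define e where "e = min \<eta> (1 / 2)"
  have e: "0 < e" "e < 1" "e \<le> \<eta>" using \<eta> by (auto simp: e_def)
  have "(1 - e) / sqrt (real k) \<le> \<alpha>"
    by (rule helly_admissible_ge[OF type spread_system_inverse_sqrt[OF inf k e(1,2)] k \<alpha>])
  then have "1 / sqrt (real k) \<le> \<alpha> + e / sqrt (real k)" by (simp add: diff_divide_distrib)
  also have "e / sqrt (real k) \<le> e / 1" using e k by (intro divide_left_mono) auto
  finally show "1 / sqrt (real k) \<le> \<alpha> + \<eta>" using e by simp
qed

theorem theorem8p1:
  fixes k :: nat
  assumes infinite_dim: "\<not> (\<exists>B :: 'a::banach set. finite B \<and> span B = UNIV)"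
    and type_gt_1: "1 < supremal_type TYPE('a \<Rightarrow>\<^sub>L real)"
    and "1 \<le> k"
  shows "real k powr (- 1 + 1 / supremal_type TYPE('a \<Rightarrow>\<^sub>L real)) \<le> helly TYPE('a) k"
proof -
  define p where "p = supremal_type TYPE('a \<Rightarrow>\<^sub>L real)"
  define \<T> where "\<T> = {r. has_rademacher_type TYPE('a \<Rightarrow>\<^sub>L real) r}"
  have p_Sup: "p = Sup \<T>" by (simp add: p_def supremal_type_def \<T>_def)
  have \<T>2: "r \<le> 2" if "r \<in> \<T>" for r using that by (simp add: \<T>_def has_rademacher_type_def)
  have \<T>: "\<T> \<noteq> {}" "bdd_above \<T>"
    using has_rademacher_type_one \<T>2 by (auto simp: \<T>_def intro!: bdd_aboveI[of _ 2])
  have p2: "p \<le> 2" unfolding p_Sup using \<T>(1) \<T>2 by (rule cSup_least)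
  have p1: "1 < p" using type_gt_1 by (simp add: p_def)
  \<comment> \<open>Some type above 1, from which the signs are chosen; the supremum
    \<open>p\<close> itself need not be a type.\<close>
  obtain q0 where q0: "has_rademacher_type TYPE('a \<Rightarrow>\<^sub>L real) q0" "1 < q0"
    using p1 less_cSup_iff[OF \<T>, of 1] unfolding p_Sup by (auto simp: \<T>_def)
  have "real k powr (- 1 + 1 / p) \<le> \<alpha>" if \<alpha>: "0 < \<alpha>" "helly_admissible TYPE('a) k \<alpha>" for \<alpha>
  proof -
    note half = one_div_sqrt_le_helly_admissible[OF infinite_dim q0 \<open>1 \<le> k\<close> \<alpha>]
    consider "k = 1" | "p = 2" | "2 \<le> k" "p < 2" using \<open>1 \<le> k\<close> p2 by linarith
    then show ?thesis
    proof cases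
      case 1
      then show ?thesis using half by simp
    next
      case 2
      have "real k powr (- 1 + 1 / p) = 1 / sqrt (real k)"
        using \<open>1 \<le> k\<close> by (simp add: 2 powr_minus_divide powr_half_sqrt)
      then show ?thesis using half by simp
    next
      case 3
      \<comment> \<open>Failure of a spread system would give the type \<open>(p + q) / 2\<close>,
        which exceeds the supremum \<open>p\<close>.\<close>
      have le: "real k powr (- 1 + 1 / q) \<le> \<alpha>" if q: "p < q" "q < 2" for q
      proof (rule helly_admissible_ge[OF q0 _ \<open>1 \<le> k\<close> \<alpha>], rule ccontr)
        fix N assume "\<not> spread_system TYPE('a \<Rightarrow>\<^sub>L real) N k (real k powr (- 1 + 1 / q))"
        then have "has_rademacher_type TYPE('a \<Rightarrow>\<^sub>L real) ((p + q) / 2)"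
          by (rule type_of_not_spread_system) (use 3 p1 q in auto)
        then have "(p + q) / 2 \<le> p" unfolding p_Sup using \<T>(2) by (intro cSup_upper) (auto simp: \<T>_def)
        then show False using q by simp
      qed
      \<comment> \<open>Continuity in the exponent lets \<open>q\<close> decrease to
        \<open>p\<close>.\<close>
      have "((\<lambda>q. real k powr (- 1 + 1 / q)) \<longlongrightarrow> real k powr (- 1 + 1 / p)) (at_right p)"
        using 3 p1 by (intro tendsto_intros) auto
      moreover have "\<forall>\<^sub>F q in at_right p. real k powr (- 1 + 1 / q) \<le> \<alpha>"
        using eventually_at_right_real[OF 3(2)] by eventually_elim (use le in auto)
      ultimately show ?thesis by (rule tendsto_upperbound) simp
    qed
  qed
  moreover have "1 \<in> {\<alpha>. 0 < \<alpha> \<and> helly_admissible TYPE('a) k \<alpha>}"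
    using helly_admissible_one[OF \<open>1 \<le> k\<close>] by simp
  ultimately show ?thesis unfolding helly_eq p_def[symmetric]
    by (intro cInf_greatest) (blast, auto)
qed

end
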